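(* Let $\phi=(\phi_1,\phi_2)$ be a Lagrangian immersion of an orientable surface $\Sigma$ into $\mathbb{C}^2$ such that $\phi_1$ and $\phi_2$ do not vanish, and let $\psi_1,\psi_2$ be two Legendrian immersions of orientable manifolds $N_1$ and $N_2$ (of dimensions $n_1-1$ and $n_2-1$) into $\mathbb{S}^{2n_1-1}$ and $\mathbb{S}^{2n_2-1}$ respectively, with $n_1+n_2=n$. Then the map $$\Phi:\Sigma\times N_1\times N_2\to\mathbb{C}^n,\qquad \Phi(p,x,y)=(\phi_1(p)\psi_1(x),\phi_2(p)\psi_2(y)),$$ is a Lagrangian immersion with induced metric $$\bar g=g+|\phi_1|^2g_1+|\phi_2|^2g_2,$$ where $g,g_1,g_2$ are the induced metrics on $\Sigma,N_1,N_2$ respectively, and its Lagrangian angle map is $$\beta_\Phi(p,x,y)=(n_1-1)\pi+G_\phi(p)+\beta_{\psi_1}(x)+\beta_{\psi_2}(y),$$ where $\beta_{\psi_1},\beta_{\psi_2}$ are the Legendrian angle maps of $\psi_1,\psi_2$ and $G_\phi$ is the $\mathbb{R}/2\pi\mathbb{Z}$-valued map defined on $\Sigma$ by $$G_\phi:=\beta_\phi+(n_1-1)\arg\phi_1+(n_2-1)\arg\phi_2,$$ with $\beta_\phi$ the Lagrangian angle map of $\phi$. In addition, the gradient of $\beta_\Phi$ is given by $$\nabla_{\bar g}\beta_\Phi=\big(\nabla_gG_\phi,\ |\phi_1|^{-2}\nabla_{g_1}\beta_{\psi_1},\ |\phi_2|^{-2}\nabla_{g_2}\beta_{\psi_2}\big).$$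 Moreover, given vector fields $X,Y,Z$ on $\Sigma,N_1,N_2$ respectively, and denoting by $\bar D$ (resp. $D,D^1,D^2$) the Levi-Civita connection of $\bar g$ (resp. of $g,g_1,g_2$), we have $$\bar D_{(X,0,0)}\nabla_{\bar g}\beta_\Phi=\Big(D_X\nabla_gG_\phi,\ X(|\phi_1|^{-2})\nabla_{g_1}\beta_{\psi_1},\ X(|\phi_2|^{-2})\nabla_{g_2}\beta_{\psi_2}\Big),$$ $$\bar D_{(0,Y,0)}\nabla_{\bar g}\beta_\Phi=\Big(\frac{\nabla_g|\phi_1|^{-2}}{|\phi_1|^2}\,d\beta_{\psi_1}(Y),\ \frac{D^1_Y\nabla_{g_1}\beta_{\psi_1}}{|\phi_1|^2}+g(\nabla_gG_\phi,\nabla_g|\phi_1|^{-2})\,Y,\ 0\Big),$$ $$\bar D_{(0,0,Z)}\nabla_{\bar g}\beta_\Phi=\Big(\frac{\nabla_g|\phi_2|^{-2}}{|\phi_2|^2}\,d\beta_{\psi_2}(Z),\ 0,\ \frac{D^2_Z\nabla_{g_2}\beta_{\psi_2}}{|\phi_2|^2}+g(\nabla_gG_\phi,\nabla_g|\phi_2|^{-2})\,Z\Big),$$ and $$\Delta_{\bar g}\beta_\Phi=\frac{1}{|\phi_1|^{n_1-1}|\phi_2|^{n_2-1}}\,\mathrm{div}_g\Big(|\phi_1|^{n_1-1}|\phi_2|^{n_2-1}\nabla_gG_\phi\Big)+\frac{\Delta_{g_1}\beta_{\psi_1}}{|\phi_1|^2}+\frac{\Delta_{g_2}\beta_{\ps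i_2}}{|\phi_2|^2}.$$
   Context: On $\mathbb{C}^m$ put $(z,w)=\sum_j z_j\bar w_j$, $\langle\cdot,\cdot\rangle=\mathrm{Re}(\cdot,\cdot)$ (Euclidean metric), $\omega=-\mathrm{Im}(\cdot,\cdot)$ (symplectic form), and let $J$ be multiplication by $i$. An immersion of an $m$-manifold into $\mathbb{C}^m$ is Lagrangian if it pulls back $\omega$ to $0$. The Lagrangian angle of an oriented Lagrangian immersion $\Phi$ is the $\mathbb{R}/2\pi\mathbb{Z}$-valued map $\beta_\Phi=\arg\,(dz_1\wedge\dots\wedge dz_m)(d\Phi(e_1),\dots,d\Phi(e_m))$, where $(e_1,\dots,e_m)$ is any oriented tangent frame. The Liouville form $\Lambda$ is given by $2\Lambda_z(v)=\langle v,Jz\rangle$. An immersion $\psi$ of an $(m-1)$-manifold $N$ into the unit sphere $\mathbb{S}^{2m-1}\subset\mathbb{C}^m$ is Legendrian if $\psi^*\Lambda=0$. If $N$ is oriented, its Legendrian angle is the $\mathbb{R}/2\pi\mathbb{Z}$-valued map $\beta_\psi$ defined by $e^{i\beta_\psi(x)}=\det_{\mathbb{C}}\{\psi(x),d\psi(e_1),\dots,d\psi(e_{m-1})\}$ for any oriented orthonormal frame $(e_1,\dots,e_{m-1})$ of $T_xN$. Orientations of $\Sigma,N_1,N_2$ are fixed and $\Sigma\times N_1\times N_2$ carries the product orientation. For a non-vanishing complex function $f$, $\arg f\in\mathbb{R}/2\pi\mathbb{Z}$ is defined by $f=|f|e^{i\arg f}$. For a metric $h$, $\nabla_h$, $\mathrm{div}_h$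 and $\Delta_h=\mathrm{div}_h\nabla_h$ denote gradient, divergence and Laplacian; for $\mathbb{R}/2\pi\mathbb{Z}$-valued maps they are computed via local real-valued lifts. Tangent vectors of $\Sigma\times N_1\times N_2$ are written as triples.
   Formalization: The printed covariant-derivative coefficients are false; for i=1,2 the formal ones read ½X(|φ_i|^{-2}) for X(|φ_i|^{-2}), ½|φ_i|²∇_g|φ_i|^{-2} for |φ_i|^{-2}∇_g|φ_i|^{-2}, and -½|φ_i|²g(∇_gG_φ,∇_g|φ_i|^{-2}) for g(∇_gG_φ,∇_g|φ_i|^{-2}). *)

theory Defs
  imports "HOL-Analysis.Analysis" "HOL-Library.Real_Mod"
begin

section \<open>Angles: the group of reals modulo \<open>2\<pi>\<close>\<close>

quotient_type angle = real / "\<lambda>x y. [x = y] (rmod 2 * pi)"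
  by (rule equivpI) (auto intro!: reflpI sympI transpI intro: rcong_sym rcong_trans)

lift_definition angle_of :: "real \<Rightarrow> angle" is "\<lambda>x. x" .

instantiation angle :: ab_group_add
begin
lift_definition zero_angle :: angle is 0 .
lift_definition plus_angle :: "angle \<Rightarrow> angle \<Rightarrow> angle" is "(+)" by (rule rcong_add)
lift_definition uminus_angle :: "angle \<Rightarrow> angle" is uminus by (rule rcong_uminus)
lift_definition minus_angle :: "angle \<Rightarrow> angle \<Rightarrow> angle" is "(-)" by (rule rcong_diff)
instance by standard (transfer; simp add: algebra_simps)+
end

definition angle_mult :: "nat \<Rightarrow> angle \<Rightarrow> angle"
  where "angle_mult k a = (\<Sum>i<k. a)"

lemma cis_eq_cis_iff_rcong: "cis x = cis y \<longleftrightarrow> [x = y] (rmod 2 * pi)"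
proof -
  have "cis x = cis y \<longleftrightarrow> (\<exists>n. x = y + of_int n * (2 * pi))"
    using sin_cos_eq_iff[of x y] by (simp add: complex_eq_iff mult_ac conj_commute)
  also have "\<dots> \<longleftrightarrow> [y = x] (rmod 2 * pi)"
    by (simp add: rcong_altdef)
  finally show ?thesis
    by (simp add: rcong_sym_iff)
qed

text \<open>The map \<open>\<theta> \<mapsto> exp (i\<theta>)\<close>.\<close>

lift_definition angle_cis :: "angle \<Rightarrow> complex" is cis
  by (simp add: cis_eq_cis_iff_rcong)

definition carg :: "complex \<Rightarrow> angle"
  where "carg z = (THE \<theta>. z = of_real (cmod z) * angle_cis \<theta>)"

section \<open>Linear algebra\<close>

text \<open>The complex determinant of a list of \<open>m\<close> vectors of \<open>\<complex>\<^sup>m\<close>. The coordinates are numbered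
  \<open>0, \<dots>, m - 1\<close> by the order of the index type. (In the numeral types the literal \<open>m\<close> denotes
  the least element, so the coordinates must not be addressed by literals.)\<close>

definition coord_pos :: "'n::{finite,linorder} \<Rightarrow> nat"
  where "coord_pos i = card {j. j < i}"

definition cvec :: "complex list \<Rightarrow> complex ^ 'n::{finite,linorder}"
  where "cvec zs = (\<chi> i. zs ! coord_pos i)"

definition coords :: "complex ^ 'n::{finite,linorder} \<Rightarrow> complex list"
  where "coords z = map (\<lambda>i. z $ i) (sorted_list_of_set UNIV)"

definition cdet :: "(complex ^ 'n::{finite,linorder}) list \<Rightarrow> complex"
  where "cdet vs = det (\<chi> i j. (vs ! coord_pos j) $ i)"

text \<open>The Hermitian product. Its real part is the library's inner product, and its negated
  imaginary part is the symplectic form.\<close>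

definition hprod :: "complex ^ 'n::finite \<Rightarrow> complex ^ 'n \<Rightarrow> complex"
  where "hprod z w = (\<Sum>j\<in>UNIV. z $ j * cnj (w $ j))"

lemma Re_hprod: "Re (hprod z w) = z \<bullet> w"
  by (simp add: hprod_def inner_vec_def inner_complex_def)

definition symp :: "complex ^ 'n::finite \<Rightarrow> complex ^ 'n \<Rightarrow> real"
  where "symp z w = - Im (hprod z w)"

definition liouville :: "complex ^ 'n::finite \<Rightarrow> complex ^ 'n \<Rightarrow> real"
  where "liouville z v = (v \<bullet> (\<i> *s z)) / 2"

definition ordered_basis :: "'e::real_vector list \<Rightarrow> bool"
  where "ordered_basis B \<longleftrightarrow> distinct B \<and> independent (set B) \<and> span (set B) = UNIV"

text \<open>The determinant (Leibniz formula) of the coordinates of the vectors \<open>es\<close> in the basis \<open>B\<close>.\<close>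

definition frame_det :: "'e::real_vector list \<Rightarrow> 'e list \<Rightarrow> real"
  where "frame_det B es =
    (\<Sum>\<sigma> | \<sigma> permutes {..<length B}. of_int (sign \<sigma>) *
       (\<Prod>i<length B. representation (set B) (es ! i) (B ! \<sigma> i)))"

definition basis_trace :: "'e::real_vector list \<Rightarrow> ('e \<Rightarrow> 'e) \<Rightarrow> real"
  where "basis_trace B L = (\<Sum>i<length B. representation (set B) (L (B ! i)) (B ! i))"

section \<open>Smooth maps\<close>

text \<open>For finite-dimensional domains and open \<open>S\<close> this is the class \<open>C\<^sup>k\<close> on \<open>S\<close>: existence and
  continuity of all iterated directional derivatives up to order \<open>k\<close>.\<close>

primrec Ck_on :: "nat \<Rightarrow> 'e::real_normed_vector set \<Rightarrow> ('e \<Rightarrow> 'f::real_normed_vector) \<Rightarrow> bool"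
where
  "Ck_on 0 S f \<longleftrightarrow> continuous_on S f"
| "Ck_on (Suc k) S f \<longleftrightarrow> (\<forall>x\<in>S. f differentiable (at x)) \<and>
     (\<forall>v. Ck_on k S (\<lambda>x. frechet_derivative f (at x) v))"

definition smooth_on :: "'e::real_normed_vector set \<Rightarrow> ('e \<Rightarrow> 'f::real_normed_vector) \<Rightarrow> bool"
  where "smooth_on S f \<longleftrightarrow> (\<forall>k. Ck_on k S f)"

section \<open>Oriented smooth manifolds\<close>

text \<open>A manifold is a whole type \<open>'a\<close> with an atlas of charts \<open>(U, \<kappa>)\<close> into a finite-dimensional
  real vector space \<open>'e\<close>; its dimension is the length of the ordered basis \<open>model_frame\<close>,
  which fixes the orientation of \<open>'e\<close>. The class \<open>real_normed_vector\<close> is used for \<open>'e\<close> instead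
  of \<open>euclidean_space\<close> because the latter has no 0-dimensional instance; 0-dimensional manifolds
  carry the positive orientation at each point.

  One chart \<open>chart_at x\<close> around each point is distinguished. It identifies the tangent space at
  \<open>x\<close> with \<open>'e\<close>, so tangent vectors are elements of \<open>'e\<close> and those of a product are tuples.\<close>

type_synonym ('a, 'e) chart = "'a set \<times> ('a \<Rightarrow> 'e)"

record ('a, 'e) manifold =
  atlas :: "('a, 'e) chart set"
  chart_at :: "'a \<Rightarrow> ('a, 'e) chart"
  model_frame :: "'e list"

definition chart_inv :: "('a, 'e) chart \<Rightarrow> 'e \<Rightarrow> 'a"
  where "chart_inv c = inv_into (fst c) (snd c)"

definition oriented_manifold ::
  "('a::{t2_space,second_countable_topology}, 'e::real_normed_vector) manifold \<Rightarrow> bool"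
where
  "oriented_manifold M \<longleftrightarrow>
     ordered_basis (model_frame M) \<and>
     (\<forall>(U, \<kappa>)\<in>atlas M. open U \<and> open (\<kappa> ` U) \<and> homeomorphism U (\<kappa> ` U) \<kappa> (inv_into U \<kappa>)) \<and>
     (\<forall>x. chart_at M x \<in> atlas M \<and> x \<in> fst (chart_at M x)) \<and>
     (\<forall>(U, \<kappa>)\<in>atlas M. \<forall>(V, \<mu>)\<in>atlas M.
        smooth_on (\<kappa> ` (U \<inter> V)) (\<mu> \<circ> inv_into U \<kappa>) \<and>
        (\<forall>x\<in>U \<inter> V. frame_det (model_frame M)
           (map (frechet_derivative (\<mu> \<circ> inv_into U \<kappa>) (at (\<kappa> x))) (model_frame M)) > 0))"

definition mdim :: "('a, 'e) manifold \<Rightarrow> nat"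
  where "mdim M = length (model_frame M)"

text \<open>The product manifold with the product orientation.\<close>

definition mprod ::
  "('a, 'e::zero) manifold \<Rightarrow> ('b, 'f::zero) manifold \<Rightarrow> ('a \<times> 'b, 'e \<times> 'f) manifold"
  (infixr \<open>\<times>\<^sub>M\<close> 80)
where
  "mprod M N = \<lparr>
     atlas = {(U \<times> V, map_prod \<kappa> \<mu>) | U \<kappa> V \<mu>. (U, \<kappa>) \<in> atlas M \<and> (V, \<mu>) \<in> atlas N},
     chart_at = (\<lambda>(x, y). (fst (chart_at M x) \<times> fst (chart_at N y),
                            map_prod (snd (chart_at M x)) (snd (chart_at N y)))),
     model_frame = map (\<lambda>v. (v, 0)) (model_frame M) @ map (\<lambda>w. (0, w)) (model_frame N)\<rparr>"

definition msmooth_on :: "('a::topological_space, 'e::real_normed_vector) manifold \<Rightarrow> 'a set \<Rightarrow>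
    ('a \<Rightarrow> 'f::real_normed_vector) \<Rightarrow> bool"
  where "msmooth_on M W f \<longleftrightarrow>
    (\<forall>c\<in>atlas M. smooth_on (snd c ` (fst c \<inter> W)) (f \<circ> chart_inv c))"

definition mderiv :: "('a, 'e::real_normed_vector) manifold \<Rightarrow>
    ('a \<Rightarrow> 'f::real_normed_vector) \<Rightarrow> 'a \<Rightarrow> 'e \<Rightarrow> 'f"
  where "mderiv M f x =
    frechet_derivative (f \<circ> chart_inv (chart_at M x)) (at (snd (chart_at M x) x))"

text \<open>The differential of an angle-valued map, computed by local smooth real-valued lifts \<open>b\<close>.\<close>

definition mderiv_angle :: "('a::topological_space, 'e::real_normed_vector) manifold \<Rightarrow>
    ('a \<Rightarrow> angle) \<Rightarrow> 'a \<Rightarrow> 'e \<Rightarrow> real"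
  where "mderiv_angle M \<beta> x =
    (THE d. \<exists>W b. open W \<and> x \<in> W \<and> msmooth_on M W b \<and> (\<forall>y\<in>W. angle_of (b y) = \<beta> y) \<and>
       d = mderiv M b x)"

text \<open>The coordinate expression, in the chart \<open>c\<close>, of a vector field.\<close>

definition field_in_chart :: "('a, 'e::real_normed_vector) manifold \<Rightarrow> ('a, 'e) chart \<Rightarrow>
    ('a \<Rightarrow> 'e) \<Rightarrow> 'e \<Rightarrow> 'e"
  where "field_in_chart M c X u = mderiv M (snd c) (chart_inv c u) (X (chart_inv c u))"

definition smooth_field_on :: "('a::topological_space, 'e::real_normed_vector) manifold \<Rightarrow>
    'a set \<Rightarrow> ('a \<Rightarrow> 'e) \<Rightarrow> bool"
  where "smooth_field_on M W X \<longleftrightarrow>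
    (\<forall>c\<in>atlas M. smooth_on (snd c ` (fst c \<inter> W)) (field_in_chart M c X))"

definition lie_bracket :: "('a, 'e::real_normed_vector) manifold \<Rightarrow>
    ('a \<Rightarrow> 'e) \<Rightarrow> ('a \<Rightarrow> 'e) \<Rightarrow> 'a \<Rightarrow> 'e"
  where "lie_bracket M X Y x =
    (let c = chart_at M x; u = snd c x in
       frechet_derivative (field_in_chart M c Y) (at u) (X x) -
       frechet_derivative (field_in_chart M c X) (at u) (Y x))"

text \<open>An oriented tangent frame, at any point: the charts \<open>chart_at\<close> belong to the oriented atlas.\<close>

definition oriented_frame :: "('a, 'e::real_normed_vector) manifold \<Rightarrow> 'e list \<Rightarrow> bool"
  where "oriented_frame M es \<longleftrightarrow> length es = mdim M \<and> frame_det (model_frame M) es > 0"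

section \<open>Riemannian metrics and the Levi-Civita connection\<close>

type_synonym ('a, 'e) metric = "'a \<Rightarrow> 'e \<Rightarrow> 'e \<Rightarrow> real"

definition orthonormal :: "('a, 'e) metric \<Rightarrow> 'a \<Rightarrow> 'e list \<Rightarrow> bool"
  where "orthonormal g x es \<longleftrightarrow>
    (\<forall>i<length es. \<forall>j<length es. g x (es ! i) (es ! j) = (if i = j then 1 else 0))"

text \<open>The \<open>g\<close>-dual vector field of a 1-form.\<close>

definition sharp :: "('a, 'e) metric \<Rightarrow> ('a \<Rightarrow> 'e \<Rightarrow> real) \<Rightarrow> 'a \<Rightarrow> 'e"
  where "sharp g \<alpha> x = (THE w. \<forall>v. g x w v = \<alpha> x v)"

definition grad :: "('a, 'e::real_normed_vector) manifold \<Rightarrow> ('a, 'e) metric \<Rightarrow>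
    ('a \<Rightarrow> real) \<Rightarrow> 'a \<Rightarrow> 'e"
  where "grad M g h = sharp g (mderiv M h)"

definition grad_angle :: "('a::topological_space, 'e::real_normed_vector) manifold \<Rightarrow>
    ('a, 'e) metric \<Rightarrow> ('a \<Rightarrow> angle) \<Rightarrow> 'a \<Rightarrow> 'e"
  where "grad_angle M g \<beta> = sharp g (mderiv_angle M \<beta>)"

text \<open>\<open>D x v Y\<close> is the covariant derivative at \<open>x\<close> of the field \<open>Y\<close> in the direction \<open>v\<close>.
  The axioms are imposed on fields defined and smooth on an open set \<open>W\<close>, that is, \<open>D\<close> is given
  as an operator on local sections. Values of \<open>D\<close> at fields that are not smooth near
  \<open>x\<close> are unconstrained.\<close>

type_synonym ('a, 'e) connection = "'a \<Rightarrow> 'e \<Rightarrow> ('a \<Rightarrow> 'e) \<Rightarrow> 'e"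

definition affine_connection :: "('a::topological_space, 'e::real_normed_vector) manifold \<Rightarrow>
    ('a, 'e) connection \<Rightarrow> bool"
where
  "affine_connection M D \<longleftrightarrow>
     (\<forall>W Y. open W \<and> smooth_field_on M W Y \<longrightarrow>
        (\<forall>x\<in>W. linear (\<lambda>v. D x v Y)) \<and>
        (\<forall>X. smooth_field_on M W X \<longrightarrow> smooth_field_on M W (\<lambda>x. D x (X x) Y)) \<and>
        (\<forall>Z. smooth_field_on M W Z \<longrightarrow>
           (\<forall>x\<in>W. \<forall>v. D x v (\<lambda>y. Y y + Z y) = D x v Y + D x v Z)) \<and>
        (\<forall>h. msmooth_on M W h \<longrightarrow>
           (\<forall>x\<in>W. \<forall>v. D x v (\<lambda>y. h y *\<^sub>R Y y) = mderiv M h x v *\<^sub>R Y x + h x *\<^sub>R D x v Y)))"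

definition levi_civita :: "('a::topological_space, 'e::real_normed_vector) manifold \<Rightarrow>
    ('a, 'e) metric \<Rightarrow> ('a, 'e) connection \<Rightarrow> bool"
where
  "levi_civita M g D \<longleftrightarrow> affine_connection M D \<and>
     (\<forall>W Y Z. open W \<and> smooth_field_on M W Y \<and> smooth_field_on M W Z \<longrightarrow> (\<forall>x\<in>W.
        D x (Y x) Z - D x (Z x) Y = lie_bracket M Y Z x \<and>
        (\<forall>v. mderiv M (\<lambda>y. g y (Y y) (Z y)) x v = g x (D x v Y) (Z x) + g x (Y x) (D x v Z))))"

text \<open>The divergence of a field with respect to a metric with Levi-Civita connection \<open>D\<close>.\<close>

definition mdiv :: "('a, 'e::real_normed_vector) manifold \<Rightarrow> ('a, 'e) connection \<Rightarrow>
    ('a \<Rightarrow> 'e) \<Rightarrow> 'a \<Rightarrow> real"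
  where "mdiv M D V x = basis_trace (model_frame M) (\<lambda>v. D x v V)"

definition laplacian_angle :: "('a::topological_space, 'e::real_normed_vector) manifold \<Rightarrow>
    ('a, 'e) metric \<Rightarrow> ('a, 'e) connection \<Rightarrow> ('a \<Rightarrow> angle) \<Rightarrow> 'a \<Rightarrow> real"
  where "laplacian_angle M g D \<beta> = mdiv M D (grad_angle M g \<beta>)"

section \<open>Lagrangian and Legendrian immersions\<close>

definition immersion :: "('a::topological_space, 'e::real_normed_vector) manifold \<Rightarrow>
    ('a \<Rightarrow> 'f::real_normed_vector) \<Rightarrow> bool"
  where "immersion M f \<longleftrightarrow> msmooth_on M UNIV f \<and> (\<forall>x. inj (mderiv M f x))"

definition induced_metric :: "('a, 'e::real_normed_vector) manifold \<Rightarrow>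
    ('a \<Rightarrow> 'f::real_inner) \<Rightarrow> ('a, 'e) metric"
  where "induced_metric M f x v w = mderiv M f x v \<bullet> mderiv M f x w"

definition lagrangian_immersion :: "('a::topological_space, 'e::real_normed_vector) manifold \<Rightarrow>
    ('a \<Rightarrow> complex ^ 'n::{finite,linorder}) \<Rightarrow> bool"
  where "lagrangian_immersion M f \<longleftrightarrow> mdim M = CARD('n) \<and> immersion M f \<and>
    (\<forall>x v w. symp (mderiv M f x v) (mderiv M f x w) = 0)"

definition lagrangian_angle :: "('a, 'e::real_normed_vector) manifold \<Rightarrow>
    ('a \<Rightarrow> complex ^ 'n::{finite,linorder}) \<Rightarrow> 'a \<Rightarrow> angle"
  where "lagrangian_angle M f x =
    (THE \<theta>. \<forall>es. oriented_frame M es \<longrightarrow> \<theta> = carg (cdet (map (mderiv M f x) es)))"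

definition legendrian_immersion :: "('a::topological_space, 'e::real_normed_vector) manifold \<Rightarrow>
    ('a \<Rightarrow> complex ^ 'n::{finite,linorder}) \<Rightarrow> bool"
  where "legendrian_immersion N \<psi> \<longleftrightarrow> mdim N + 1 = CARD('n) \<and> immersion N \<psi> \<and>
    (\<forall>x. \<psi> x \<in> sphere 0 1) \<and> (\<forall>x v. liouville (\<psi> x) (mderiv N \<psi> x v) = 0)"

definition legendrian_angle :: "('a, 'e::real_normed_vector) manifold \<Rightarrow>
    ('a \<Rightarrow> complex ^ 'n::{finite,linorder}) \<Rightarrow> 'a \<Rightarrow> angle"
  where "legendrian_angle N \<psi> x =
    (THE \<theta>. \<forall>es. oriented_frame N es \<and> orthonormal (induced_metric N \<psi>) x es \<longrightarrow>
       angle_cis \<theta> = cdet (\<psi> x # map (mderiv N \<psi> x) es))"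

text \<open>The point \<open>(z, w)\<close> of \<open>\<complex>\<^sup>n\<close>, for \<open>n\<close> the sum of the two smaller dimensions.\<close>

definition cjoin :: "complex ^ 'k::{finite,linorder} \<Rightarrow> complex ^ 'l::{finite,linorder} \<Rightarrow>
    complex ^ 'n::{finite,linorder}"
  where "cjoin z w = cvec (coords z @ coords w)"

end

theory Submission
  imports Defs "Jordan_Normal_Form.Determinant"
begin

text \<open>
  The vectors tangent to \<open>\<Phi>\<close> are
  \<open>(d\<phi>\<^sub>1(a) \<psi>\<^sub>1 + \<phi>\<^sub>1 d\<psi>\<^sub>1(b), d\<phi>\<^sub>2(a) \<psi>\<^sub>2 + \<phi>\<^sub>2 d\<psi>\<^sub>2(c))\<close>. A Legendrian immersion is a Hermitian unit
  normal of its own tangent spaces (\<open>legendrian_position_normal\<close>), and these are isotropic, because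
  the symplectic form is the differential of the Liouville form (\<open>legendrian_symp\<close>, which rests on
  the symmetry of second derivatives). Hence the Hermitian product of two tangent vectors of \<open>\<Phi>\<close> is
  that of the surface plus real multiples of the two Legendrian metrics (\<open>hprod_mderiv_\<Phi>\<close>). Its real
  part is the formula for the metric, and its imaginary part says that \<open>\<Phi>\<close> is Lagrangian.

  For the angle, the determinant of a product frame factors (\<open>cdet_cjoin\<close>): the frame of the surface
  contributes \<open>det d\<phi>\<close>, the fibres contribute their Legendrian determinants and the powers
  \<open>\<phi>\<^sub>1\<^bsup>n\<^sub>1-1\<^esup> \<phi>\<^sub>2\<^bsup>n\<^sub>2-1\<^esup>\<close>, and moving the vector \<open>\<psi>\<^sub>2\<close> past the \<open>n\<^sub>1 - 1\<close> vectors of the first fibre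
  gives the sign. An orthonormal basis of an isotropic space is Hermitian orthonormal, so all these
  determinants are nonzero and any oriented frame computes the same argument
  (locale \<open>isotropic_map\<close>).

  The remaining formulas only depend on the shape \<open>g + r\<^sub>1\<^sup>2 g\<^sub>1 + r\<^sub>2\<^sup>2 g\<^sub>2\<close> of the metric and on the
  angle being a sum of angles of the factors, and are derived in that generality (locale
  \<open>warped_product\<close>). The gradient is read off from the metric. For its covariant derivatives, the
  Hessian of a function is half the Lie derivative of the metric along the gradient; in a chart this
  is a formula without Christoffel symbols (\<open>covariant_derivative_gradient\<close>), and for the product
  metric it splits into the Hessians of the factors and terms with the derivatives of \<open>r\<^sub>1\<close> and \<open>r\<^sub>2\<close>.
  Taking the trace, the latter add up to the derivative of \<open>log (r\<^sub>1\<^bsup>n\<^sub>1-1\<^esup> r\<^sub>2\<^bsup>n\<^sub>2-1\<^esup>)\<close> along the gradient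
  of the base, which turns the divergence into the weighted divergence of the Laplacian formula.

  The axioms of a connection speak about smooth fields, so the angle maps need smooth local lifts and
  their gradients need to be smooth. The former come from logarithms of frame determinants in a fixed
  chart (\<open>smooth_angle_frame_cdet\<close>), the latter from Cramer's rule for the Gram matrix
  (\<open>smooth_grad_angle\<close>).
\<close>

no_notation vec_index (infixl \<open>$\<close> 100)
no_notation scalar_prod (infix \<open>\<bullet>\<close> 70)
hide_const (open) Determinant.det Matrix.mat Matrix.vec Matrix.row Matrix.orthogonal

section \<open>Determinants indexed by natural numbers\<close>

text \<open>Rows and columns are numbered by natural numbers because the sizes that occur are lengths of
  frames as well as cardinalities of index types.\<close>

definition ndet :: "nat \<Rightarrow> (nat \<Rightarrow> nat \<Rightarrow> 'a::comm_ring_1) \<Rightarrow> 'a"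
  where "ndet n A = (\<Sum>\<sigma> | \<sigma> permutes {..<n}. of_int (sign \<sigma>) * (\<Prod>i<n. A i (\<sigma> i)))"

abbreviation nmat :: "nat \<Rightarrow> (nat \<Rightarrow> nat \<Rightarrow> 'a) \<Rightarrow> 'a Matrix.mat"
  where "nmat n A \<equiv> Matrix.mat n n (\<lambda>(i, j). A i j)"

lemma ndet_eq_det: "ndet n A = Determinant.det (nmat n A)"
proof -
  have "Determinant.det (nmat n A) =
      (\<Sum>p | p permutes {0..<n}. of_int (sign p) * (\<Prod>i=0..<n. nmat n A $$ (i, p i)))"
    by (simp add: Determinant.det_def)
  also have "\<dots> = ndet n A"
    unfolding ndet_def atLeast0LessThan
  proof (intro sum.cong prod.cong arg_cong2[where f = "(*)"] refl)
    fix p i assume "p \<in> {p. p permutes {..<n}}" and i: "i \<in> {..<n}"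
    hence "p i \<in> {..<n}"
      by (metis mem_Collect_eq permutes_in_image)
    thus "nmat n A $$ (i, p i) = A i (p i)"
      using i by simp
  qed
  finally show ?thesis ..
qed

lemma ndet_cong:
  assumes "\<And>i j. i < n \<Longrightarrow> j < n \<Longrightarrow> A i j = B i j"
  shows "ndet n A = ndet n B"
proof -
  have "nmat n A = nmat n B"
    by (rule eq_matI) (auto simp: assms)
  thus ?thesis
    by (simp add: ndet_eq_det)
qed

lemma ndet_transpose: "ndet n (\<lambda>i j. A j i) = ndet n A"
proof -
  have "Matrix.transpose_mat (nmat n A) = nmat n (\<lambda>i j. A j i)"
    by (rule eq_matI) auto
  thus ?thesis
    using Determinant.det_transpose[of "nmat n A" n] by (simp add: ndet_eq_det)
qed

lemma ndet_mult: "ndet n (\<lambda>i j. \<Sum>k<n. A i k * B k j) = ndet n A * ndet n B"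
proof -
  have "nmat n A * nmat n B = nmat n (\<lambda>i j. \<Sum>k<n. A i k * B k j)"
    by (rule eq_matI) (auto simp: times_mat_def scalar_prod_def atLeast0LessThan)
  thus ?thesis
    using Determinant.det_mult[of "nmat n A" n "nmat n B"] by (simp add: ndet_eq_det)
qed

lemma ndet_block_diagonal:
  fixes A B :: "nat \<Rightarrow> nat \<Rightarrow> 'a::idom"
  shows "ndet (m + n) (\<lambda>i j. if i < m \<and> j < m then A i j
      else if m \<le> i \<and> m \<le> j then B (i - m) (j - m) else 0) = ndet m A * ndet n B"
proof -
  have "four_block_mat (nmat m A) (0\<^sub>m m n) (0\<^sub>m n m) (nmat n B) =
      nmat (m + n) (\<lambda>i j. if i < m \<and> j < m then A i j
        else if m \<le> i \<and> m \<le> j then B (i - m) (j - m) else 0)"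
    by (rule eq_matI) (auto simp: four_block_mat_def Let_def)
  thus ?thesis
    using det_four_block_mat_upper_right_zero[of "nmat m A" m "0\<^sub>m m n" n "0\<^sub>m n m" "nmat n B"]
    by (simp add: ndet_eq_det)
qed

lemma ndet_diagonal:
  "ndet n (\<lambda>i j. if i = j then d i else 0) = (\<Prod>i<n. d i)"
proof -
  have "Determinant.det (nmat n (\<lambda>i j. if i = j then d i else 0)) =
      prod_list (diag_mat (nmat n (\<lambda>i j. if i = j then d i else 0)))"
    by (rule det_upper_triangular[of _ n]) (auto simp: upper_triangular_def)
  also have "diag_mat (nmat n (\<lambda>i j. if i = j then d i else 0)) = map d [0..<n]"
    by (auto simp: diag_mat_def)
  also have "prod_list (map d [0..<n]) = (\<Prod>i<n. d i)"
    by (simp add: prod.distinct_set_conv_list[symmetric] atLeast0LessThan)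
  finally show ?thesis
    by (simp add: ndet_eq_det)
qed

lemma ndet_one: "ndet n (\<lambda>i j. if i = j then 1 else 0) = 1"
  by (simp add: ndet_diagonal)

lemma ndet_of_real: "ndet n (\<lambda>i j. of_real (A i j)) = (of_real (ndet n A) :: complex)"
  by (simp add: ndet_def)

lemma ndet_cnj: "ndet n (\<lambda>i j. cnj (A i j)) = cnj (ndet n A)"
  by (simp add: ndet_def)

lemma ndet_two:
  "ndet (Suc (Suc 0)) A = A 0 0 * A (Suc 0) (Suc 0) - A 0 (Suc 0) * A (Suc 0) 0"
proof -
  have f: "finite {Suc 0}" "0 \<notin> {Suc 0}" by auto
  have eq: "{..<Suc (Suc 0)} = {0, Suc 0}" by auto
  show ?thesis
    unfolding ndet_def eq sum_over_permutations_insert[OF f] permutes_sing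
    by (simp add: sign_swap_id sign_id)
qed

text \<open>This form of Cramer's rule, with no division and no inverse matrix, presents the coordinates of
  a gradient as quotients of polynomials in the metric and the differential.\<close>

lemma ndet_cramer:
  assumes "\<And>i. i < n \<Longrightarrow> (\<Sum>j<n. A i j * w j) = b i" and "k < n"
  shows "ndet n (\<lambda>i j. if j = k then b i else A i j) = w k * ndet n A"
proof -
  have "nmat n (\<lambda>i j. if j = k then b i else A i j) =
      replace_col (nmat n A) (nmat n A *\<^sub>v Matrix.vec n w) k"
    using assms(2)
    by (intro eq_matI)
       (auto simp: replace_col_def scalar_prod_def assms(1)[symmetric] atLeast0LessThan)
  thus ?thesis
    using cramer_lemma_mat[of "nmat n A" n "Matrix.vec n w" k] assms(2)
    by (simp add: ndet_eq_det)
qed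

lemma ndet_eq_0_imp_kernel:
  fixes A :: "nat \<Rightarrow> nat \<Rightarrow> 'a::idom"
  assumes "ndet n A = 0"
  obtains w k where "k < n" "w k \<noteq> 0" "\<And>i. i < n \<Longrightarrow> (\<Sum>j<n. A i j * w j) = 0"
proof -
  obtain v where v: "v \<in> carrier_vec n" "v \<noteq> 0\<^sub>v n" "nmat n A *\<^sub>v v = 0\<^sub>v n"
    using det_0_iff_vec_prod_zero[of "nmat n A" n] assms by (auto simp: ndet_eq_det)
  from v(1,2) obtain k where k: "k < n" "vec_index v k \<noteq> 0"
    by (metis eq_vecI index_zero_vec carrier_vecD)
  have "(\<Sum>j<n. A i j * vec_index v j) = 0" if "i < n" for i
  proof -
    have "vec_index (nmat n A *\<^sub>v v) i = 0"
      using v(3) that by simp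
    thus ?thesis
      using that v(1) by (simp add: scalar_prod_def atLeast0LessThan)
  qed
  with k show thesis
    by (rule that)
qed

lemma ndet_swap_initial_cols:
  assumes "k + m \<le> n"
  shows "ndet n A = (- 1) ^ (k * m) *
    ndet n (\<lambda>i j. A i (if j < m then j + k else if j < k + m then j - m else j))"
proof -
  have "Matrix.mat n n (\<lambda>(i, j). nmat n A $$ (i, if j < m then j + k else if j < k + m then j - m else j)) =
     nmat n (\<lambda>i j. A i (if j < m then j + k else if j < k + m then j - m else j))"
    using assms by (intro eq_matI) auto
  thus ?thesis
    using det_swap_initial_cols[of "nmat n A" n k m] assms by (simp add: ndet_eq_det)
qed

no_notation scalar_prod (infix \<open>\<bullet>\<close> 70)
section \<open>Coordinates of complex vectors\<close>

text \<open>The inverse of \<^const>\<open>coord_pos\<close>.\<close>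

definition coord :: "nat \<Rightarrow> 'n::{finite,linorder}"
  where "coord k = sorted_list_of_set UNIV ! k"

lemma coord_pos_coord:
  assumes "k < CARD('n::{finite,linorder})"
  shows "coord_pos (coord k :: 'n) = k"
proof -
  define xs where "xs = sorted_list_of_set (UNIV :: 'n set)"
  have xs: "sorted xs" "distinct xs" "set xs = UNIV" "length xs = CARD('n)"
    by (auto simp: xs_def)
  have ss: "xs ! i < xs ! j \<longleftrightarrow> i < j" if "i < length xs" "j < length xs" for i j
    using strict_sorted_iff xs that
    by (metis linorder_neqE_nat not_less_iff_gr_or_eq sorted_wrt_iff_nth_less)
  have "{j. j < xs ! k} = (!) xs ` {..<k}"
  proof (intro Set.set_eqI iffI)
    fix j assume "j \<in> {j. j < xs ! k}"
    moreover obtain i where "i < length xs" "j = xs ! i"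
      using xs(3) by (metis UNIV_I in_set_conv_nth)
    ultimately show "j \<in> (!) xs ` {..<k}"
      using ss assms xs(4) by auto
  qed (use ss assms xs(4) in auto)
  moreover have "inj_on ((!) xs) {..<k}"
    using xs assms by (auto simp: inj_on_def nth_eq_iff_index_eq)
  ultimately show ?thesis
    by (simp add: coord_pos_def coord_def xs_def card_image)
qed

lemma bij_betw_coord: "bij_betw (coord :: nat \<Rightarrow> 'n::{finite,linorder}) {..<CARD('n)} UNIV"
proof -
  have "inj_on (coord :: nat \<Rightarrow> 'n) {..<CARD('n)}"
    by (metis coord_pos_coord inj_onI lessThan_iff)
  moreover from this have "coord ` {..<CARD('n)} = (UNIV :: 'n set)"
    by (intro card_subset_eq) (auto simp: card_image)
  ultimately show ?thesis
    by (simp add: bij_betw_def)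
qed

lemma coord_surj:
  obtains k where "k < CARD('n)" "(i :: 'n::{finite,linorder}) = coord k"
  using bij_betw_imp_surj_on[OF bij_betw_coord] by (metis (no_types) UNIV_I imageE lessThan_iff)

lemma coord_coord_pos [simp]: "coord (coord_pos i) = (i :: 'n::{finite,linorder})"
  by (rule coord_surj[of i]) (simp add: coord_pos_coord)

lemma coord_pos_less: "coord_pos (i :: 'n) < CARD('n::{finite,linorder})"
  by (rule coord_surj[of i]) (simp add: coord_pos_coord)

lemma bij_betw_coord_pos:
  "bij_betw (coord_pos :: 'n::{finite,linorder} \<Rightarrow> nat) UNIV {..<CARD('n)}"
  by (rule bij_betw_byWitness[where f' = coord]) (auto simp: coord_pos_coord coord_pos_less)

lemma sum_coord: "(\<Sum>i\<in>UNIV. f i) = (\<Sum>k<CARD('n). f (coord k :: 'n::{finite,linorder}))"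
  by (rule sum.reindex_bij_betw[OF bij_betw_coord, symmetric])

lemma vec_eq_coord_iff:
  fixes v w :: "'a ^ 'n::{finite,linorder}"
  shows "v = w \<longleftrightarrow> (\<forall>k<CARD('n). v $ coord k = w $ coord k)"
proof
  assume eq: "\<forall>k<CARD('n). v $ coord k = w $ coord k"
  have "v $ i = w $ i" for i
    by (rule coord_surj[of i]) (use eq in simp)
  thus "v = w"
    by (simp add: Finite_Cartesian_Product.vec_eq_iff)
qed simp

lemma nth_coords: "k < CARD('n) \<Longrightarrow> coords (z :: complex ^ 'n::{finite,linorder}) ! k = z $ coord k"
  by (simp add: coords_def coord_def)

lemma length_coords [simp]: "length (coords (z :: complex ^ 'n::{finite,linorder})) = CARD('n)"
  by (simp add: coords_def)

text \<open>Numbering the index type turns permutations of the type into permutations of an initial segment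
  of the natural numbers; conjugation with a bijection preserves the sign.\<close>

lemma det_eq_ndet:
  "Determinants.det (\<chi> i j. A (coord_pos i) (coord_pos j) :: complex ^ 'n::{finite,linorder} ^ 'n::{finite,linorder})
    = ndet CARD('n) A"
proof -
  let ?c = "coord :: nat \<Rightarrow> 'n" and ?U = "{..<CARD('n)}"
  have inj: "inj_on ?c ?U" and img: "?c ` ?U = UNIV"
    using bij_betw_coord by (auto simp: bij_betw_def)
  have inv: "inv_into ?U ?c i = coord_pos i" for i
    by (metis coord_coord_pos coord_pos_less inj inv_into_f_f lessThan_iff)
  have mp: "map_permutation ?U ?c p (?c k) = ?c (p k)" if "k < CARD('n)" for p k
    using that by (simp add: map_permutation_def restrict_id_def inv img coord_pos_coord)
  have bij: "bij_betw (map_permutation ?U ?c) {p. p permutes ?U} {p. p permutes (UNIV :: 'n set)}"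
  proof (rule bij_betw_byWitness[where f' = "map_permutation UNIV coord_pos"])
    show "\<forall>a\<in>{p. p permutes ?U}. map_permutation UNIV coord_pos (map_permutation ?U ?c a) = a"
      by (auto intro!: map_permutation_compose_inv bij_betw_coord coord_pos_coord)
    show "\<forall>a\<in>{p. p permutes UNIV}. map_permutation ?U ?c (map_permutation UNIV coord_pos a) = a"
      by (auto intro!: map_permutation_compose_inv bij_betw_coord_pos)
    show "map_permutation ?U ?c ` {p. p permutes ?U} \<subseteq> {p. p permutes UNIV}"
      by (auto intro!: map_permutation_permutes bij_betw_coord)
    show "map_permutation UNIV coord_pos ` {p. p permutes (UNIV :: 'n set)} \<subseteq> {p. p permutes ?U}"
      by (auto intro!: map_permutation_permutes bij_betw_coord_pos)
  qed
  have "Determinants.det (\<chi> i j. A (coord_pos i) (coord_pos j) :: complex ^ 'n::{finite,linorder} ^ 'n::{finite,linorder}) =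
     (\<Sum>p | p permutes (UNIV :: 'n set). of_int (sign p) * (\<Prod>i\<in>UNIV. A (coord_pos i) (coord_pos (p i))))"
    by (simp add: Determinants.det_def)
  also have "\<dots> = (\<Sum>p | p permutes ?U. of_int (sign (map_permutation ?U ?c p)) *
      (\<Prod>i\<in>UNIV. A (coord_pos i) (coord_pos (map_permutation ?U ?c p i))))"
    by (rule sum.reindex_bij_betw[OF bij, symmetric])
  also have "\<dots> = (\<Sum>p | p permutes ?U. of_int (sign p) * (\<Prod>k<CARD('n). A k (p k)))"
  proof (intro sum.cong refl arg_cong2[where f = "(*)"])
    fix p assume "p \<in> {p. p permutes ?U}"
    hence p: "p permutes ?U" by simp
    show "complex_of_int (sign (map_permutation ?U ?c p)) = of_int (sign p)"
      using p inj by (simp add: sign_map_permutation)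
    have "(\<Prod>i\<in>UNIV. A (coord_pos i) (coord_pos (map_permutation ?U ?c p i))) =
        (\<Prod>k<CARD('n). A (coord_pos (?c k)) (coord_pos (map_permutation ?U ?c p (?c k))))"
      by (rule prod.reindex_bij_betw[OF bij_betw_coord, symmetric])
    also have "\<dots> = (\<Prod>k<CARD('n). A k (p k))"
      using permutes_in_image[OF p] by (intro prod.cong) (auto simp: mp coord_pos_coord)
    finally show "(\<Prod>i\<in>UNIV. A (coord_pos i) (coord_pos (map_permutation ?U ?c p i))) =
        (\<Prod>k<CARD('n). A k (p k))" .
  qed
  finally show ?thesis
    by (simp add: ndet_def)
qed

lemma cdet_eq_ndet:
  "cdet (vs :: (complex ^ 'n::{finite,linorder}) list) = ndet CARD('n) (\<lambda>i j. (vs ! j) $ coord i)"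
  unfolding cdet_def by (subst det_eq_ndet[symmetric]) simp

text \<open>Passing from one list of vectors to a list of combinations of its members multiplies the
  complex determinant by the determinant of the coefficients. Changes of frame, reversals of a vector
  and the determinant of the product frame are all instances.\<close>

lemma cdet_lincomb:
  fixes vs ws :: "(complex ^ 'n::{finite,linorder}) list"
  assumes "\<And>j. j < CARD('n) \<Longrightarrow> vs ! j = (\<Sum>k<CARD('n). M k j *s ws ! k)"
  shows "cdet vs = ndet CARD('n) M * cdet ws"
proof -
  have "cdet vs = ndet CARD('n) (\<lambda>i j. \<Sum>k<CARD('n). (ws ! k) $ coord i * M k j)"
    unfolding cdet_eq_ndet by (intro ndet_cong) (simp add: assms mult.commute)
  also have "\<dots> = cdet ws * ndet CARD('n) M"
    unfolding cdet_eq_ndet by (rule ndet_mult)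
  finally show ?thesis
    by (simp add: mult.commute)
qed

lemma hprod_coord:
  "hprod z (w :: complex ^ 'n::{finite,linorder}) =
    (\<Sum>k<CARD('n). z $ coord k * cnj (w $ coord k))"
  unfolding hprod_def by (rule sum_coord)

text \<open>The product of the determinant with its conjugate is the determinant of the Gram matrix.\<close>

lemma cmod_cdet_unitary:
  fixes vs :: "(complex ^ 'n::{finite,linorder}) list"
  assumes "\<And>i j. i < CARD('n) \<Longrightarrow> j < CARD('n) \<Longrightarrow> hprod (vs ! i) (vs ! j) = (if i = j then 1 else 0)"
  shows "cmod (cdet vs) = 1"
proof -
  have "cdet vs * cnj (cdet vs) =
      ndet CARD('n) (\<lambda>i j. (vs ! i) $ coord j) * ndet CARD('n) (\<lambda>i j. cnj ((vs ! j) $ coord i))"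
    by (subst ndet_transpose) (simp add: cdet_eq_ndet ndet_cnj)
  also have "\<dots> = ndet CARD('n) (\<lambda>i j. hprod (vs ! i) (vs ! j))"
    by (simp add: ndet_mult[symmetric] hprod_coord)
  also have "\<dots> = ndet CARD('n) (\<lambda>i j. if i = j then 1 else 0)"
    by (intro ndet_cong assms)
  finally have "cdet vs * cnj (cdet vs) = 1"
    by (simp add: ndet_one)
  hence "(cmod (cdet vs))\<^sup>2 = 1"
    by (metis complex_norm_square of_real_eq_1_iff)
  thus ?thesis
    by (simp add: power2_eq_1_iff)
       (smt (verit) norm_ge_zero)
qed

lemma hprod_add_left: "hprod (x + y) z = hprod x z + hprod y z"
  and hprod_add_right: "hprod x (y + z) = hprod x y + hprod x z"
  and hprod_mult_left: "hprod (a *s x) y = a * hprod x y"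
  and hprod_mult_right: "hprod x (a *s y) = cnj a * hprod x y"
  and hprod_zero_left [simp]: "hprod 0 y = 0"
  and hprod_zero_right [simp]: "hprod x 0 = 0"
  and cnj_hprod: "cnj (hprod x y) = hprod y x"
  by (auto simp: hprod_def sum.distrib sum_distrib_left algebra_simps)

section \<open>Splitting complex space\<close>

lemma cjoin_coord:
  fixes z :: "complex ^ 'k::{finite,linorder}" and w :: "complex ^ 'l::{finite,linorder}"
  assumes "CARD('k) + CARD('l) = CARD('n)" and "k < CARD('n)"
  shows "(cjoin z w :: complex ^ 'n::{finite,linorder}) $ coord k =
    (if k < CARD('k) then z $ coord k else w $ coord (k - CARD('k)))"
  using assms by (auto simp: cjoin_def cvec_def nth_append nth_coords coord_pos_coord)

lemma cvec_coord: "k < CARD('n) \<Longrightarrow> (cvec zs :: complex ^ 'n::{finite,linorder}) $ coord k = zs ! k"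
  by (simp add: cvec_def coord_pos_coord)

lemma cjoin_add:
  assumes "CARD('k) + CARD('l) = CARD('n)"
  shows "(cjoin z w :: complex ^ 'n::{finite,linorder}) + cjoin z' w' =
    cjoin (z + z' :: complex ^ 'k::{finite,linorder}) (w + w' :: complex ^ 'l::{finite,linorder})"
  by (simp add: vec_eq_coord_iff cjoin_coord[OF assms])

lemma cjoin_smult:
  assumes "CARD('k) + CARD('l) = CARD('n)"
  shows "a *s (cjoin z w :: complex ^ 'n::{finite,linorder}) =
    cjoin (a *s z :: complex ^ 'k::{finite,linorder}) (a *s w :: complex ^ 'l::{finite,linorder})"
  by (simp add: vec_eq_coord_iff cjoin_coord[OF assms])

lemma sum_lessThan_add: "(\<Sum>k<a + b. f k) = (\<Sum>k<a. f k) + (\<Sum>k<b. f (a + k :: nat) :: 'a::comm_monoid_add)"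
  by (induction b) (auto simp: add.assoc)

lemma prod_lessThan_add: "(\<Prod>k<a + b. f k) = (\<Prod>k<a. f k) * (\<Prod>k<b. f (a + k :: nat) :: 'a::comm_monoid_mult)"
  by (induction b) (auto simp: mult.assoc)

lemma hprod_cjoin:
  assumes "CARD('k) + CARD('l) = CARD('n)"
  shows "hprod (cjoin z w :: complex ^ 'n::{finite,linorder}) (cjoin z' w') =
    hprod z (z' :: complex ^ 'k::{finite,linorder}) + hprod w (w' :: complex ^ 'l::{finite,linorder})"
proof -
  have "hprod (cjoin z w :: complex ^ 'n::{finite,linorder}) (cjoin z' w') =
      (\<Sum>k<CARD('k) + CARD('l). (cjoin z w :: complex ^ 'n::{finite,linorder}) $ coord k *
        cnj ((cjoin z' w' :: complex ^ 'n::{finite,linorder}) $ coord k))"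
    by (simp add: hprod_coord assms)
  also have "\<dots> = hprod z z' + hprod w w'"
    by (simp add: sum_lessThan_add hprod_coord cjoin_coord[OF assms] assms[symmetric])
  finally show ?thesis .
qed

lemma cdet_swap_initial:
  fixes as bs cs :: "(complex ^ 'n::{finite,linorder}) list"
  assumes "length as + length bs + length cs = CARD('n)"
  shows "cdet (as @ bs @ cs) = (- 1) ^ (length as * length bs) * cdet (bs @ as @ cs)"
proof -
  have "cdet (as @ bs @ cs) = (- 1) ^ (length as * length bs) *
      ndet CARD('n) (\<lambda>i j. ((as @ bs @ cs) ! (if j < length bs then j + length as
        else if j < length as + length bs then j - length bs else j)) $ coord i)"
    unfolding cdet_eq_ndet by (rule ndet_swap_initial_cols) (use assms in simp)
  also have "ndet CARD('n) (\<lambda>i j. ((as @ bs @ cs) ! (if j < length bs then j + length as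
        else if j < length as + length bs then j - length bs else j)) $ coord i)
      = cdet (bs @ as @ cs)"
    unfolding cdet_eq_ndet
    by (intro ndet_cong arg_cong2[where f = vec_nth] refl) (auto simp: nth_append add.commute)
  finally show ?thesis .
qed

lemma cdet_cjoin_blocks:
  fixes us :: "(complex ^ 'k::{finite,linorder}) list" and ws :: "(complex ^ 'l::{finite,linorder}) list"
  assumes n: "CARD('k) + CARD('l) = CARD('n)" and "length us = CARD('k)" and "length ws = CARD('l)"
  shows "cdet (map (\<lambda>u. cjoin u (0 :: complex ^ 'l::{finite,linorder}) :: complex ^ 'n::{finite,linorder}) us @ map (\<lambda>w. cjoin (0 :: complex ^ 'k::{finite,linorder}) w) ws) =
    cdet us * cdet ws"
  unfolding cdet_eq_ndet ndet_block_diagonal[symmetric] n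
  by (intro ndet_cong)
     (use assms in \<open>auto simp: nth_append cjoin_coord[OF n] Suc_diff_le\<close>)

text \<open>The vectors in question are combinations of \<open>(z, 0)\<close>, \<open>(0, w)\<close>, the \<open>(u, 0)\<close> and the
  \<open>(0, v)\<close>, with a coefficient matrix made of a block of size two and a diagonal block. The sign
  comes from moving \<open>(0, w)\<close> past the \<open>(u, 0)\<close>.\<close>

lemma cdet_cjoin:
  fixes z :: "complex ^ 'k::{finite,linorder}" and w :: "complex ^ 'l::{finite,linorder}"
    and us :: "(complex ^ 'k::{finite,linorder}) list" and vs :: "(complex ^ 'l::{finite,linorder}) list"
  assumes n: "CARD('k) + CARD('l) = CARD('n)"
    and us: "length us + 1 = CARD('k)" and vs: "length vs + 1 = CARD('l)"
  shows "cdet ([cjoin (a1 *s z) (b1 *s w), cjoin (a2 *s z) (b2 *s w)] @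
      map (\<lambda>u. cjoin (s *s u) (0 :: complex ^ 'l::{finite,linorder})) us @
      map (\<lambda>v. cjoin (0 :: complex ^ 'k::{finite,linorder}) (t *s v)) vs
      :: (complex ^ 'n::{finite,linorder}) list) =
    (- 1) ^ length us * s ^ length us * t ^ length vs * (a1 * b2 - a2 * b1) *
      cdet (z # us) * cdet (w # vs)"
proof -
  define e1 e2 where "e1 = (\<lambda>u :: complex ^ 'k::{finite,linorder}. cjoin u (0 :: complex ^ 'l::{finite,linorder}) :: complex ^ 'n::{finite,linorder})"
    and "e2 = (\<lambda>w :: complex ^ 'l::{finite,linorder}. cjoin (0 :: complex ^ 'k::{finite,linorder}) w :: complex ^ 'n::{finite,linorder})"
  let ?vs = "[cjoin (a1 *s z) (b1 *s w), cjoin (a2 *s z) (b2 *s w)] @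
      map (\<lambda>u. cjoin (s *s u) (0 :: complex ^ 'l::{finite,linorder})) us @
      map (\<lambda>v. cjoin (0 :: complex ^ 'k::{finite,linorder}) (t *s v)) vs
      :: (complex ^ 'n::{finite,linorder}) list"
  let ?ws = "[e1 z, e2 w] @ map e1 us @ map e2 vs"
  define T where "T = (\<lambda>i j. if i = (0::nat) then (if j = (0::nat) then a1 else a2)
    else if j = 0 then b1 else b2)"
  define d where "d = (\<lambda>j. if j < length us then s else t)"
  define M where "M = (\<lambda>i j. if i < 2 \<and> j < 2 then T i j
    else if 2 \<le> i \<and> 2 \<le> j then (if i - 2 = j - 2 then d (i - 2) else 0) else 0)"
  let ?m = "length us + length vs"
  have card: "CARD('n) = 2 + ?m"
    using n us vs by simp
  have comb: "?vs ! j = (\<Sum>k<CARD('n). M k j *s ?ws ! k)" if j: "j < CARD('n)" for j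
  proof (cases "j < 2")
    case True
    have "(\<Sum>k<CARD('n). M k j *s ?ws ! k) = (\<Sum>k<2. M k j *s ?ws ! k)"
      unfolding card using True by (subst sum_lessThan_add) (simp add: M_def)
    also have "\<dots> = T 0 j *s e1 z + T 1 j *s e2 w"
      using True by (simp add: M_def numeral_2_eq_2)
    also have "\<dots> = ?vs ! j"
      using True by (auto simp: T_def e1_def e2_def cjoin_smult[OF n] cjoin_add[OF n] less_2_cases_iff)
    finally show ?thesis ..
  next
    case False
    then obtain i where i: "j = 2 + i" "i < ?m"
      using j card by (metis le_Suc_ex linorder_not_less nat_add_left_cancel_less)
    have "(\<Sum>k<CARD('n). M k j *s ?ws ! k) = (\<Sum>k<?m. (if k = i then d k else 0) *s (?ws ! (2 + k)))"
      unfolding card using i by (subst sum_lessThan_add) (simp add: M_def cong: if_cong)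
    also have "\<dots> = (\<Sum>k<?m. if k = i then d i *s (?ws ! (2 + i)) else 0)"
      by (intro sum.cong) auto
    also have "\<dots> = d i *s (?ws ! (2 + i))"
      using i by simp
    also have "\<dots> = ?vs ! j"
      using i by (auto simp: d_def e1_def e2_def cjoin_smult[OF n] nth_append)
    finally show ?thesis ..
  qed
  have "ndet CARD('n) M = ndet 2 T * ndet ?m (\<lambda>i j. if i = j then d i else 0)"
    unfolding card M_def by (rule ndet_block_diagonal)
  also have "\<dots> = (a1 * b2 - a2 * b1) * (s ^ length us * t ^ length vs)"
    by (simp add: ndet_two numeral_2_eq_2 ndet_diagonal T_def d_def sum_lessThan_add
        prod.If_cases prod_lessThan_add)
  finally have M: "ndet CARD('n) M = (a1 * b2 - a2 * b1) * (s ^ length us * t ^ length vs)" .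
  have "cdet ?ws = cdet (map e1 us @ [e1 z, e2 w] @ map e2 vs)"
    by (subst cdet_swap_initial) (use card in simp_all)
  also have "\<dots> = (- 1) ^ length us * cdet ([e1 z] @ map e1 us @ e2 w # map e2 vs)"
    using cdet_swap_initial[of "map e1 us" "[e1 z]" "e2 w # map e2 vs"] card by simp
  also have "cdet ([e1 z] @ map e1 us @ e2 w # map e2 vs) = cdet (z # us) * cdet (w # vs)"
    using cdet_cjoin_blocks[OF n, of "z # us" "w # vs"] us vs by (simp add: e1_def e2_def)
  finally show ?thesis
    using cdet_lincomb[of ?vs M ?ws] comb by (simp add: M)
qed

section \<open>Frames\<close>

lemma frame_det_eq_ndet:
  "frame_det B es = ndet (length B) (\<lambda>i j. representation (set B) (es ! i) (B ! j))"
  by (simp add: frame_det_def ndet_def)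

lemma sum_list_index:
  "distinct B \<Longrightarrow> (\<Sum>k<length B. f (B ! k)) = (\<Sum>b\<in>set B. f b)"
  by (rule sum.reindex_bij_betw) (auto intro!: bij_betw_nth)

lemma basis_expansion:
  assumes "ordered_basis B"
  shows "v = (\<Sum>k<length B. representation (set B) v (B ! k) *\<^sub>R (B ! k))"
proof -
  have "(\<Sum>b\<in>set B. representation (set B) v b *\<^sub>R b) = v"
    by (rule real_vector.sum_representation_eq) (use assms in \<open>auto simp: ordered_basis_def\<close>)
  thus ?thesis
    using assms by (simp add: sum_list_index[of B "\<lambda>b. representation (set B) v b *\<^sub>R b"] ordered_basis_def)
qed

lemma representation_basis_nth:
  assumes "ordered_basis B" "i < length B" "j < length B"
  shows "representation (set B) (B ! i) (B ! j) = (if i = j then 1 else 0)"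
  using assms real_vector.representation_basis[of "set B" "B ! i"]
  by (auto simp: ordered_basis_def nth_eq_iff_index_eq)

lemma frame_det_basis: "ordered_basis B \<Longrightarrow> frame_det B B = 1"
  using ndet_cong[of "length B" "\<lambda>i j. representation (set B) (B ! i) (B ! j)"
      "\<lambda>i j. if i = j then 1 else 0"]
  by (simp add: representation_basis_nth frame_det_eq_ndet ndet_one)

lemma scaleR_eq_smult: "r *\<^sub>R (v :: complex ^ 'n) = of_real r *s v"
  unfolding Finite_Cartesian_Product.vec_eq_iff vector_scaleR_component vector_smult_component
  by (simp add: scaleR_conv_of_real)

lemma linear_basis_expansion:
  assumes "ordered_basis B" "linear L"
  shows "L v = (\<Sum>k<length B. representation (set B) v (B ! k) *\<^sub>R L (B ! k))"
proof -
  have "L v = L (\<Sum>k<length B. representation (set B) v (B ! k) *\<^sub>R (B ! k))"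
    by (rule arg_cong[OF basis_expansion[OF assms(1)]])
  thus ?thesis
    by (simp add: linear_sum[OF assms(2)] linear_cmul[OF assms(2)])
qed

text \<open>The leading vectors \<open>ws\<close> stay fixed, so the coefficient matrix of the change of frame is
  an identity block next to a real block. With \<open>ws\<close> empty this compares Lagrangian frames, and with
  \<open>ws\<close> the position vector it compares Legendrian ones.\<close>

lemma cdet_append_map_frame:
  fixes L :: "'e::real_vector \<Rightarrow> complex ^ 'n::{finite,linorder}"
  assumes B: "ordered_basis B" "length ws + length B = CARD('n)" and L: "linear L"
    and es: "length es = length B"
  shows "cdet (ws @ map L es) = of_real (frame_det B es) * cdet (ws @ map L B)"
proof -
  let ?m = "length ws"
  define R where "R = (\<lambda>k j. complex_of_real (representation (set B) (es ! j) (B ! k)))"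
  define M where "M = (\<lambda>k j. if k < ?m \<and> j < ?m then (if k = j then 1 else 0)
    else if ?m \<le> k \<and> ?m \<le> j then R (k - ?m) (j - ?m) else 0)"
  have card: "CARD('n) = ?m + length B"
    using B by simp
  have "(ws @ map L es) ! j = (\<Sum>k<CARD('n). M k j *s (ws @ map L B) ! k)" if "j < CARD('n)" for j
  proof (cases "j < ?m")
    case True
    have "(\<Sum>k<CARD('n). M k j *s (ws @ map L B) ! k) = (\<Sum>k<?m. (if k = j then 1 else 0) *s ws ! k)"
      unfolding card sum_lessThan_add using True by (simp add: M_def nth_append)
    also have "\<dots> = (\<Sum>k<?m. if k = j then ws ! j else 0)"
      by (intro sum.cong) auto
    finally show ?thesis
      using True by (simp add: nth_append)
  next
    case False
    define i where "i = j - ?m"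
    have i: "j = ?m + i" "i < length B"
      using False that card by (auto simp: i_def)
    have "(\<Sum>k<CARD('n). M k j *s (ws @ map L B) ! k) = (\<Sum>k<length B. R k i *s L (B ! k))"
      unfolding card sum_lessThan_add using i by (simp add: M_def nth_append)
    also have "\<dots> = L (es ! i)"
      using linear_basis_expansion[OF B(1) L, of "es ! i"] by (simp add: R_def scaleR_eq_smult)
    finally show ?thesis
      using i es by (simp add: nth_append)
  qed
  hence "cdet (ws @ map L es) = ndet CARD('n) M * cdet (ws @ map L B)"
    by (rule cdet_lincomb)
  also have "ndet CARD('n) M = ndet ?m (\<lambda>i j. if i = j then 1 else 0) * ndet (length B) R"
    unfolding card M_def by (rule ndet_block_diagonal)
  also have "ndet (length B) R = of_real (frame_det B es)"
    unfolding R_def by (subst ndet_transpose) (simp add: ndet_of_real frame_det_eq_ndet)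
  finally show ?thesis
    by (simp add: ndet_one)
qed

section \<open>Finite-dimensional normed spaces\<close>

text \<open>If \<open>- a\<close> were a limit of combinations of \<open>B\<close>, their coefficients would be Cauchy sequences by
  the bound \<open>c\<close>, and the combination of the limits would be \<open>- a\<close>.\<close>

lemma dist_finite_span_positive:
  fixes a :: "'a::real_normed_vector"
  assumes B: "finite B" and a: "a \<notin> span B"
    and c: "\<And>f. (\<Sum>b\<in>B. \<bar>f b\<bar>) \<le> c * norm (\<Sum>b\<in>B. f b *\<^sub>R b)"
  shows "\<exists>d>0. \<forall>f. d \<le> norm (a + (\<Sum>b\<in>B. f b *\<^sub>R b))"
proof (rule ccontr)
  assume "\<not> ?thesis"
  hence "\<exists>f. norm (a + (\<Sum>b\<in>B. f b *\<^sub>R b)) < inverse (real (Suc n))" for n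
    by (meson inverse_positive_iff_positive not_le of_nat_0_less_iff zero_less_Suc)
  then obtain F where F: "\<And>n. norm (a + (\<Sum>b\<in>B. F n b *\<^sub>R b)) < inverse (real (Suc n))"
    by metis
  define S where "S n = (\<Sum>b\<in>B. F n b *\<^sub>R b)" for n
  have "(\<lambda>n. a + S n) \<longlonglongrightarrow> 0"
    by (rule Lim_null_comparison[OF always_eventually LIMSEQ_inverse_real_of_nat])
       (use F in \<open>auto simp: S_def intro: less_imp_le\<close>)
  hence lim: "S \<longlonglongrightarrow> - a"
    using tendsto_add[of "\<lambda>n. a + S n" 0 sequentially "\<lambda>_. - a" "- a"] by simp
  hence cauchy: "Cauchy S"
    by (rule LIMSEQ_imp_Cauchy)
  have diff: "\<bar>F m b - F n b\<bar> \<le> \<bar>c\<bar> * norm (S m - S n)" if "b \<in> B" for m n b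
  proof -
    have "\<bar>F m b - F n b\<bar> \<le> (\<Sum>b\<in>B. \<bar>F m b - F n b\<bar>)"
      using that B by (intro member_le_sum) auto
    also have "\<dots> \<le> c * norm (S m - S n)"
      using c[of "\<lambda>b. F m b - F n b"] by (simp add: S_def scaleR_diff_left sum_subtractf)
    also have "\<dots> \<le> \<bar>c\<bar> * norm (S m - S n)"
      by (intro mult_right_mono) auto
    finally show ?thesis .
  qed
  have "convergent (\<lambda>n. F n b)" if "b \<in> B" for b
  proof (rule Cauchy_convergent, rule CauchyI)
    fix e :: real assume "0 < e"
    hence "0 < e / (\<bar>c\<bar> + 1)" by auto
    then obtain M where M: "\<And>m n. M \<le> m \<Longrightarrow> M \<le> n \<Longrightarrow> norm (S m - S n) < e / (\<bar>c\<bar> + 1)"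
      using CauchyD[OF cauchy] by blast
    show "\<exists>M. \<forall>m\<ge>M. \<forall>n\<ge>M. norm (F m b - F n b) < e"
    proof (intro exI allI impI)
      fix m n assume mn: "M \<le> m" "M \<le> n"
      have "norm (F m b - F n b) \<le> \<bar>c\<bar> * norm (S m - S n)"
        using diff[OF that] by simp
      also have "\<dots> \<le> (\<bar>c\<bar> + 1) * norm (S m - S n)"
        by (simp add: algebra_simps)
      also have "\<dots> < e"
        using M[OF mn] by (simp add: field_simps)
      finally show "norm (F m b - F n b) < e" .
    qed
  qed
  then obtain G where G: "\<And>b. b \<in> B \<Longrightarrow> (\<lambda>n. F n b) \<longlonglongrightarrow> G b"
    unfolding convergent_def by metis
  have "S \<longlonglongrightarrow> (\<Sum>b\<in>B. G b *\<^sub>R b)"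
    unfolding S_def by (intro tendsto_sum tendsto_scaleR G tendsto_const)
  with lim have "- a = (\<Sum>b\<in>B. G b *\<^sub>R b)"
    by (rule LIMSEQ_unique)
  hence "- a \<in> span B"
    by (simp add: span_sum span_scale span_base)
  with a show False
    using span_neg[of "- a" B] by simp
qed

text \<open>Induction on the basis: a new vector has positive distance \<open>d\<close> from the span of the old ones, so
  its coefficient in \<open>v\<close> is at most \<open>norm v / d\<close>, and the induction hypothesis bounds the rest.\<close>

lemma coefficients_bounded:
  fixes B :: "'a::real_normed_vector set"
  assumes "finite B" "independent B"
  shows "\<exists>c. \<forall>f. (\<Sum>b\<in>B. \<bar>f b\<bar>) \<le> c * norm (\<Sum>b\<in>B. f b *\<^sub>R b)"
  using assms
proof (induction B rule: finite_induct)
  case (insert a B)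
  hence a: "a \<notin> span B" and "independent B"
    by (auto simp: independent_insert)
  then obtain c where c: "\<And>f. (\<Sum>b\<in>B. \<bar>f b\<bar>) \<le> c * norm (\<Sum>b\<in>B. f b *\<^sub>R b)"
    using insert.IH by blast
  from dist_finite_span_positive[OF insert.hyps(1) a c]
  obtain d where d: "d > 0" "\<And>f. d \<le> norm (a + (\<Sum>b\<in>B. f b *\<^sub>R b))"
    by blast
  show ?case
  proof (intro exI allI)
    fix f :: "'a \<Rightarrow> real"
    let ?y = "\<Sum>b\<in>B. f b *\<^sub>R b"
    let ?N = "norm (f a *\<^sub>R a + ?y)"
    have fa: "\<bar>f a\<bar> \<le> ?N / d"
    proof (cases "f a = 0")
      case False
      have "d \<le> norm (a + (\<Sum>b\<in>B. (f b / f a) *\<^sub>R b))"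
        by (rule d(2))
      also have "a + (\<Sum>b\<in>B. (f b / f a) *\<^sub>R b) = (1 / f a) *\<^sub>R (f a *\<^sub>R a + ?y)"
        using False by (simp add: scaleR_add_right scaleR_sum_right)
      finally have "d \<le> ?N / \<bar>f a\<bar>"
        by (simp only: norm_scaleR) simp
      thus ?thesis
        using d(1) False by (simp add: field_simps)
    qed (use d(1) in simp)
    have "(\<Sum>b\<in>B. \<bar>f b\<bar>) \<le> c * norm ?y"
      by (rule c)
    also have "\<dots> \<le> \<bar>c\<bar> * norm ?y"
      by (intro mult_right_mono) auto
    also have "norm ?y \<le> ?N + \<bar>f a\<bar> * norm a"
      using norm_triangle_ineq4[of "f a *\<^sub>R a + ?y" "f a *\<^sub>R a"] by simp
    also have "\<bar>f a\<bar> * norm a \<le> (?N / d) * norm a"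
      using fa by (intro mult_right_mono) auto
    finally have "(\<Sum>b\<in>B. \<bar>f b\<bar>) \<le> \<bar>c\<bar> * (?N + ?N / d * norm a)"
      by (simp add: mult_left_mono)
    with fa have "\<bar>f a\<bar> + (\<Sum>b\<in>B. \<bar>f b\<bar>) \<le> ?N / d + \<bar>c\<bar> * (?N + ?N / d * norm a)"
      by linarith
    also have "\<dots> = (1 / d + \<bar>c\<bar> * (1 + norm a / d)) * ?N"
      by (simp add: field_simps)
    finally show "(\<Sum>b\<in>insert a B. \<bar>f b\<bar>) \<le>
        (1 / d + \<bar>c\<bar> * (1 + norm a / d)) * norm (\<Sum>b\<in>insert a B. f b *\<^sub>R b)"
      using insert.hyps by simp
  qed
qed auto

text \<open>Continuity of the coordinates allows the derivative of a composition, and of a map along a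
  variable direction, to be expanded in a basis.\<close>

lemma bounded_linear_representation:
  fixes B :: "'a::real_normed_vector list"
  assumes "ordered_basis B"
  shows "bounded_linear (\<lambda>v. representation (set B) v b)"
proof -
  have B: "independent (set B)" "span (set B) = UNIV"
    using assms by (auto simp: ordered_basis_def)
  obtain c where c: "\<And>f. (\<Sum>b\<in>set B. \<bar>f b\<bar>) \<le> c * norm (\<Sum>b\<in>set B. f b *\<^sub>R b)"
    using coefficients_bounded[of "set B"] B by auto
  have lin: "linear (\<lambda>v. representation (set B) v b)"
    using B by (intro linearI) (simp_all add: real_vector.representation_add real_vector.representation_scale)
  show ?thesis
  proof (rule bounded_linear_intro)
    fix v
    show "norm (representation (set B) v b) \<le> norm v * c"
    proof (cases "b \<in> set B")
      case True
      hence "\<bar>representation (set B) v b\<bar> \<le> (\<Sum>b\<in>set B. \<bar>representation (set B) v b\<bar>)"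
        by (intro member_le_sum) auto
      also have "\<dots> \<le> c * norm v"
        using c[of "representation (set B) v"] B
        by (simp add: real_vector.sum_representation_eq)
      finally show ?thesis by (simp add: mult.commute)
    next
      case False
      hence "representation (set B) v b = 0"
        by (meson real_vector.representation_ne_zero)
      moreover have "0 \<le> c * norm v"
        using order_trans[OF sum_nonneg c[of "representation (set B) v"]] B
        by (simp add: real_vector.sum_representation_eq)
      ultimately show ?thesis by (simp add: mult.commute)
    qed
  qed (use linear_add[OF lin] linear_cmul[OF lin] in auto)
qed

section \<open>Calculus of maps of class \<open>C\<^sup>k\<close>\<close>

lemma Ck_on_subset: "Ck_on k S f \<Longrightarrow> T \<subseteq> S \<Longrightarrow> Ck_on k T f"
  by (induction k arbitrary: f) (auto intro: continuous_on_subset)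

lemma frechet_derivative_cong_open:
  assumes "open S" "x \<in> S" "\<And>y. y \<in> S \<Longrightarrow> f y = g y"
  shows "frechet_derivative f (at x) = frechet_derivative g (at x)"
proof -
  have "(f has_derivative D) (at x) \<longleftrightarrow> (g has_derivative D) (at x)" for D
    using has_derivative_transform_within_open[OF _ assms(1,2), of f D UNIV g]
      has_derivative_transform_within_open[OF _ assms(1,2), of g D UNIV f] assms(3) by auto
  thus ?thesis
    by (simp add: frechet_derivative_def)
qed

lemma differentiable_cong_open:
  assumes "open S" "x \<in> S" "\<And>y. y \<in> S \<Longrightarrow> f y = g y"
  shows "f differentiable (at x) \<longleftrightarrow> g differentiable (at x)"
  using has_derivative_transform_within_open[OF _ assms(1,2), of f _ UNIV g]
    has_derivative_transform_within_open[OF _ assms(1,2), of g _ UNIV f] assms(3)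
  unfolding differentiable_def by auto

lemma Ck_on_cong:
  assumes "open S" "\<And>x. x \<in> S \<Longrightarrow> f x = g x"
  shows "Ck_on k S f \<longleftrightarrow> Ck_on k S g"
  using assms(2)
proof (induction k arbitrary: f g)
  case 0
  thus ?case using continuous_on_cong[of S S f g] by simp
next
  case (Suc k)
  have "frechet_derivative f (at x) v = frechet_derivative g (at x) v" if "x \<in> S" for x v
    using frechet_derivative_cong_open[OF assms(1) that] Suc.prems by metis
  hence "Ck_on k S (\<lambda>x. frechet_derivative f (at x) v) \<longleftrightarrow>
      Ck_on k S (\<lambda>x. frechet_derivative g (at x) v)" for v
    by (intro Suc.IH)
  moreover have "f differentiable (at x) \<longleftrightarrow> g differentiable (at x)" if "x \<in> S" for x
    using differentiable_cong_open[OF assms(1) that] Suc.prems by blast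
  ultimately show ?case by simp
qed

lemma Ck_on_local:
  assumes "\<And>x. x \<in> S \<Longrightarrow> \<exists>T. open T \<and> x \<in> T \<and> Ck_on k T f"
  shows "Ck_on k S f"
  using assms
proof (induction k arbitrary: f)
  case 0
  have "isCont f x" if "x \<in> S" for x
    using 0[OF that] by (auto simp: continuous_on_eq_continuous_at)
  thus ?case
    by (simp add: continuous_at_imp_continuous_on)
next
  case (Suc k)
  have "Ck_on k S (\<lambda>x. frechet_derivative f (at x) v)" for v
    by (rule Suc.IH) (use Suc.prems in fastforce)
  thus ?case
    using Suc.prems by fastforce
qed

text \<open>Inductions on the order of differentiability use this rule: it suffices to exhibit a derivative
  that is a \<open>C\<^sup>k\<close> expression in the data.\<close>

lemma Ck_on_SucI:
  assumes "open S" "\<And>x. x \<in> S \<Longrightarrow> (f has_derivative D x) (at x)"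
    and "\<And>v. Ck_on k S (\<lambda>x. D x v)"
  shows "Ck_on (Suc k) S f"
proof -
  have "frechet_derivative f (at x) = D x" if "x \<in> S" for x
    using frechet_derivative_at[OF assms(2)[OF that]] by simp
  hence "Ck_on k S (\<lambda>x. frechet_derivative f (at x) v)" for v
    using Ck_on_cong[OF assms(1), of "\<lambda>x. frechet_derivative f (at x) v" "\<lambda>x. D x v" k] assms(3)
    by auto
  thus ?thesis
    using assms(2) by (auto simp: differentiable_def)
qed

lemma Ck_on_SucD:
  assumes "Ck_on (Suc k) S f"
  shows "x \<in> S \<Longrightarrow> (f has_derivative frechet_derivative f (at x)) (at x)"
    and "Ck_on k S (\<lambda>x. frechet_derivative f (at x) v)"
  using assms by (auto simp: frechet_derivative_works[symmetric])

lemma Ck_on_Suc_imp: "Ck_on (Suc k) S f \<Longrightarrow> Ck_on k S f"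
proof (induction k arbitrary: f)
  case 0
  thus ?case
    by (auto intro!: continuous_at_imp_continuous_on differentiable_imp_continuous_within)
next
  case (Suc k)
  have "Ck_on k S (\<lambda>x. frechet_derivative f (at x) v)" for v
    by (rule Suc.IH) (use Suc.prems in simp)
  thus ?case
    using Suc.prems by simp
qed

lemma Ck_on_const: "Ck_on k S (\<lambda>x. c)"
  by (induction k arbitrary: c) auto

lemma Ck_on_bounded_linear:
  assumes "open S" "bounded_linear L" "Ck_on k S f"
  shows "Ck_on k S (\<lambda>x. L (f x))"
  using assms(3)
proof (induction k arbitrary: f)
  case 0
  thus ?case
    using bounded_linear.continuous_on[OF assms(2)] by simp
next
  case (Suc k)
  show ?case
    by (rule Ck_on_SucI[OF assms(1), of _ "\<lambda>x v. L (frechet_derivative f (at x) v)"])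
       (use Suc.prems in \<open>auto intro!: Suc.IH bounded_linear.has_derivative[OF assms(2)] Ck_on_SucD(1)\<close>)
qed

lemma Ck_on_precompose_linear:
  assumes "open S" "open T" "bounded_linear L" "\<And>x. x \<in> T \<Longrightarrow> L x \<in> S" "Ck_on k S f"
  shows "Ck_on k T (\<lambda>x. f (L x))"
  using assms(5)
proof (induction k arbitrary: f)
  case 0
  thus ?case
    using assms(4) bounded_linear.continuous_on[OF assms(3) continuous_on_id, of T]
    by (auto intro!: continuous_on_compose2[of S f T L])
next
  case (Suc k)
  show ?case
  proof (rule Ck_on_SucI[OF assms(2), of _ "\<lambda>x v. frechet_derivative f (at (L x)) (L v)"])
    fix x assume "x \<in> T"
    thus "((\<lambda>x. f (L x)) has_derivative (\<lambda>v. frechet_derivative f (at (L x)) (L v))) (at x)"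
      by (intro has_derivative_compose[OF bounded_linear_imp_has_derivative[OF assms(3)]]
          Ck_on_SucD(1)[OF Suc.prems] assms(4))
  next
    fix v
    show "Ck_on k T (\<lambda>x. frechet_derivative f (at (L x)) (L v))"
      by (rule Suc.IH) (use Suc.prems in simp)
  qed
qed

lemma Ck_on_add:
  assumes "open S" "Ck_on k S f" "Ck_on k S g"
  shows "Ck_on k S (\<lambda>x. f x + g x)"
  using assms(2,3)
proof (induction k arbitrary: f g)
  case 0
  thus ?case by (auto intro: continuous_on_add)
next
  case (Suc k)
  show ?case
    by (rule Ck_on_SucI[OF assms(1), of _ "\<lambda>x v. frechet_derivative f (at x) v + frechet_derivative g (at x) v"])
       (use Suc.prems in \<open>auto intro!: Suc.IH has_derivative_add Ck_on_SucD(1)\<close>)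
qed

lemma Ck_on_sum:
  assumes "open S" "\<And>i. i \<in> I \<Longrightarrow> Ck_on k S (f i)"
  shows "Ck_on k S (\<lambda>x. \<Sum>i\<in>I. f i x)"
  using assms(2)
  by (induction I rule: infinite_finite_induct) (auto intro: Ck_on_add[OF assms(1)] Ck_on_const)

lemma Ck_on_Pair:
  assumes "open S" "Ck_on k S f" "Ck_on k S g"
  shows "Ck_on k S (\<lambda>x. (f x, g x))"
  using assms(2,3)
proof (induction k arbitrary: f g)
  case 0
  thus ?case by (auto intro: continuous_on_Pair)
next
  case (Suc k)
  show ?case
    by (rule Ck_on_SucI[OF assms(1), of _ "\<lambda>x v. (frechet_derivative f (at x) v, frechet_derivative g (at x) v)"])
       (use Suc.prems in \<open>auto intro!: Suc.IH has_derivative_Pair Ck_on_SucD(1)\<close>)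
qed

lemma Ck_on_bilinear:
  assumes "open S" "bounded_bilinear b" "Ck_on k S f" "Ck_on k S g"
  shows "Ck_on k S (\<lambda>x. b (f x) (g x))"
  using assms(3,4)
proof (induction k arbitrary: f g)
  case 0
  thus ?case by (auto intro: bounded_bilinear.continuous_on[OF assms(2)])
next
  case (Suc k)
  show ?case
  proof (rule Ck_on_SucI[OF assms(1), of _ "\<lambda>x v. b (f x) (frechet_derivative g (at x) v) +
        b (frechet_derivative f (at x) v) (g x)"])
    fix v
    show "Ck_on k S (\<lambda>x. b (f x) (frechet_derivative g (at x) v) +
        b (frechet_derivative f (at x) v) (g x))"
      by (intro Ck_on_add[OF assms(1)] Suc.IH Ck_on_SucD(2) Suc.prems Ck_on_Suc_imp)
  qed (use Suc.prems in \<open>auto intro!: bounded_bilinear.FDERIV[OF assms(2)] Ck_on_SucD(1)\<close>)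
qed

lemma Ck_on_prod:
  fixes f :: "'i \<Rightarrow> 'e::real_normed_vector \<Rightarrow> 'a::{real_normed_algebra,comm_ring_1}"
  assumes "open S" "\<And>i. i \<in> I \<Longrightarrow> Ck_on k S (f i)"
  shows "Ck_on k S (\<lambda>x. \<Prod>i\<in>I. f i x)"
  using assms(2)
  by (induction I rule: infinite_finite_induct)
     (auto intro: Ck_on_bilinear[OF assms(1) bounded_bilinear_mult] Ck_on_const)

text \<open>The derivative of \<open>1/f\<close> is a polynomial in \<open>1/f\<close> and the derivative of \<open>f\<close>, so the induction
  hypothesis applies to it. The square root below is treated in the same way.\<close>

lemma Ck_on_inverse:
  fixes f :: "'e::real_normed_vector \<Rightarrow> 'a::real_normed_field"
  assumes "open S" "Ck_on k S f" "\<And>x. x \<in> S \<Longrightarrow> f x \<noteq> 0"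
  shows "Ck_on k S (\<lambda>x. inverse (f x))"
  using assms(2)
proof (induction k)
  case 0
  thus ?case using assms(3) by (auto intro: continuous_on_inverse)
next
  case (Suc k)
  show ?case
  proof (rule Ck_on_SucI[OF assms(1), of _ "\<lambda>x v. (- inverse (f x) * inverse (f x)) * frechet_derivative f (at x) v"])
    fix x assume "x \<in> S"
    from Deriv.has_derivative_inverse[OF assms(3)[OF this] Ck_on_SucD(1)[OF Suc.prems this]]
    show "((\<lambda>x. inverse (f x)) has_derivative
        (\<lambda>v. (- inverse (f x) * inverse (f x)) * frechet_derivative f (at x) v)) (at x)"
      by (simp add: mult_ac)
  next
    fix v
    have inv: "Ck_on k S (\<lambda>x. inverse (f x))"
      using Suc.IH Ck_on_Suc_imp[OF Suc.prems] .
    show "Ck_on k S (\<lambda>x. (- inverse (f x) * inverse (f x)) * frechet_derivative f (at x) v)"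
      by (rule Ck_on_bilinear[OF assms(1) bounded_bilinear_mult] inv Ck_on_SucD(2)[OF Suc.prems]
          Ck_on_bounded_linear[OF assms(1) bounded_linear_minus[OF bounded_linear_ident]])+
  qed
qed

lemma Ck_on_sqrt:
  assumes "open S" "Ck_on k S f" "\<And>x. x \<in> S \<Longrightarrow> f x > 0"
  shows "Ck_on k S (\<lambda>x. sqrt (f x))"
  using assms(2)
proof (induction k)
  case 0
  thus ?case by (auto intro: continuous_on_real_sqrt)
next
  case (Suc k)
  show ?case
  proof (rule Ck_on_SucI[OF assms(1), of _ "\<lambda>x v. (1 / 2 * inverse (sqrt (f x))) * frechet_derivative f (at x) v"])
    fix x assume x: "x \<in> S"
    have "(sqrt has_real_derivative inverse (sqrt (f x)) / 2) (at (f x))"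
      by (rule DERIV_real_sqrt) (use assms(3) x in auto)
    from has_derivative_compose[OF Ck_on_SucD(1)[OF Suc.prems x] this[unfolded has_field_derivative_def]]
    show "((\<lambda>x. sqrt (f x)) has_derivative
        (\<lambda>v. (1 / 2 * inverse (sqrt (f x))) * frechet_derivative f (at x) v)) (at x)"
      by (simp add: mult_ac)
  next
    fix v
    have "Ck_on k S (\<lambda>x. inverse (sqrt (f x)))"
      by (rule Ck_on_inverse[OF assms(1) Suc.IH]) (use Ck_on_Suc_imp[OF Suc.prems] assms(3) in force)+
    thus "Ck_on k S (\<lambda>x. (1 / 2 * inverse (sqrt (f x))) * frechet_derivative f (at x) v)"
      by (intro Ck_on_bilinear[OF assms(1) bounded_bilinear_mult] Ck_on_SucD(2)[OF Suc.prems] Ck_on_const)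
  qed
qed

text \<open>Positive real part keeps \<open>f\<close> away from the branch cut of the logarithm.\<close>

lemma Ck_on_Ln:
  assumes "open S" "Ck_on k S f" "\<And>x. x \<in> S \<Longrightarrow> Re (f x) > 0"
  shows "Ck_on k S (\<lambda>x. Ln (f x))"
proof (cases k)
  case 0
  have "f x \<notin> \<real>\<^sub>\<le>\<^sub>0" if "x \<in> S" for x
    using assms(3)[OF that] by (auto simp: complex_nonpos_Reals_iff)
  thus ?thesis using assms(2) 0 by (auto intro: continuous_on_Ln')
next
  case (Suc n)
  note C = assms(2)[unfolded Suc]
  show ?thesis
    unfolding Suc
  proof (rule Ck_on_SucI[OF assms(1), of _ "\<lambda>x v. inverse (f x) * frechet_derivative f (at x) v"])
    fix x assume x: "x \<in> S"
    have "(Ln has_field_derivative inverse (f x)) (at (f x))"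
      by (rule has_field_derivative_Ln) (use assms(3)[OF x] in \<open>auto simp: complex_nonpos_Reals_iff\<close>)
    from has_derivative_compose[OF Ck_on_SucD(1)[OF C x] this[unfolded has_field_derivative_def]]
    show "((\<lambda>x. Ln (f x)) has_derivative (\<lambda>v. inverse (f x) * frechet_derivative f (at x) v)) (at x)" .
  next
    fix v
    have "Ck_on n S (\<lambda>x. inverse (f x))"
      by (rule Ck_on_inverse[OF assms(1) Ck_on_Suc_imp[OF C]]) (use assms(3) in force)
    thus "Ck_on n S (\<lambda>x. inverse (f x) * frechet_derivative f (at x) v)"
      by (intro Ck_on_bilinear[OF assms(1) bounded_bilinear_mult] Ck_on_SucD(2)[OF C])
  qed
qed

lemma Ck_on_ndet:
  fixes A :: "nat \<Rightarrow> nat \<Rightarrow> 'e::real_normed_vector \<Rightarrow> 'a::{real_normed_algebra,comm_ring_1}"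
  assumes "open S" "\<And>i j. i < n \<Longrightarrow> j < n \<Longrightarrow> Ck_on k S (A i j)"
  shows "Ck_on k S (\<lambda>x. ndet n (\<lambda>i j. A i j x))"
  unfolding ndet_def
proof (intro Ck_on_sum Ck_on_bilinear[OF _ bounded_bilinear_mult] Ck_on_prod Ck_on_const assms(1))
  fix \<sigma> i assume "\<sigma> \<in> {\<sigma>. \<sigma> permutes {..<n}}" "i \<in> {..<n}"
  thus "Ck_on k S (A i (\<sigma> i))"
    using permutes_in_image[of \<sigma> "{..<n}" i] by (intro assms(2)) auto
qed

text \<open>In coordinates of the middle space the derivative of a composition is a sum of products, so
  that the induction on the order of differentiability only needs products and sums.\<close>

lemma Ck_on_compose:
  fixes B :: "'m::real_normed_vector list" and f :: "'e::real_normed_vector \<Rightarrow> 'm"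
    and g :: "'m \<Rightarrow> 'f::real_normed_vector"
  assumes B: "ordered_basis B" and "open S" "open T" "\<And>x. x \<in> S \<Longrightarrow> f x \<in> T"
    and f: "Ck_on k S f" and "Ck_on k T g"
  shows "Ck_on k S (\<lambda>x. g (f x))"
  using f assms(6)
proof (induction k arbitrary: g)
  case 0
  thus ?case
    using assms(4) by (auto intro!: continuous_on_compose2[of T g S f])
next
  case (Suc k)
  let ?R = "\<lambda>x v i. representation (set B) (frechet_derivative f (at x) v) (B ! i)"
  let ?D = "\<lambda>x v. \<Sum>i<length B. ?R x v i *\<^sub>R frechet_derivative g (at (f x)) (B ! i)"
  show ?case
  proof (rule Ck_on_SucI[OF assms(2), of _ ?D])
    fix x assume x: "x \<in> S"
    note dg = Ck_on_SucD(1)[OF Suc.prems(2) assms(4)[OF x]]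
    have "frechet_derivative g (at (f x)) (frechet_derivative f (at x) v) = ?D x v" for v
      by (rule linear_basis_expansion[OF B bounded_linear.linear[OF has_derivative_bounded_linear[OF dg]]])
    moreover from has_derivative_compose[OF Ck_on_SucD(1)[OF Suc.prems(1) x] dg]
    have "((\<lambda>x. g (f x)) has_derivative
        (\<lambda>v. frechet_derivative g (at (f x)) (frechet_derivative f (at x) v))) (at x)" .
    ultimately show "((\<lambda>x. g (f x)) has_derivative ?D x) (at x)"
      by simp
  next
    fix v
    show "Ck_on k S (\<lambda>x. ?D x v)"
      by (intro Ck_on_sum Ck_on_bilinear[OF _ bounded_bilinear_scaleR] assms(2)
            Ck_on_bounded_linear[OF _ bounded_linear_representation[OF B]]
            Suc.IH Ck_on_SucD(2)[OF Suc.prems(1)] Ck_on_SucD(2)[OF Suc.prems(2)] Ck_on_Suc_imp[OF Suc.prems(1)])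
  qed
qed

section \<open>Smooth maps\<close>

lemma smooth_on_subset: "smooth_on S f \<Longrightarrow> T \<subseteq> S \<Longrightarrow> smooth_on T f"
  unfolding smooth_on_def by (blast intro: Ck_on_subset)

lemma smooth_on_cong: "open S \<Longrightarrow> (\<And>x. x \<in> S \<Longrightarrow> f x = g x) \<Longrightarrow> smooth_on S f \<longleftrightarrow> smooth_on S g"
  unfolding smooth_on_def using Ck_on_cong[of S f g] by auto

lemma smooth_on_local:
  "(\<And>x. x \<in> S \<Longrightarrow> \<exists>T. open T \<and> x \<in> T \<and> smooth_on T f) \<Longrightarrow> smooth_on S f"
  unfolding smooth_on_def by (intro allI Ck_on_local) blast

lemma smooth_on_const: "smooth_on S (\<lambda>x. c)"
  unfolding smooth_on_def by (blast intro: Ck_on_const)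

lemma smooth_on_bounded_linear:
  "open S \<Longrightarrow> bounded_linear L \<Longrightarrow> smooth_on S f \<Longrightarrow> smooth_on S (\<lambda>x. L (f x))"
  unfolding smooth_on_def by (blast intro: Ck_on_bounded_linear)

lemma smooth_on_precompose_linear:
  "open S \<Longrightarrow> open T \<Longrightarrow> bounded_linear L \<Longrightarrow> (\<And>x. x \<in> T \<Longrightarrow> L x \<in> S) \<Longrightarrow> smooth_on S f
    \<Longrightarrow> smooth_on T (\<lambda>x. f (L x))"
  unfolding smooth_on_def by (blast intro: Ck_on_precompose_linear)

lemma smooth_on_add: "open S \<Longrightarrow> smooth_on S f \<Longrightarrow> smooth_on S g \<Longrightarrow> smooth_on S (\<lambda>x. f x + g x)"
  unfolding smooth_on_def by (blast intro: Ck_on_add)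

lemma smooth_on_sum:
  "open S \<Longrightarrow> (\<And>i. i \<in> I \<Longrightarrow> smooth_on S (f i)) \<Longrightarrow> smooth_on S (\<lambda>x. \<Sum>i\<in>I. f i x)"
  unfolding smooth_on_def by (blast intro: Ck_on_sum)

lemma smooth_on_Pair:
  "open S \<Longrightarrow> smooth_on S f \<Longrightarrow> smooth_on S g \<Longrightarrow> smooth_on S (\<lambda>x. (f x, g x))"
  unfolding smooth_on_def by (blast intro: Ck_on_Pair)

lemma smooth_on_bilinear:
  "open S \<Longrightarrow> bounded_bilinear b \<Longrightarrow> smooth_on S f \<Longrightarrow> smooth_on S g \<Longrightarrow> smooth_on S (\<lambda>x. b (f x) (g x))"
  unfolding smooth_on_def by (blast intro: Ck_on_bilinear)

lemma smooth_on_power: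
  fixes f :: "'e::real_normed_vector \<Rightarrow> 'a::real_normed_field"
  shows "open S \<Longrightarrow> smooth_on S f \<Longrightarrow> smooth_on S (\<lambda>x. f x ^ n)"
  by (induction n) (auto intro: smooth_on_const smooth_on_bilinear[OF _ bounded_bilinear_mult])

lemma smooth_on_inverse:
  fixes f :: "'e::real_normed_vector \<Rightarrow> 'a::real_normed_field"
  shows "open S \<Longrightarrow> smooth_on S f \<Longrightarrow> (\<And>x. x \<in> S \<Longrightarrow> f x \<noteq> 0) \<Longrightarrow> smooth_on S (\<lambda>x. inverse (f x))"
  unfolding smooth_on_def by (blast intro: Ck_on_inverse)

lemma smooth_on_sqrt:
  "open S \<Longrightarrow> smooth_on S f \<Longrightarrow> (\<And>x. x \<in> S \<Longrightarrow> f x > 0) \<Longrightarrow> smooth_on S (\<lambda>x. sqrt (f x))"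
  unfolding smooth_on_def by (blast intro: Ck_on_sqrt)

lemma smooth_on_Ln:
  "open S \<Longrightarrow> smooth_on S f \<Longrightarrow> (\<And>x. x \<in> S \<Longrightarrow> Re (f x) > 0) \<Longrightarrow> smooth_on S (\<lambda>x. Ln (f x))"
  unfolding smooth_on_def by (blast intro: Ck_on_Ln)

lemma smooth_on_ndet:
  fixes A :: "nat \<Rightarrow> nat \<Rightarrow> 'e::real_normed_vector \<Rightarrow> 'a::{real_normed_algebra,comm_ring_1}"
  shows "open S \<Longrightarrow> (\<And>i j. i < n \<Longrightarrow> j < n \<Longrightarrow> smooth_on S (A i j))
    \<Longrightarrow> smooth_on S (\<lambda>x. ndet n (\<lambda>i j. A i j x))"
  unfolding smooth_on_def by (blast intro: Ck_on_ndet)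

lemma smooth_on_compose:
  fixes B :: "'m::real_normed_vector list" and f :: "'e::real_normed_vector \<Rightarrow> 'm"
    and g :: "'m \<Rightarrow> 'f::real_normed_vector"
  assumes "ordered_basis B" "open S" "open T" "\<And>x. x \<in> S \<Longrightarrow> f x \<in> T" "smooth_on S f" "smooth_on T g"
  shows "smooth_on S (\<lambda>x. g (f x))"
  unfolding smooth_on_def
  by (rule allI, rule Ck_on_compose[OF assms(1-4) spec[OF assms(5)[unfolded smooth_on_def]]
      spec[OF assms(6)[unfolded smooth_on_def]]])

lemma smooth_on_has_derivative:
  "smooth_on S f \<Longrightarrow> x \<in> S \<Longrightarrow> (f has_derivative frechet_derivative f (at x)) (at x)"
  using Ck_on_SucD(1) unfolding smooth_on_def by blast

lemma smooth_on_frechet_derivative: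
  "smooth_on S f \<Longrightarrow> smooth_on S (\<lambda>x. frechet_derivative f (at x) v)"
  using Ck_on_SucD(2) unfolding smooth_on_def by blast

lemma smooth_on_imp_continuous_on: "smooth_on S f \<Longrightarrow> continuous_on S f"
  unfolding smooth_on_def by (drule spec[of _ 0]) simp

lemma smooth_on_linear_frechet: "smooth_on S f \<Longrightarrow> x \<in> S \<Longrightarrow> linear (frechet_derivative f (at x))"
  by (blast dest: smooth_on_has_derivative has_derivative_bounded_linear bounded_linear.linear)

text \<open>The direction varies with the point; expanding it in the basis reduces the claim to constant
  directions.\<close>

lemma smooth_on_frechet_derivative_field:
  fixes B :: "'m::real_normed_vector list" and f :: "'m \<Rightarrow> 'f::real_normed_vector"
  assumes "ordered_basis B" "open S" "smooth_on S f" "smooth_on S X"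
  shows "smooth_on S (\<lambda>x. frechet_derivative f (at x) (X x))"
proof -
  have "smooth_on S (\<lambda>x. \<Sum>i<length B. representation (set B) (X x) (B ! i) *\<^sub>R
      frechet_derivative f (at x) (B ! i))"
    by (intro smooth_on_sum smooth_on_bilinear[OF _ bounded_bilinear_scaleR] assms
        smooth_on_bounded_linear[OF _ bounded_linear_representation] smooth_on_frechet_derivative)
  thus ?thesis
    using linear_basis_expansion[OF assms(1) smooth_on_linear_frechet[OF assms(3)]]
    by (subst smooth_on_cong[OF assms(2)]) auto
qed

section \<open>Symmetry of second derivatives\<close>

text \<open>The second difference of \<open>f\<close> over a small parallelogram is, by two applications of the mean
  value theorem, a value of either mixed derivative near the corner.\<close>

lemma second_difference_mean_value:
  fixes f :: "'e::real_normed_vector \<Rightarrow> real"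
  assumes f: "smooth_on (ball x d) f" and s: "0 < s" "s * (norm v + norm w) < d"
  obtains y where "y \<in> ball x d" and
    "f (x + s *\<^sub>R v + s *\<^sub>R w) - f (x + s *\<^sub>R v) - f (x + s *\<^sub>R w) + f x =
      s * s * frechet_derivative (\<lambda>y. frechet_derivative f (at y) v) (at y) w"
proof -
  let ?D = "\<lambda>y. frechet_derivative f (at y) v"
  have close: "norm (t *\<^sub>R v + u *\<^sub>R w) \<le> s * (norm v + norm w)"
    if "0 \<le> t" "t \<le> s" "0 \<le> u" "u \<le> s" for t u
  proof -
    have "norm (t *\<^sub>R v + u *\<^sub>R w) \<le> t * norm v + u * norm w"
      using norm_triangle_ineq[of "t *\<^sub>R v" "u *\<^sub>R w"] that by simp
    also have "\<dots> \<le> s * norm v + s * norm w"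
      using that by (intro add_mono mult_right_mono) auto
    finally show ?thesis by (simp add: algebra_simps)
  qed
  have inball: "x + t *\<^sub>R v + u *\<^sub>R w \<in> ball x d" if "0 \<le> t" "t \<le> s" "0 \<le> u" "u \<le> s" for t u
  proof -
    have "x - (x + t *\<^sub>R v + u *\<^sub>R w) = - (t *\<^sub>R v + u *\<^sub>R w)"
      by simp
    hence "dist x (x + t *\<^sub>R v + u *\<^sub>R w) = norm (t *\<^sub>R v + u *\<^sub>R w)"
      by (simp only: dist_norm norm_minus_cancel)
    thus ?thesis
      using close[OF that] s(2) by simp
  qed
  have der: "((\<lambda>t. h (a + t *\<^sub>R b)) has_real_derivative frechet_derivative h (at (a + t *\<^sub>R b)) b) (at t)"
    if h: "smooth_on (ball x d) h" and a: "a + t *\<^sub>R b \<in> ball x d" for h :: "'e \<Rightarrow> real" and a b t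
  proof -
    note hd = smooth_on_has_derivative[OF h a]
    have "((\<lambda>t. a + t *\<^sub>R b) has_derivative (\<lambda>r. r *\<^sub>R b)) (at t)"
      by (auto intro!: derivative_eq_intros)
    from has_derivative_compose[OF this hd] show ?thesis
      unfolding has_field_derivative_def
      using linear_cmul[OF bounded_linear.linear[OF has_derivative_bounded_linear[OF hd]]]
      by (simp add: mult_commute_abs)
  qed
  have "\<exists>t>0. t < s \<and> (f ((x + s *\<^sub>R w) + s *\<^sub>R v) - f (x + s *\<^sub>R v)) - (f ((x + s *\<^sub>R w) + 0 *\<^sub>R v) - f (x + 0 *\<^sub>R v)) =
      (s - 0) * (?D ((x + s *\<^sub>R w) + t *\<^sub>R v) - ?D (x + t *\<^sub>R v))"
  proof (rule MVT2)
    fix t assume t: "0 \<le> t" "t \<le> s"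
    show "((\<lambda>t. f ((x + s *\<^sub>R w) + t *\<^sub>R v) - f (x + t *\<^sub>R v)) has_real_derivative
        ?D ((x + s *\<^sub>R w) + t *\<^sub>R v) - ?D (x + t *\<^sub>R v)) (at t)"
      using inball[OF t, of s] inball[OF t, of 0] s(1)
      by (intro DERIV_diff der f) (auto simp: add_ac)
  qed (use s in auto)
  then obtain t where t: "0 < t" "t < s" and
    eq1: "f (x + s *\<^sub>R v + s *\<^sub>R w) - f (x + s *\<^sub>R v) - f (x + s *\<^sub>R w) + f x =
      s * (?D (x + t *\<^sub>R v + s *\<^sub>R w) - ?D (x + t *\<^sub>R v))"
    by (auto simp: add_ac)
  have "\<exists>u>0. u < s \<and> ?D ((x + t *\<^sub>R v) + s *\<^sub>R w) - ?D ((x + t *\<^sub>R v) + 0 *\<^sub>R w) =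
      (s - 0) * frechet_derivative ?D (at ((x + t *\<^sub>R v) + u *\<^sub>R w)) w"
  proof (rule MVT2)
    fix u assume u: "0 \<le> u" "u \<le> s"
    show "((\<lambda>u. ?D ((x + t *\<^sub>R v) + u *\<^sub>R w)) has_real_derivative
        frechet_derivative ?D (at ((x + t *\<^sub>R v) + u *\<^sub>R w)) w) (at u)"
      using inball[of t u] t u by (intro der smooth_on_frechet_derivative f) auto
  qed (use s in auto)
  then obtain u where u: "0 < u" "u < s" and
    eq2: "?D (x + t *\<^sub>R v + s *\<^sub>R w) - ?D (x + t *\<^sub>R v) =
      s * frechet_derivative ?D (at (x + t *\<^sub>R v + u *\<^sub>R w)) w"
    by auto
  show thesis
  proof (rule that)
    show "x + t *\<^sub>R v + u *\<^sub>R w \<in> ball x d"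
      using t u by (intro inball) auto
  qed (use eq1 eq2 in simp)
qed

lemma second_derivative_symmetric_real:
  fixes f :: "'e::real_normed_vector \<Rightarrow> real"
  assumes f: "smooth_on S f" and S: "open S" "x \<in> S"
  shows "frechet_derivative (\<lambda>y. frechet_derivative f (at y) v) (at x) w =
    frechet_derivative (\<lambda>y. frechet_derivative f (at y) w) (at x) v"
proof (rule ccontr)
  define A B where "A = (\<lambda>x. frechet_derivative (\<lambda>y. frechet_derivative f (at y) v) (at x) w)"
    and "B = (\<lambda>x. frechet_derivative (\<lambda>y. frechet_derivative f (at y) w) (at x) v)"
  assume "\<not> ?thesis"
  hence e: "\<bar>A x - B x\<bar> / 2 > 0"
    by (simp add: A_def B_def)
  have "continuous_on S A" "continuous_on S B"
    unfolding A_def B_def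
    by (intro smooth_on_imp_continuous_on smooth_on_frechet_derivative f)+
  hence "isCont A x" "isCont B x"
    using S by (auto simp: continuous_on_eq_continuous_at)
  then obtain d1 d2 where d1: "d1 > 0" "\<And>y. dist y x < d1 \<Longrightarrow> dist (A y) (A x) < \<bar>A x - B x\<bar> / 2"
    and d2: "d2 > 0" "\<And>y. dist y x < d2 \<Longrightarrow> dist (B y) (B x) < \<bar>A x - B x\<bar> / 2"
    unfolding continuous_at_eps_delta using e by metis
  obtain d0 where d0: "d0 > 0" "ball x d0 \<subseteq> S"
    using S by (meson openE)
  define d where "d = min d0 (min d1 d2)"
  have d: "d > 0"
    using d0 d1 d2 by (simp add: d_def)
  (* Half of d / q keeps the parallelogram with sides s v and s w inside the ball; the summand 1 in q
     allows v = w = 0. *)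
  define q where "q = norm v + norm w + 1"
  have pos: "q > 0"
    unfolding q_def by (smt (verit) norm_ge_zero)
  define s where "s = d / q / 2"
  have s: "s > 0" "s * (norm v + norm w) < d"
  proof -
    show "s > 0"
      using d pos by (simp add: s_def)
    hence "s * (norm v + norm w) \<le> s * q"
      by (simp add: q_def)
    also have "\<dots> = d / 2"
      using pos by (simp add: s_def)
    finally show "s * (norm v + norm w) < d"
      using d by simp
  qed
  have fb: "smooth_on (ball x d) f"
    using d0(2) by (intro smooth_on_subset[OF f]) (auto simp: d_def)
  obtain y where y: "y \<in> ball x d"
    "f (x + s *\<^sub>R v + s *\<^sub>R w) - f (x + s *\<^sub>R v) - f (x + s *\<^sub>R w) + f x = s * s * A y"
    using second_difference_mean_value[OF fb s] unfolding A_def by metis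
  obtain z where z: "z \<in> ball x d"
    "f (x + s *\<^sub>R w + s *\<^sub>R v) - f (x + s *\<^sub>R w) - f (x + s *\<^sub>R v) + f x = s * s * B z"
    using second_difference_mean_value[OF fb s(1), of w v] s(2) unfolding B_def
    by (metis add.commute)
  have "s * s * A y = s * s * B z"
    using y(2) z(2) by (simp add: algebra_simps)
  hence "A y = B z"
    using s(1) by simp
  moreover have "dist (A y) (A x) < \<bar>A x - B x\<bar> / 2" "dist (B z) (B x) < \<bar>A x - B x\<bar> / 2"
    using y(1) z(1) d1(2)[of y] d2(2)[of z] by (simp_all add: d_def dist_commute)
  ultimately show False
    unfolding dist_real_def by (smt (verit) field_sum_of_halves)
qed

text \<open>The vector-valued case follows by taking inner products with constant vectors.\<close>

lemma second_derivative_symmetric: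
  fixes f :: "'e::real_normed_vector \<Rightarrow> 'g::real_inner"
  assumes f: "smooth_on S f" and S: "open S" "x \<in> S"
  shows "frechet_derivative (\<lambda>y. frechet_derivative f (at y) v) (at x) w =
    frechet_derivative (\<lambda>y. frechet_derivative f (at y) w) (at x) v" (is "?a = ?b")
proof -
  have d: "frechet_derivative (\<lambda>y. h y \<bullet> u) (at z) v = frechet_derivative h (at z) v \<bullet> u"
    if "smooth_on S h" "z \<in> S" for h :: "'e \<Rightarrow> 'g" and u z v
    using frechet_derivative_at[OF has_derivative_inner_left[OF smooth_on_has_derivative[OF that]], of u]
    by metis
  have dd: "frechet_derivative (\<lambda>y. frechet_derivative (\<lambda>y. f y \<bullet> u) (at y) v) (at x) w =
      frechet_derivative (\<lambda>y. frechet_derivative f (at y) v) (at x) w \<bullet> u" for u v w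
  proof -
    have "frechet_derivative (\<lambda>y. frechet_derivative (\<lambda>y. f y \<bullet> u) (at y) v) (at x) =
        frechet_derivative (\<lambda>y. frechet_derivative f (at y) v \<bullet> u) (at x)"
      by (rule frechet_derivative_cong_open[OF S]) (rule d[OF f])
    thus ?thesis
      by (simp add: d[OF smooth_on_frechet_derivative[OF f] S(2)])
  qed
  have "smooth_on S (\<lambda>y. f y \<bullet> u)" for u
    by (rule smooth_on_bounded_linear[OF S(1) bounded_linear_inner_left f])
  hence "?a \<bullet> u = ?b \<bullet> u" for u
    using second_derivative_symmetric_real[OF _ S, of "\<lambda>y. f y \<bullet> u" v w] by (simp add: dd)
  hence "(?a - ?b) \<bullet> (?a - ?b) = 0"
    by (simp add: inner_diff_left)
  thus ?thesis
    by simp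
qed

section \<open>Smooth manifolds\<close>

text \<open>An atlas with its smooth structure, without the orientation. Products of manifolds are formed at
  this level.\<close>

locale smooth_manifold =
  fixes M :: "('a::t2_space, 'e::real_normed_vector) manifold"
  assumes frame: "ordered_basis (model_frame M)"
    and chart_open: "c \<in> atlas M \<Longrightarrow> open (fst c)"
    and chart_image_open: "c \<in> atlas M \<Longrightarrow> open (snd c ` fst c)"
    and chart_homeomorphism:
      "c \<in> atlas M \<Longrightarrow> homeomorphism (fst c) (snd c ` fst c) (snd c) (chart_inv c)"
    and chart_at_atlas: "chart_at M x \<in> atlas M"
    and chart_at_mem: "x \<in> fst (chart_at M x)"
    and transition: "c \<in> atlas M \<Longrightarrow> d \<in> atlas M \<Longrightarrow>
      smooth_on (snd c ` (fst c \<inter> fst d)) (snd d \<circ> chart_inv c)"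

lemma oriented_imp_smooth_manifold:
  assumes "oriented_manifold M"
  shows "smooth_manifold M"
  using assms unfolding oriented_manifold_def smooth_manifold_def chart_inv_def
  by (auto simp: case_prod_beta)

context smooth_manifold
begin

lemma chart_inv_chart: "c \<in> atlas M \<Longrightarrow> x \<in> fst c \<Longrightarrow> chart_inv c (snd c x) = x"
  using homeomorphism_apply1[OF chart_homeomorphism] .

lemma chart_chart_inv: "c \<in> atlas M \<Longrightarrow> u \<in> snd c ` fst c \<Longrightarrow> snd c (chart_inv c u) = u"
  using homeomorphism_apply2[OF chart_homeomorphism] .

lemma chart_inv_mem: "c \<in> atlas M \<Longrightarrow> u \<in> snd c ` fst c \<Longrightarrow> chart_inv c u \<in> fst c"
  by (metis chart_inv_chart imageE)

lemma mem_chart_image: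
  "c \<in> atlas M \<Longrightarrow> u \<in> snd c ` (fst c \<inter> W) \<longleftrightarrow> u \<in> snd c ` fst c \<and> chart_inv c u \<in> W"
proof -
  assume c: "c \<in> atlas M"
  show "u \<in> snd c ` (fst c \<inter> W) \<longleftrightarrow> u \<in> snd c ` fst c \<and> chart_inv c u \<in> W"
  proof
    assume "u \<in> snd c ` (fst c \<inter> W)"
    thus "u \<in> snd c ` fst c \<and> chart_inv c u \<in> W"
      using chart_inv_chart[OF c] by auto
  next
    assume u: "u \<in> snd c ` fst c \<and> chart_inv c u \<in> W"
    hence "u = snd c (chart_inv c u)" "chart_inv c u \<in> fst c \<inter> W"
      using chart_chart_inv[OF c] chart_inv_mem[OF c] by auto
    thus "u \<in> snd c ` (fst c \<inter> W)"
      by (rule image_eqI)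
  qed
qed

lemma open_chart_image:
  assumes c: "c \<in> atlas M" and W: "open W"
  shows "open (snd c ` (fst c \<inter> W))"
proof -
  have "open {u \<in> snd c ` fst c. chart_inv c u \<in> W}"
    using homeomorphism_cont2[OF chart_homeomorphism[OF c]] chart_image_open[OF c] W
    by (rule continuous_open_preimage[unfolded vimage_def Int_def, simplified])
  also have "{u \<in> snd c ` fst c. chart_inv c u \<in> W} = snd c ` (fst c \<inter> W)"
    using mem_chart_image[OF c] by blast
  finally show ?thesis .
qed

lemma msmooth_onD:
  "msmooth_on M W f \<Longrightarrow> c \<in> atlas M \<Longrightarrow> smooth_on (snd c ` (fst c \<inter> W)) (f \<circ> chart_inv c)"
  by (simp add: msmooth_on_def)

lemma msmooth_on_subset: "msmooth_on M W f \<Longrightarrow> V \<subseteq> W \<Longrightarrow> msmooth_on M V f"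
  unfolding msmooth_on_def by (blast intro: smooth_on_subset)

lemma smooth_field_on_subset: "smooth_field_on M W X \<Longrightarrow> V \<subseteq> W \<Longrightarrow> smooth_field_on M V X"
  unfolding smooth_field_on_def by (blast intro: smooth_on_subset)

text \<open>A single chart around each point is enough because the transition maps are smooth.\<close>

lemma msmooth_onI:
  assumes "\<And>x. x \<in> W \<Longrightarrow> \<exists>c\<in>atlas M. \<exists>V. open V \<and> x \<in> V \<and> x \<in> fst c \<and>
      smooth_on (snd c ` (fst c \<inter> V)) (f \<circ> chart_inv c)"
  shows "msmooth_on M W f"
  unfolding msmooth_on_def
proof (intro ballI smooth_on_local)
  fix d u assume d: "d \<in> atlas M" and u: "u \<in> snd d ` (fst d \<inter> W)"
  then obtain x where x: "x \<in> fst d" "x \<in> W" "u = snd d x"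
    by auto
  from assms[OF x(2)] obtain c V where c: "c \<in> atlas M" "x \<in> fst c" and V: "open V" "x \<in> V"
    and f: "smooth_on (snd c ` (fst c \<inter> V)) (f \<circ> chart_inv c)"
    by blast
  let ?T = "snd d ` (fst d \<inter> (fst c \<inter> V))"
  have T: "open ?T"
    by (intro open_chart_image d open_Int chart_open c V)
  have "smooth_on ?T (\<lambda>u. (f \<circ> chart_inv c) ((snd c \<circ> chart_inv d) u))"
  proof (rule smooth_on_compose[OF frame T open_chart_image[OF c(1) V(1)] _ _ f])
    show "smooth_on ?T (snd c \<circ> chart_inv d)"
      by (rule smooth_on_subset[OF transition[OF d c(1)]]) auto
  qed (auto simp: chart_inv_chart[OF d])
  hence "smooth_on ?T (f \<circ> chart_inv d)"
    by (subst smooth_on_cong[OF T, of _ "\<lambda>u. (f \<circ> chart_inv c) ((snd c \<circ> chart_inv d) u)"])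
       (auto simp: chart_inv_chart[OF d] chart_inv_chart[OF c(1)])
  thus "\<exists>T. open T \<and> u \<in> T \<and> smooth_on T (f \<circ> chart_inv d)"
    using T x c(2) V(2) by blast
qed

lemma msmooth_on_imp_continuous_on:
  assumes "msmooth_on M W f" "open W"
  shows "continuous_on W f"
proof -
  have "isCont f x" if x: "x \<in> W" for x
  proof -
    let ?c = "chart_at M x"
    have "continuous_on (snd ?c ` (fst ?c \<inter> W)) (f \<circ> chart_inv ?c)"
      by (intro smooth_on_imp_continuous_on msmooth_onD assms chart_at_atlas)
    moreover have "continuous_on (fst ?c \<inter> W) (snd ?c)"
      using homeomorphism_cont1[OF chart_homeomorphism[OF chart_at_atlas]]
      by (rule continuous_on_subset) auto
    ultimately have "continuous_on (fst ?c \<inter> W) (\<lambda>y. (f \<circ> chart_inv ?c) (snd ?c y))"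
      by (rule continuous_on_compose2) auto
    hence "continuous_on (fst ?c \<inter> W) f"
      by (rule continuous_on_eq) (auto simp: chart_inv_chart[OF chart_at_atlas])
    moreover have "open (fst ?c \<inter> W)"
      by (intro open_Int chart_open[OF chart_at_atlas] assms(2))
    ultimately show ?thesis
      using x chart_at_mem by (auto simp: continuous_on_eq_continuous_at)
  qed
  thus ?thesis
    by (simp add: continuous_at_imp_continuous_on)
qed

lemma msmooth_on_differentiable:
  assumes "msmooth_on M W f" "x \<in> W" "c \<in> atlas M" "x \<in> fst c"
  shows "((f \<circ> chart_inv c) has_derivative frechet_derivative (f \<circ> chart_inv c) (at (snd c x))) (at (snd c x))"
  by (rule smooth_on_has_derivative[OF msmooth_onD[OF assms(1,3)]]) (use assms in auto)

lemma mderiv_has_derivative: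
  assumes "msmooth_on M W f" "x \<in> W"
  shows "((f \<circ> chart_inv (chart_at M x)) has_derivative mderiv M f x) (at (snd (chart_at M x) x))"
  unfolding mderiv_def by (rule msmooth_on_differentiable[OF assms chart_at_atlas chart_at_mem])

lemma linear_mderiv: "msmooth_on M W f \<Longrightarrow> x \<in> W \<Longrightarrow> linear (mderiv M f x)"
  using mderiv_has_derivative has_derivative_bounded_linear bounded_linear.linear by blast

lemma mderiv_cong_open:
  assumes "open W" "x \<in> W" "\<And>y. y \<in> W \<Longrightarrow> f y = f' y"
  shows "mderiv M f x = mderiv M f' x"
  unfolding mderiv_def
proof (rule frechet_derivative_cong_open[OF open_chart_image[OF chart_at_atlas assms(1)]])
  show "snd (chart_at M x) x \<in> snd (chart_at M x) ` (fst (chart_at M x) \<inter> W)"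
    using chart_at_mem assms(2) by blast
qed (auto simp: chart_inv_chart[OF chart_at_atlas] assms(3))

lemma msmooth_on_add:
  assumes "open W" "msmooth_on M W f" "msmooth_on M W f'"
  shows "msmooth_on M W (\<lambda>x. f x + f' x)"
  unfolding msmooth_on_def comp_def
  by (intro ballI smooth_on_add open_chart_image assms(1) msmooth_onD[OF assms(2), unfolded comp_def]
      msmooth_onD[OF assms(3), unfolded comp_def])

lemma mderiv_add:
  assumes "msmooth_on M W f" "msmooth_on M W f'" "x \<in> W"
  shows "mderiv M (\<lambda>x. f x + f' x) x v = mderiv M f x v + mderiv M f' x v"
  using frechet_derivative_at[OF has_derivative_add[OF mderiv_has_derivative[OF assms(1,3)]
        mderiv_has_derivative[OF assms(2,3)]]]
  unfolding mderiv_def[of M "\<lambda>x. f x + f' x"] comp_def by metis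

text \<open>The differential \<^const>\<open>mderiv\<close> refers to a chart that jumps from point to point. This chain rule
  moves it to one chart, in which smoothness can be discussed; \<open>mderiv M (snd c) x\<close> is the change
  of coordinates of tangent vectors.\<close>

lemma mderiv_in_chart:
  assumes c: "c \<in> atlas M" "x \<in> fst c"
    and f: "(f \<circ> chart_inv c) differentiable (at (snd c x))"
  shows "mderiv M f x v = frechet_derivative (f \<circ> chart_inv c) (at (snd c x)) (mderiv M (snd c) x v)"
proof -
  let ?a = "chart_at M x"
  let ?u = "snd ?a x"
  let ?T = "snd ?a ` (fst ?a \<inter> fst c)"
  have T: "open ?T" "?u \<in> ?T"
    using open_chart_image[OF chart_at_atlas chart_open[OF c(1)]] chart_at_mem c(2) by auto
  have tr: "((snd c \<circ> chart_inv ?a) has_derivative mderiv M (snd c) x) (at ?u)"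
    unfolding mderiv_def by (rule smooth_on_has_derivative[OF transition[OF chart_at_atlas c(1)] T(2)])
  have u: "(snd c \<circ> chart_inv ?a) ?u = snd c x"
    by (simp add: chart_inv_chart[OF chart_at_atlas chart_at_mem])
  have "((\<lambda>u. (f \<circ> chart_inv c) ((snd c \<circ> chart_inv ?a) u)) has_derivative
      (\<lambda>v. frechet_derivative (f \<circ> chart_inv c) (at (snd c x)) (mderiv M (snd c) x v))) (at ?u)"
    by (rule has_derivative_compose[OF tr]) (use f frechet_derivative_works in \<open>unfold u, blast\<close>)
  hence "((f \<circ> chart_inv ?a) has_derivative
      (\<lambda>v. frechet_derivative (f \<circ> chart_inv c) (at (snd c x)) (mderiv M (snd c) x v))) (at ?u)"
    by (rule has_derivative_transform_within_open[OF _ T])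
       (auto simp: chart_inv_chart[OF chart_at_atlas] chart_inv_chart[OF c(1)])
  thus ?thesis
    unfolding mderiv_def[of M f] using frechet_derivative_at by metis
qed

lemma msmooth_on_chart: "c \<in> atlas M \<Longrightarrow> msmooth_on M (fst c) (snd c)"
  by (simp add: msmooth_on_def transition)

lemma mderiv_chart_at: "mderiv M (snd (chart_at M x)) x v = v"
proof -
  let ?c = "chart_at M x"
  have "mderiv M (snd ?c) x = frechet_derivative (\<lambda>u. u) (at (snd ?c x))"
    unfolding mderiv_def
    by (rule frechet_derivative_cong_open[OF chart_image_open[OF chart_at_atlas]])
       (use chart_at_mem in \<open>auto simp: chart_inv_chart[OF chart_at_atlas]\<close>)
  thus ?thesis by simp
qed

end

text \<open>The coordinate vector fields of the chart \<open>c\<close>: constant in that chart, but recorded at \<open>x\<close> in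
  the coordinates of \<open>chart_at M x\<close>, in which tangent vectors at \<open>x\<close> are given.\<close>

definition coord_field ::
  "('a::t2_space, 'e::real_normed_vector) manifold \<Rightarrow> ('a, 'e) chart \<Rightarrow> 'e \<Rightarrow> 'a \<Rightarrow> 'e"
  where "coord_field M c v x =
    frechet_derivative (snd (chart_at M x) \<circ> chart_inv c) (at (snd c x)) v"

context smooth_manifold
begin

lemma mderiv_coord_field:
  assumes c: "c \<in> atlas M" "x \<in> fst c"
  shows "mderiv M (snd c) x (coord_field M c v x) = v"
proof -
  let ?a = "chart_at M x"
  let ?T = "snd c ` (fst c \<inter> fst ?a)"
  have T: "open ?T" "snd c x \<in> ?T"
    using open_chart_image[OF c(1) chart_open[OF chart_at_atlas]] c(2) chart_at_mem by auto
  have d1: "((snd ?a \<circ> chart_inv c) has_derivative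
      frechet_derivative (snd ?a \<circ> chart_inv c) (at (snd c x))) (at (snd c x))"
    by (rule smooth_on_has_derivative[OF transition[OF c(1) chart_at_atlas] T(2)])
  have d2: "((snd c \<circ> chart_inv ?a) has_derivative mderiv M (snd c) x) (at ((snd ?a \<circ> chart_inv c) (snd c x)))"
    using mderiv_has_derivative[OF msmooth_on_chart[OF c(1)] c(2)] by (simp add: chart_inv_chart[OF c])
  from has_derivative_compose[OF d1 d2]
  have "((\<lambda>u. (snd c \<circ> chart_inv ?a) ((snd ?a \<circ> chart_inv c) u)) has_derivative
      (\<lambda>v. mderiv M (snd c) x (coord_field M c v x))) (at (snd c x))"
    by (simp add: coord_field_def)
  hence "((\<lambda>u. u) has_derivative (\<lambda>v. mderiv M (snd c) x (coord_field M c v x))) (at (snd c x))"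
    by (rule has_derivative_transform_within_open[OF _ T])
       (auto simp: chart_inv_chart[OF chart_at_atlas] chart_inv_chart[OF c(1)])
  from has_derivative_unique[OF this has_derivative_ident] show ?thesis
    by metis
qed

lemma coord_field_mderiv:
  assumes c: "c \<in> atlas M" "x \<in> fst c"
  shows "coord_field M c (mderiv M (snd c) x v) x = v"
proof -
  have "mderiv M (snd (chart_at M x)) x v =
      frechet_derivative (snd (chart_at M x) \<circ> chart_inv c) (at (snd c x)) (mderiv M (snd c) x v)"
    by (rule mderiv_in_chart[OF c differentiableI, OF msmooth_on_differentiable[OF
        msmooth_on_chart[OF chart_at_atlas] chart_at_mem c]])
  thus ?thesis
    by (simp add: mderiv_chart_at coord_field_def)
qed

lemma coord_field_at: "coord_field M (chart_at M x) v x = v"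
  using coord_field_mderiv[OF chart_at_atlas chart_at_mem] by (simp add: mderiv_chart_at)

lemma mderiv_smooth_in_chart:
  assumes "msmooth_on M W f" "x \<in> W" "c \<in> atlas M" "x \<in> fst c"
  shows "mderiv M f x v = frechet_derivative (f \<circ> chart_inv c) (at (snd c x)) (mderiv M (snd c) x v)"
  by (rule mderiv_in_chart[OF assms(3,4) differentiableI[OF msmooth_on_differentiable[OF assms]]])

lemma mderiv_coord_direction:
  assumes "msmooth_on M W f" "x \<in> W" "c \<in> atlas M" "x \<in> fst c"
  shows "mderiv M f x (coord_field M c v x) = frechet_derivative (f \<circ> chart_inv c) (at (snd c x)) v"
  using mderiv_smooth_in_chart[OF assms] mderiv_coord_field[OF assms(3,4)] by simp

lemma field_in_chart_eq:
  "c \<in> atlas M \<Longrightarrow> x \<in> fst c \<Longrightarrow> field_in_chart M c X (snd c x) = mderiv M (snd c) x (X x)"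
  by (simp add: field_in_chart_def chart_inv_chart)

lemma field_in_chart_at: "field_in_chart M (chart_at M x) X (snd (chart_at M x) x) = X x"
  by (simp add: field_in_chart_eq[OF chart_at_atlas chart_at_mem] mderiv_chart_at)

lemma field_in_chart_coord_field:
  assumes "c \<in> atlas M" "u \<in> snd c ` fst c"
  shows "field_in_chart M c (coord_field M c v) u = v"
  using mderiv_coord_field[OF assms(1) chart_inv_mem[OF assms]] by (simp add: field_in_chart_def)

lemma smooth_coord_field:
  assumes c: "c \<in> atlas M"
  shows "smooth_field_on M (fst c) (coord_field M c v)"
  unfolding smooth_field_on_def
proof
  fix d assume d: "d \<in> atlas M"
  let ?T = "snd d ` (fst d \<inter> fst c)"
  have T: "open ?T"
    by (rule open_chart_image[OF d chart_open[OF c]])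
  have "smooth_on ?T (\<lambda>u. frechet_derivative (snd d \<circ> chart_inv c) (at ((snd c \<circ> chart_inv d) u)) v)"
    by (rule smooth_on_compose[OF frame T open_chart_image[OF c chart_open[OF d]] _ transition[OF d c]
          smooth_on_frechet_derivative[OF transition[OF c d]]])
       (auto simp: chart_inv_chart[OF d])
  thus "smooth_on ?T (field_in_chart M d (coord_field M c v))"
    by (subst smooth_on_cong[OF T])
       (auto simp: field_in_chart_eq[OF d] chart_inv_chart[OF d]
         mderiv_coord_direction[OF msmooth_on_chart[OF d] _ c])
qed

lemma msmooth_on_bounded_linear:
  assumes "bounded_linear L" "open W" "msmooth_on M W f"
  shows "msmooth_on M W (\<lambda>x. L (f x))"
  unfolding msmooth_on_def comp_def
  by (intro ballI smooth_on_bounded_linear[OF _ assms(1)] open_chart_image assms(2)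
      msmooth_onD[OF assms(3), unfolded comp_def])

lemma mderiv_bounded_linear:
  assumes "bounded_linear L" "msmooth_on M W f" "x \<in> W"
  shows "mderiv M (\<lambda>x. L (f x)) x v = L (mderiv M f x v)"
  using frechet_derivative_at[OF bounded_linear.has_derivative[OF assms(1) mderiv_has_derivative[OF assms(2,3)]]]
  unfolding mderiv_def[of M "\<lambda>x. L (f x)"] comp_def by metis

lemma msmooth_on_bilinear:
  assumes "bounded_bilinear b" "open W" "msmooth_on M W f" "msmooth_on M W h"
  shows "msmooth_on M W (\<lambda>x. b (f x) (h x))"
  unfolding msmooth_on_def comp_def
  by (intro ballI smooth_on_bilinear[OF _ assms(1)] open_chart_image assms(2)
      msmooth_onD[OF assms(3), unfolded comp_def] msmooth_onD[OF assms(4), unfolded comp_def])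

lemma mderiv_bilinear:
  assumes "bounded_bilinear b" "msmooth_on M W f" "msmooth_on M W h" "x \<in> W"
  shows "mderiv M (\<lambda>x. b (f x) (h x)) x v = b (f x) (mderiv M h x v) + b (mderiv M f x v) (h x)"
  using frechet_derivative_at[OF bounded_bilinear.FDERIV[OF assms(1) mderiv_has_derivative[OF assms(2,4)]
        mderiv_has_derivative[OF assms(3,4)]]]
  unfolding mderiv_def[of M "\<lambda>x. b (f x) (h x)"] comp_def chart_inv_chart[OF chart_at_atlas chart_at_mem]
  by metis

lemma msmooth_on_cmod:
  fixes f :: "'a \<Rightarrow> complex"
  assumes "msmooth_on M UNIV f" "\<And>x. f x \<noteq> 0"
  shows "msmooth_on M UNIV (\<lambda>x. cmod (f x))"
  unfolding msmooth_on_def comp_def norm_eq_sqrt_inner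
  by (intro ballI smooth_on_sqrt smooth_on_bilinear[OF _ bounded_bilinear_inner] open_chart_image open_UNIV
      msmooth_onD[OF assms(1), unfolded comp_def]) (auto simp: assms(2))

lemma msmooth_on_power:
  fixes f :: "'a \<Rightarrow> complex"
  assumes "open W" "msmooth_on M W f"
  shows "msmooth_on M W (\<lambda>x. f x ^ k)"
  unfolding msmooth_on_def comp_def
  by (intro ballI smooth_on_power open_chart_image assms(1) msmooth_onD[OF assms(2), unfolded comp_def])

end

section \<open>Product manifolds\<close>

definition prod_basis :: "'e::zero list \<Rightarrow> 'f::zero list \<Rightarrow> ('e \<times> 'f) list"
  where "prod_basis A B = map (\<lambda>v. (v, 0)) A @ map (\<lambda>w. (0, w)) B"

lemma length_prod_basis [simp]: "length (prod_basis A B) = length A + length B"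
  by (simp add: prod_basis_def)

lemma ordered_basis_not_zero: "ordered_basis B \<Longrightarrow> 0 \<notin> set B"
  unfolding ordered_basis_def using real_vector.dependent_zero by blast

text \<open>Since a combination of the product basis splits into its two components, independence and
  coordinates can be read off componentwise.\<close>

lemma prod_basis_combination:
  fixes A :: "'e::real_vector list" and B :: "'f::real_vector list"
  assumes "ordered_basis A" "ordered_basis B"
  shows "distinct (prod_basis A B)"
    and "(\<Sum>p\<in>set (prod_basis A B). h p *\<^sub>R p) =
      (\<Sum>v\<in>set A. h (v, 0) *\<^sub>R v, \<Sum>w\<in>set B. h (0, w) *\<^sub>R w)"
proof -
  have disj: "(\<lambda>v. (v, 0)) ` set A \<inter> (\<lambda>w. (0, w)) ` set B = ({} :: ('e \<times> 'f) set)"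
    using ordered_basis_not_zero[OF assms(1)] by auto
  show "distinct (prod_basis A B)"
    using assms disj by (auto simp: prod_basis_def ordered_basis_def distinct_map inj_on_def)
  have "(\<Sum>p\<in>set (prod_basis A B). h p *\<^sub>R p) =
      (\<Sum>p\<in>(\<lambda>v. (v, 0)) ` set A. h p *\<^sub>R p) + (\<Sum>p\<in>(\<lambda>w. (0, w)) ` set B. h p *\<^sub>R p)"
    unfolding prod_basis_def set_append set_map by (rule sum.union_disjoint) (use disj in auto)
  also have "\<dots> = (\<Sum>v\<in>set A. h (v, 0) *\<^sub>R (v, 0)) + (\<Sum>w\<in>set B. h (0, w) *\<^sub>R (0, w))"
    by (simp add: sum.reindex inj_on_def)
  also have "\<dots> = (\<Sum>v\<in>set A. h (v, 0) *\<^sub>R v, \<Sum>w\<in>set B. h (0, w) *\<^sub>R w)"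
    by (simp add: prod_eq_iff fst_sum snd_sum)
  finally show "(\<Sum>p\<in>set (prod_basis A B). h p *\<^sub>R p) =
      (\<Sum>v\<in>set A. h (v, 0) *\<^sub>R v, \<Sum>w\<in>set B. h (0, w) *\<^sub>R w)" .
qed

lemma ordered_basis_prod_basis:
  fixes A :: "'e::real_vector list" and B :: "'f::real_vector list"
  assumes A: "ordered_basis A" and B: "ordered_basis B"
  shows "ordered_basis (prod_basis A B)"
  unfolding ordered_basis_def
proof (intro conjI)
  note comb = prod_basis_combination(2)[OF assms]
  show "distinct (prod_basis A B)"
    by (rule prod_basis_combination(1)[OF assms])
  show "independent (set (prod_basis A B))"
  proof
    assume "dependent (set (prod_basis A B))"
    then obtain h p where p: "p \<in> set (prod_basis A B)" "h p \<noteq> 0"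
      and "(\<Sum>p\<in>set (prod_basis A B). h p *\<^sub>R p) = 0"
      by (auto simp: real_vector.dependent_finite)
    hence "(\<Sum>v\<in>set A. h (v, 0) *\<^sub>R v) = 0" "(\<Sum>w\<in>set B. h (0, w) *\<^sub>R w) = 0"
      by (simp_all add: comb zero_prod_def)
    hence "\<forall>v\<in>set A. h (v, 0) = 0" "\<forall>w\<in>set B. h (0, w) = 0"
      using A B real_vector.independentD[of "set A" "set A" "\<lambda>v. h (v, 0)"]
        real_vector.independentD[of "set B" "set B" "\<lambda>w. h (0, w)"]
      by (auto simp: ordered_basis_def)
    with p show False
      by (auto simp: prod_basis_def)
  qed
  have "p \<in> span (set (prod_basis A B))" for p
  proof -
    obtain v w where p: "p = (v, w)" by fastforce
    define h where "h = (\<lambda>q :: 'e \<times> 'f. if snd q = 0 then representation (set A) v (fst q)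
      else representation (set B) w (snd q))"
    have "(\<Sum>b\<in>set A. h (b, 0) *\<^sub>R b) = (\<Sum>b\<in>set A. representation (set A) v b *\<^sub>R b)"
      by (simp add: h_def)
    moreover have "(\<Sum>b\<in>set B. h (0, b) *\<^sub>R b) = (\<Sum>b\<in>set B. representation (set B) w b *\<^sub>R b)"
      by (intro sum.cong refl) (use ordered_basis_not_zero[OF B] in \<open>auto simp: h_def\<close>)
    ultimately have "p = (\<Sum>q\<in>set (prod_basis A B). h q *\<^sub>R q)"
      using A B by (simp add: comb p ordered_basis_def real_vector.sum_representation_eq)
    thus ?thesis
      by (simp add: real_vector.span_sum real_vector.span_scale real_vector.span_base)
  qed
  thus "span (set (prod_basis A B)) = UNIV"
    by auto
qed

lemma representation_prod_basis:
  fixes A :: "'e::real_vector list" and B :: "'f::real_vector list"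
  assumes A: "ordered_basis A" and B: "ordered_basis B"
  shows "v \<in> set A \<Longrightarrow> representation (set (prod_basis A B)) p (v, 0) = representation (set A) (fst p) v"
    and "w \<in> set B \<Longrightarrow> representation (set (prod_basis A B)) p (0, w) = representation (set B) (snd p) w"
proof -
  have P: "independent (set (prod_basis A B))" "span (set (prod_basis A B)) = UNIV"
    using ordered_basis_prod_basis[OF assms] by (auto simp: ordered_basis_def)
  let ?h = "representation (set (prod_basis A B)) p"
  have "p = (\<Sum>q\<in>set (prod_basis A B). ?h q *\<^sub>R q)"
    using P by (simp add: real_vector.sum_representation_eq)
  also have "\<dots> = (\<Sum>v\<in>set A. ?h (v, 0) *\<^sub>R v, \<Sum>w\<in>set B. ?h (0, w) *\<^sub>R w)"
    by (rule prod_basis_combination(2)[OF assms])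
  finally have p: "p = (\<Sum>v\<in>set A. ?h (v, 0) *\<^sub>R v, \<Sum>w\<in>set B. ?h (0, w) *\<^sub>R w)" .
  have fst: "fst p = (\<Sum>v\<in>set A. ?h (v, 0) *\<^sub>R v)"
    by (rule trans[OF arg_cong[OF p, of fst]]) simp
  have snd: "snd p = (\<Sum>w\<in>set B. ?h (0, w) *\<^sub>R w)"
    by (rule trans[OF arg_cong[OF p, of snd]]) simp
  have uniq: "h b = representation (set C) q b"
    if C: "ordered_basis C" and q: "q = (\<Sum>b\<in>set C. h b *\<^sub>R b)" and b: "b \<in> set C"
    for C :: "'z::real_vector list" and h q b
  proof -
    have "(\<Sum>b\<in>set C. (h b - representation (set C) q b) *\<^sub>R b) = 0"
      using C by (simp add: scaleR_diff_left sum_subtractf q[symmetric] ordered_basis_def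
          real_vector.sum_representation_eq)
    thus ?thesis
      using real_vector.independentD[of "set C" "set C" "\<lambda>b. h b - representation (set C) q b" b] C b
      by (auto simp: ordered_basis_def)
  qed
  show "v \<in> set A \<Longrightarrow> ?h (v, 0) = representation (set A) (fst p) v"
    by (rule uniq[OF A fst])
  show "w \<in> set B \<Longrightarrow> ?h (0, w) = representation (set B) (snd p) w"
    by (rule uniq[OF B snd])
qed

lemma basis_trace_prod_basis:
  fixes A :: "'e::real_vector list" and B :: "'f::real_vector list"
  assumes A: "ordered_basis A" and B: "ordered_basis B"
  shows "basis_trace (prod_basis A B) L =
    basis_trace A (\<lambda>v. fst (L (v, 0))) + basis_trace B (\<lambda>w. snd (L (0, w)))"
proof -
  have "basis_trace (prod_basis A B) L =
    (\<Sum>i<length A. representation (set (prod_basis A B)) (L (A ! i, 0)) (A ! i, 0)) +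
    (\<Sum>i<length B. representation (set (prod_basis A B)) (L (0, B ! i)) (0, B ! i))"
    unfolding basis_trace_def length_prod_basis sum_lessThan_add
    by (simp add: prod_basis_def nth_append)
  also have "\<dots> = basis_trace A (\<lambda>v. fst (L (v, 0))) + basis_trace B (\<lambda>w. snd (L (0, w)))"
    by (simp add: basis_trace_def representation_prod_basis[OF assms])
  finally show ?thesis .
qed

definition prod_chart :: "('a, 'e) chart \<Rightarrow> ('b, 'f) chart \<Rightarrow> ('a \<times> 'b, 'e \<times> 'f) chart"
  where "prod_chart c d = (fst c \<times> fst d, map_prod (snd c) (snd d))"

lemma fst_prod_chart [simp]: "fst (prod_chart c d) = fst c \<times> fst d"
  and snd_prod_chart [simp]: "snd (prod_chart c d) = map_prod (snd c) (snd d)"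
  by (simp_all add: prod_chart_def)

lemma atlas_mprod: "atlas (M \<times>\<^sub>M N) = {prod_chart c d | c d. c \<in> atlas M \<and> d \<in> atlas N}"
  by (auto simp: mprod_def prod_chart_def)

lemma chart_at_mprod: "chart_at (M \<times>\<^sub>M N) (x, y) = prod_chart (chart_at M x) (chart_at N y)"
  by (simp add: mprod_def prod_chart_def)

lemma model_frame_mprod: "model_frame (M \<times>\<^sub>M N) = prod_basis (model_frame M) (model_frame N)"
  by (simp add: mprod_def prod_basis_def)

lemma mdim_mprod: "mdim (M \<times>\<^sub>M N) = mdim M + mdim N"
  by (simp add: mdim_def model_frame_mprod)

locale product_manifold = L: smooth_manifold M + R: smooth_manifold N
  for M :: "('a::t2_space, 'e::real_normed_vector) manifold"
    and N :: "('b::t2_space, 'f::real_normed_vector) manifold"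
begin

lemma chart_inv_prod_chart:
  assumes "c \<in> atlas M" "d \<in> atlas N" "u \<in> snd c ` fst c" "w \<in> snd d ` fst d"
  shows "chart_inv (prod_chart c d) (u, w) = (chart_inv c u, chart_inv d w)"
proof -
  have inj: "inj_on (map_prod (snd c) (snd d)) (fst c \<times> fst d)"
    by (rule inj_onI) (auto dest: L.chart_inv_chart[OF assms(1)] R.chart_inv_chart[OF assms(2)],
      (metis L.chart_inv_chart[OF assms(1)] R.chart_inv_chart[OF assms(2)])+)
  have "(u, w) = map_prod (snd c) (snd d) (chart_inv c u, chart_inv d w)"
    using assms by (simp add: L.chart_chart_inv R.chart_chart_inv)
  moreover have "(chart_inv c u, chart_inv d w) \<in> fst c \<times> fst d"
    using assms by (simp add: L.chart_inv_mem R.chart_inv_mem)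
  ultimately show ?thesis
    using inv_into_f_f[OF inj, of "(chart_inv c u, chart_inv d w)"]
    by (simp add: chart_inv_def[of "prod_chart c d"])
qed

lemma prod_chart_image:
  "snd (prod_chart c d) ` (fst (prod_chart c d) \<inter> (V \<times> W)) =
    (snd c ` (fst c \<inter> V)) \<times> (snd d ` (fst d \<inter> W))"
  by (auto simp: map_prod_def)

lemma prod_chart_image_all:
  "snd (prod_chart c d) ` fst (prod_chart c d) = (snd c ` fst c) \<times> (snd d ` fst d)"
  using prod_chart_image[of c d UNIV UNIV] by simp

sublocale smooth_manifold "M \<times>\<^sub>M N"
proof
  show "ordered_basis (model_frame (M \<times>\<^sub>M N))"
    unfolding model_frame_mprod by (rule ordered_basis_prod_basis[OF L.frame R.frame])
next
  fix e assume "e \<in> atlas (M \<times>\<^sub>M N)"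
  then obtain c d where e: "e = prod_chart c d" and c: "c \<in> atlas M" and d: "d \<in> atlas N"
    by (auto simp: atlas_mprod)
  show "open (fst e)"
    using L.chart_open[OF c] R.chart_open[OF d] by (simp add: e open_Times)
  show "open (snd e ` fst e)"
    unfolding e prod_chart_image_all by (intro open_Times L.chart_image_open R.chart_image_open c d)
  show "homeomorphism (fst e) (snd e ` fst e) (snd e) (chart_inv e)"
    unfolding homeomorphism_def
  proof (intro conjI ballI)
    show "continuous_on (fst e) (snd e)"
      unfolding e fst_prod_chart snd_prod_chart map_prod_def case_prod_beta
      by (intro continuous_on_Pair continuous_on_compose2[OF homeomorphism_cont1[OF L.chart_homeomorphism[OF c]]]
          continuous_on_compose2[OF homeomorphism_cont1[OF R.chart_homeomorphism[OF d]]] continuous_on_fst continuous_on_snd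
          continuous_on_id) auto
    have "continuous_on (snd e ` fst e) (\<lambda>p. (chart_inv c (fst p), chart_inv d (snd p)))"
      unfolding e prod_chart_image_all
      by (intro continuous_on_Pair continuous_on_compose2[OF homeomorphism_cont2[OF L.chart_homeomorphism[OF c]]]
          continuous_on_compose2[OF homeomorphism_cont2[OF R.chart_homeomorphism[OF d]]] continuous_on_fst continuous_on_snd
          continuous_on_id) auto
    thus "continuous_on (snd e ` fst e) (chart_inv e)"
      by (rule continuous_on_eq) (auto simp: e chart_inv_prod_chart[OF c d] simp del: snd_prod_chart
          simp: snd_prod_chart map_prod_def)
    fix p assume p: "p \<in> fst e"
    show "chart_inv e (snd e p) = p"
      using p by (cases p) (auto simp: e chart_inv_prod_chart[OF c d] L.chart_inv_chart[OF c] R.chart_inv_chart[OF d])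
  next
    fix u assume u: "u \<in> snd e ` fst e"
    thus "snd e (chart_inv e u) = u"
      by (auto simp: e chart_inv_prod_chart[OF c d] L.chart_inv_chart[OF c] R.chart_inv_chart[OF d])
  next
    show "chart_inv e ` snd e ` fst e = fst e"
      by (force simp: e chart_inv_prod_chart[OF c d] L.chart_inv_chart[OF c] R.chart_inv_chart[OF d]
          image_image)
  qed simp
next
  fix p show "chart_at (M \<times>\<^sub>M N) p \<in> atlas (M \<times>\<^sub>M N)"
    using L.chart_at_atlas[of "fst p"] R.chart_at_atlas[of "snd p"] chart_at_mprod[of M N "fst p" "snd p"]
    by (auto simp: atlas_mprod simp del: split_paired_Ex)
  show "p \<in> fst (chart_at (M \<times>\<^sub>M N) p)"
    using L.chart_at_mem R.chart_at_mem by (cases p) (simp add: chart_at_mprod)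
next
  fix e e' assume "e \<in> atlas (M \<times>\<^sub>M N)" "e' \<in> atlas (M \<times>\<^sub>M N)"
  then obtain c d c' d' where e: "e = prod_chart c d" "e' = prod_chart c' d'"
    and c: "c \<in> atlas M" "c' \<in> atlas M" and d: "d \<in> atlas N" "d' \<in> atlas N"
    by (auto simp: atlas_mprod)
  let ?U = "snd c ` (fst c \<inter> fst c')" and ?V = "snd d ` (fst d \<inter> fst d')"
  have img: "snd e ` (fst e \<inter> fst e') = ?U \<times> ?V"
    unfolding e fst_prod_chart[of c' d'] by (rule prod_chart_image)
  have U: "open ?U" and V: "open ?V"
    by (auto intro!: L.open_chart_image R.open_chart_image L.chart_open R.chart_open c d)
  have "smooth_on (?U \<times> ?V) (\<lambda>p. ((snd c' \<circ> chart_inv c) (fst p), (snd d' \<circ> chart_inv d) (snd p)))"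
    by (intro smooth_on_Pair open_Times U V
        smooth_on_precompose_linear[OF U open_Times[OF U V] bounded_linear_fst _ L.transition[OF c]]
        smooth_on_precompose_linear[OF V open_Times[OF U V] bounded_linear_snd _ R.transition[OF d]]) auto
  thus "smooth_on (snd e ` (fst e \<inter> fst e')) (snd e' \<circ> chart_inv e)"
    unfolding img
    by (subst smooth_on_cong[OF open_Times[OF U V]])
       (auto simp: e chart_inv_prod_chart[OF c(1) d(1)])
qed

lemma msmooth_on_prodI:
  assumes V: "open V" and W: "open W"
    and "\<And>c d. c \<in> atlas M \<Longrightarrow> d \<in> atlas N \<Longrightarrow>
      smooth_on ((snd c ` (fst c \<inter> V)) \<times> (snd d ` (fst d \<inter> W)))
        (\<lambda>u. f (chart_inv c (fst u), chart_inv d (snd u)))"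
  shows "msmooth_on (M \<times>\<^sub>M N) (V \<times> W) f"
  unfolding msmooth_on_def
proof
  fix e assume "e \<in> atlas (M \<times>\<^sub>M N)"
  then obtain c d where e: "e = prod_chart c d" and c: "c \<in> atlas M" and d: "d \<in> atlas N"
    by (auto simp: atlas_mprod)
  show "smooth_on (snd e ` (fst e \<inter> V \<times> W)) (f \<circ> chart_inv e)"
    unfolding e prod_chart_image
    by (subst smooth_on_cong[OF open_Times[OF L.open_chart_image[OF c V] R.open_chart_image[OF d W]],
          of _ "\<lambda>u. f (chart_inv c (fst u), chart_inv d (snd u))"])
       (use assms(3)[OF c d] in \<open>auto simp: chart_inv_prod_chart[OF c d]\<close>)
qed

lemma msmooth_on_fst:
  assumes "open V" "open W" "msmooth_on M V f"
  shows "msmooth_on (M \<times>\<^sub>M N) (V \<times> W) (\<lambda>p. f (fst p))"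
proof (rule msmooth_on_prodI[OF assms(1,2)])
  fix c d assume c: "c \<in> atlas M" and d: "d \<in> atlas N"
  show "smooth_on ((snd c ` (fst c \<inter> V)) \<times> (snd d ` (fst d \<inter> W)))
      (\<lambda>u. f (fst (chart_inv c (fst u), chart_inv d (snd u))))"
    using smooth_on_precompose_linear[OF L.open_chart_image[OF c assms(1)]
        open_Times[OF L.open_chart_image[OF c assms(1)] R.open_chart_image[OF d assms(2)]]
        bounded_linear_fst _ L.msmooth_onD[OF assms(3) c]]
    by auto
qed

lemma msmooth_on_snd:
  assumes "open V" "open W" "msmooth_on N W f"
  shows "msmooth_on (M \<times>\<^sub>M N) (V \<times> W) (\<lambda>p. f (snd p))"
proof (rule msmooth_on_prodI[OF assms(1,2)])
  fix c d assume c: "c \<in> atlas M" and d: "d \<in> atlas N"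
  show "smooth_on ((snd c ` (fst c \<inter> V)) \<times> (snd d ` (fst d \<inter> W)))
      (\<lambda>u. f (snd (chart_inv c (fst u), chart_inv d (snd u))))"
    using smooth_on_precompose_linear[OF R.open_chart_image[OF d assms(2)]
        open_Times[OF L.open_chart_image[OF c assms(1)] R.open_chart_image[OF d assms(2)]]
        bounded_linear_snd _ R.msmooth_onD[OF assms(3) d]]
    by auto
qed

lemma mderiv_prodI:
  assumes "((\<lambda>u. f (chart_inv (chart_at M x) (fst u), chart_inv (chart_at N y) (snd u))) has_derivative D)
    (at (snd (chart_at M x) x, snd (chart_at N y) y))"
  shows "mderiv (M \<times>\<^sub>M N) f (x, y) = D"
proof -
  let ?c = "chart_at M x" and ?d = "chart_at N y"
  have "frechet_derivative (f \<circ> chart_inv (prod_chart ?c ?d)) (at (snd ?c x, snd ?d y)) =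
      frechet_derivative (\<lambda>u. f (chart_inv ?c (fst u), chart_inv ?d (snd u))) (at (snd ?c x, snd ?d y))"
    by (rule frechet_derivative_cong_open[OF open_Times[OF L.chart_image_open[OF L.chart_at_atlas]
          R.chart_image_open[OF R.chart_at_atlas]]])
       (use L.chart_at_mem R.chart_at_mem in
         \<open>auto simp: chart_inv_prod_chart[OF L.chart_at_atlas R.chart_at_atlas]\<close>)
  thus ?thesis
    using frechet_derivative_at[OF assms] by (simp add: mderiv_def chart_at_mprod)
qed

lemma mderiv_fst:
  assumes "msmooth_on M V f" "x \<in> V"
  shows "mderiv (M \<times>\<^sub>M N) (\<lambda>p. f (fst p)) (x, y) = (\<lambda>v. mderiv M f x (fst v))"
proof (rule mderiv_prodI)
  show "((\<lambda>u. f (fst (chart_inv (chart_at M x) (fst u), chart_inv (chart_at N y) (snd u)))) has_derivative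
      (\<lambda>v. mderiv M f x (fst v))) (at (snd (chart_at M x) x, snd (chart_at N y) y))"
    using has_derivative_compose[OF bounded_linear_imp_has_derivative[OF bounded_linear_fst],
        of "f \<circ> chart_inv (chart_at M x)" "mderiv M f x" "(snd (chart_at M x) x, snd (chart_at N y) y)" UNIV]
      L.mderiv_has_derivative[OF assms]
    unfolding comp_def fst_conv by blast
qed

lemma mderiv_snd:
  assumes "msmooth_on N W f" "y \<in> W"
  shows "mderiv (M \<times>\<^sub>M N) (\<lambda>p. f (snd p)) (x, y) = (\<lambda>v. mderiv N f y (snd v))"
proof (rule mderiv_prodI)
  show "((\<lambda>u. f (snd (chart_inv (chart_at M x) (fst u), chart_inv (chart_at N y) (snd u)))) has_derivative
      (\<lambda>v. mderiv N f y (snd v))) (at (snd (chart_at M x) x, snd (chart_at N y) y))"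
    using has_derivative_compose[OF bounded_linear_imp_has_derivative[OF bounded_linear_snd],
        of "f \<circ> chart_inv (chart_at N y)" "mderiv N f y" "(snd (chart_at M x) x, snd (chart_at N y) y)" UNIV]
      R.mderiv_has_derivative[OF assms]
    unfolding comp_def snd_conv by blast
qed

lemma mderiv_prod_chart:
  assumes c: "c \<in> atlas M" "x \<in> fst c" and d: "d \<in> atlas N" "y \<in> fst d"
  shows "mderiv (M \<times>\<^sub>M N) (snd (prod_chart c d)) (x, y) v =
    (mderiv M (snd c) x (fst v), mderiv N (snd d) y (snd v))"
proof -
  let ?c = "chart_at M x" and ?d = "chart_at N y"
  have "mderiv (M \<times>\<^sub>M N) (map_prod (snd c) (snd d)) (x, y) =
      (\<lambda>v. (mderiv M (snd c) x (fst v), mderiv N (snd d) y (snd v)))"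
  proof (rule mderiv_prodI)
    have "((\<lambda>u. (snd c \<circ> chart_inv ?c) (fst u)) has_derivative (\<lambda>v. mderiv M (snd c) x (fst v)))
        (at (snd ?c x, snd ?d y))"
      by (rule has_derivative_compose[OF bounded_linear_imp_has_derivative[OF bounded_linear_fst]])
         (unfold fst_conv, rule L.mderiv_has_derivative[OF L.msmooth_on_chart[OF c(1)] c(2)])
    moreover have "((\<lambda>u. (snd d \<circ> chart_inv ?d) (snd u)) has_derivative (\<lambda>v. mderiv N (snd d) y (snd v)))
        (at (snd ?c x, snd ?d y))"
      by (rule has_derivative_compose[OF bounded_linear_imp_has_derivative[OF bounded_linear_snd]])
         (unfold snd_conv, rule R.mderiv_has_derivative[OF R.msmooth_on_chart[OF d(1)] d(2)])
    ultimately show "((\<lambda>u. map_prod (snd c) (snd d) (chart_inv ?c (fst u), chart_inv ?d (snd u))) has_derivative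
        (\<lambda>v. (mderiv M (snd c) x (fst v), mderiv N (snd d) y (snd v)))) (at (snd ?c x, snd ?d y))"
      using has_derivative_Pair by (fastforce simp: comp_def)
  qed
  thus ?thesis
    by simp
qed

lemma coord_field_prod_chart:
  assumes c: "c \<in> atlas M" "x \<in> fst c" and d: "d \<in> atlas N" "y \<in> fst d"
  shows "coord_field (M \<times>\<^sub>M N) (prod_chart c d) v (x, y) =
    (coord_field M c (fst v) x, coord_field N d (snd v) y)"
proof -
  have cd: "prod_chart c d \<in> atlas (M \<times>\<^sub>M N)" "(x, y) \<in> fst (prod_chart c d)"
    using c d by (auto simp: atlas_mprod simp del: split_paired_Ex)
  have "mderiv (M \<times>\<^sub>M N) (snd (prod_chart c d)) (x, y) (coord_field M c (fst v) x, coord_field N d (snd v) y) = v"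
    by (simp only: mderiv_prod_chart[OF c d] fst_conv snd_conv L.mderiv_coord_field[OF c]
        R.mderiv_coord_field[OF d] prod.collapse)
  thus ?thesis
    using coord_field_mderiv[OF cd] by metis
qed

end

section \<open>Arguments and angle-valued maps\<close>

lemma angle_cis_angle_of [simp]: "angle_cis (angle_of x) = cis x"
  by transfer simp

lemma angle_of_surj: obtains x where "a = angle_of x"
proof -
  have "\<exists>x. a = angle_of x"
    by transfer (auto intro: rcong_refl)
  thus thesis
    using that by blast
qed

lemma angle_of_add: "angle_of (x + y) = angle_of x + angle_of y"
  by transfer (simp add: rcong_refl)

lemma angle_of_eq_iff: "angle_of x = angle_of y \<longleftrightarrow> (\<exists>n. y = x + of_int n * (2 * pi))"
  by transfer (simp add: rcong_altdef)

lemma angle_cis_eq_iff: "angle_cis a = angle_cis b \<longleftrightarrow> a = b"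
proof
  obtain x y where "a = angle_of x" "b = angle_of y"
    by (meson angle_of_surj)
  moreover assume "angle_cis a = angle_cis b"
  ultimately have "[x = y] (rmod 2 * pi)"
    by (simp add: cis_eq_cis_iff_rcong)
  hence "angle_of x = angle_of y"
    by transfer
  thus "a = b"
    using \<open>a = angle_of x\<close> \<open>b = angle_of y\<close> by simp
qed simp

lemma angle_cis_add: "angle_cis (a + b) = angle_cis a * angle_cis b"
  by (rule angle_of_surj[of a], rule angle_of_surj[of b]) (simp add: angle_of_add[symmetric] cis_mult)

lemma norm_angle_cis [simp]: "cmod (angle_cis a) = 1"
  by (rule angle_of_surj[of a]) simp

lemma carg_polar:
  assumes "r > 0"
  shows "carg (of_real r * angle_cis a) = a"
  unfolding carg_def
proof (rule the_equality)
  have n: "cmod (of_real r * angle_cis a) = r"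
    using assms by (simp add: norm_mult)
  show "of_real r * angle_cis a = of_real (cmod (of_real r * angle_cis a)) * angle_cis a"
    by (simp only: n)
  fix b assume "of_real r * angle_cis a = of_real (cmod (of_real r * angle_cis a)) * angle_cis b"
  hence "of_real r * angle_cis a = of_real r * angle_cis b"
    by (simp only: n)
  thus "b = a"
    using assms by (simp add: angle_cis_eq_iff)
qed

lemma complex_polar: 
  assumes "z \<noteq> 0"
  shows "z = of_real (cmod z) * angle_cis (carg z)"
proof -
  have "z = of_real (cmod z) * angle_cis (angle_of (Arg z))"
    using assms by (simp add: rcis_cmod_Arg[unfolded rcis_def])
  moreover from this have "carg z = angle_of (Arg z)"
    using carg_polar[of "cmod z" "angle_of (Arg z)"] assms by simp
  ultimately show ?thesis
    by simp
qed

lemma carg_mult: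
  assumes "z \<noteq> 0" "w \<noteq> 0"
  shows "carg (z * w) = carg z + carg w"
proof -
  have "z * w = of_real (cmod z * cmod w) * angle_cis (carg z + carg w)"
    using complex_polar[OF assms(1)] complex_polar[OF assms(2)]
    by (simp add: angle_cis_add mult_ac)
  thus ?thesis
    using carg_polar[of "cmod z * cmod w"] assms by simp
qed

lemma carg_cis: "carg (cis x) = angle_of x"
  using carg_polar[of 1 "angle_of x"] by simp

lemma carg_power: "z \<noteq> 0 \<Longrightarrow> carg (z ^ k) = angle_mult k (carg z)"
proof (induction k)
  case 0
  have "angle_of 0 = 0"
    by transfer (simp add: rcong_refl)
  thus ?case
    using carg_cis[of 0] by (simp add: angle_mult_def)
qed (simp add: carg_mult angle_mult_def add.commute)

lemma carg_minus_one_power: "carg ((- 1) ^ k) = angle_of (real k * pi)"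
  by (metis carg_cis cis_pi Complex.DeMoivre)

lemma carg_positive_mult: "r > 0 \<Longrightarrow> z \<noteq> 0 \<Longrightarrow> carg (of_real r * z) = carg z"
  using carg_cis[of 0] carg_polar[of r "angle_of 0"] carg_mult[of "of_real r" z]
    angle_of_add[of 0 0] by simp

lemma carg_norm_one: "cmod z = 1 \<Longrightarrow> angle_cis (carg z) = z"
  using complex_polar[of z] by force

definition smooth_angle ::
  "('a::topological_space, 'e::real_normed_vector) manifold \<Rightarrow> ('a \<Rightarrow> angle) \<Rightarrow> bool"
  where "smooth_angle M \<beta> \<longleftrightarrow> (\<forall>x. \<exists>W b. open W \<and> x \<in> W \<and> msmooth_on M W b \<and>
    (\<forall>y\<in>W. angle_of (b y) = \<beta> y))"

context smooth_manifold
begin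

text \<open>Two lifts differ by a multiple of \<open>2\<pi>\<close>, which is locally constant by continuity.\<close>

lemma mderiv_lift_unique:
  assumes W: "open W" "x \<in> W" "msmooth_on M W b" and V: "open V" "x \<in> V" "msmooth_on M V b'"
    and eq: "\<And>y. y \<in> W \<Longrightarrow> y \<in> V \<Longrightarrow> angle_of (b y) = angle_of (b' y)"
  shows "mderiv M b x = mderiv M b' x"
proof -
  define k where "k = b' x - b x"
  have WV: "open (W \<inter> V)" "x \<in> W \<inter> V"
    using W V by auto
  have "continuous_on (W \<inter> V) (\<lambda>y. b' y - b y)"
    by (intro continuous_on_diff continuous_on_subset[OF msmooth_on_imp_continuous_on[OF W(3,1)]]
        continuous_on_subset[OF msmooth_on_imp_continuous_on[OF V(3,1)]]) auto
  hence "open ((W \<inter> V) \<inter> (\<lambda>y. b' y - b y) -` ball k (2 * pi))"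
    using continuous_on_open_vimage[OF WV(1)] open_ball by (metis Int_commute)
  moreover define U where "U = (W \<inter> V) \<inter> (\<lambda>y. b' y - b y) -` ball k (2 * pi)"
  ultimately have U: "open U" "x \<in> U"
    using WV(2) by (auto simp: k_def)
  have "b' y = b y + k" if "y \<in> U" for y
  proof -
    from that have y: "y \<in> W" "y \<in> V" "\<bar>k - (b' y - b y)\<bar> < 2 * pi"
      by (auto simp: U_def dist_real_def)
    obtain m n where m: "b' y = b y + of_int m * (2 * pi)" and n: "b' x = b x + of_int n * (2 * pi)"
      using eq[OF y(1,2)] eq[OF W(2) V(2)] by (auto simp: angle_of_eq_iff)
    have "k - (b' y - b y) = of_int (n - m) * (2 * pi)"
      by (simp add: m n k_def algebra_simps)
    hence "\<bar>of_int (n - m) :: real\<bar> * (2 * pi) < 1 * (2 * pi)"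
      using y(3) by (simp only: abs_mult) simp
    hence "\<bar>of_int (n - m) :: real\<bar> < 1"
      by (rule mult_right_less_imp_less) simp
    hence "n = m"
      by linarith
    thus ?thesis
      by (simp add: m n k_def)
  qed
  hence "mderiv M b' x = mderiv M (\<lambda>y. b y + k) x"
    by (rule mderiv_cong_open[OF U])
  also have "\<dots> = mderiv M b x"
  proof
    fix v
    show "mderiv M (\<lambda>y. b y + k) x v = mderiv M b x v"
      using mderiv_add[OF W(3) _ W(2), of "\<lambda>_. k" v]
      by (simp add: msmooth_on_def comp_def smooth_on_const mderiv_def)
  qed
  finally show ?thesis ..
qed

lemma mderiv_angle_eq:
  assumes "open W" "x \<in> W" "msmooth_on M W b" "\<And>y. y \<in> W \<Longrightarrow> angle_of (b y) = \<beta> y"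
  shows "mderiv_angle M \<beta> x = mderiv M b x"
  unfolding mderiv_angle_def
proof (rule the_equality)
  show "\<exists>W b'. open W \<and> x \<in> W \<and> msmooth_on M W b' \<and> (\<forall>y\<in>W. angle_of (b' y) = \<beta> y) \<and>
      mderiv M b x = mderiv M b' x"
    using assms by blast
  fix d assume "\<exists>W b. open W \<and> x \<in> W \<and> msmooth_on M W b \<and> (\<forall>y\<in>W. angle_of (b y) = \<beta> y) \<and>
      d = mderiv M b x"
  then obtain V b' where V: "open V" "x \<in> V" "msmooth_on M V b'" "\<And>y. y \<in> V \<Longrightarrow> angle_of (b' y) = \<beta> y"
    "d = mderiv M b' x"
    by blast
  show "d = mderiv M b x"
    unfolding V(5) by (rule mderiv_lift_unique[OF V(1-3) assms(1-3)]) (simp add: assms(4) V(4))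
qed

lemma smooth_angle_lift:
  assumes "smooth_angle M \<beta>"
  obtains W b where "open W" "x \<in> W" "msmooth_on M W b" "\<And>y. y \<in> W \<Longrightarrow> angle_of (b y) = \<beta> y"
    "mderiv_angle M \<beta> x = mderiv M b x"
  using assms mderiv_angle_eq unfolding smooth_angle_def by metis

lemma linear_mderiv_angle: "smooth_angle M \<beta> \<Longrightarrow> linear (mderiv_angle M \<beta> x)"
  by (metis smooth_angle_lift linear_mderiv)

text \<open>The principal logarithm of \<open>f / f x\<close> is smooth where that quotient has positive real part.\<close>

lemma smooth_angle_carg:
  assumes "\<And>x. \<exists>W f. open W \<and> x \<in> W \<and> msmooth_on M W f \<and> (\<forall>y\<in>W. f y \<noteq> 0 \<and> \<beta> y = carg (f y))"
  shows "smooth_angle M \<beta>"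
  unfolding smooth_angle_def
proof
  fix x
  from assms[of x] obtain W f where W: "open W" "x \<in> W" "msmooth_on M W f"
    and f: "\<And>y. y \<in> W \<Longrightarrow> f y \<noteq> 0" "\<And>y. y \<in> W \<Longrightarrow> \<beta> y = carg (f y)"
    by blast
  (* Normalised so that h x = 1. *)
  define h where "h = (\<lambda>y. inverse (f x) * f y)"
  define U where "U = W \<inter> (\<lambda>y. Re (h y)) -` {0<..}"
  have "continuous_on W (\<lambda>y. Re (h y))"
    unfolding h_def by (intro continuous_intros msmooth_on_imp_continuous_on W)
  hence "open U"
    unfolding U_def using continuous_on_open_vimage[OF W(1)] open_greaterThan by (metis Int_commute)
  have "x \<in> U"
  proof -
    have "h x = 1"
      using f(1)[OF W(2)] unfolding h_def by (rule left_inverse)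
    thus ?thesis
      using W(2) by (simp add: U_def)
  qed
  define b where "b = (\<lambda>y. Arg (f x) + Im (Ln (h y)))"
  have "msmooth_on M U b"
    unfolding msmooth_on_def
  proof
    fix c assume c: "c \<in> atlas M"
    let ?T = "snd c ` (fst c \<inter> U)"
    have T: "open ?T"
      by (rule open_chart_image[OF c \<open>open U\<close>])
    have fT: "smooth_on ?T (\<lambda>u. f (chart_inv c u))"
      using smooth_on_subset[OF msmooth_onD[OF W(3) c], of ?T] by (auto simp: U_def comp_def)
    have "smooth_on ?T (\<lambda>u. Ln (inverse (f x) * f (chart_inv c u)))"
      by (intro smooth_on_Ln smooth_on_bilinear[OF _ bounded_bilinear_mult] smooth_on_const T fT)
         (auto simp: chart_inv_chart[OF c] U_def h_def)
    hence "smooth_on ?T (\<lambda>u. Arg (f x) + Im (Ln (inverse (f x) * f (chart_inv c u))))"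
      by (intro smooth_on_add smooth_on_const T smooth_on_bounded_linear[OF _ bounded_linear_Im])
    thus "smooth_on ?T (b \<circ> chart_inv c)"
      by (simp add: b_def h_def comp_def)
  qed
  moreover have "angle_of (b y) = \<beta> y" if y: "y \<in> U" for y
  proof -
    have yW: "y \<in> W" and h0: "h y \<noteq> 0"
      using y by (auto simp: U_def)
    have "f y = f x * h y"
      using f(1)[OF W(2)] by (simp add: h_def)
    also have "f x = of_real (cmod (f x)) * cis (Arg (f x))"
      using rcis_cmod_Arg[of "f x"] by (simp add: rcis_def)
    also have "h y = of_real (cmod (h y)) * cis (Im (Ln (h y)))"
      using rcis_cmod_Arg[of "h y"] Arg_eq_Im_Ln[OF h0] by (simp add: rcis_def)
    finally have "f y = of_real (cmod (f x) * cmod (h y)) * angle_cis (angle_of (b y))"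
      by (simp add: b_def cis_mult[symmetric] mult_ac)
    hence "carg (f y) = angle_of (b y)"
      using carg_polar[of "cmod (f x) * cmod (h y)" "angle_of (b y)"] h0 f(1)[OF W(2)] by simp
    thus ?thesis
      using f(2)[OF yW] by simp
  qed
  ultimately show "\<exists>W b. open W \<and> x \<in> W \<and> msmooth_on M W b \<and> (\<forall>y\<in>W. angle_of (b y) = \<beta> y)"
    using \<open>open U\<close> \<open>x \<in> U\<close> by blast
qed

end

section \<open>Hermitian orthonormal frames\<close>

lemma inner_eq_Re_hprod: "z \<bullet> w = Re (hprod z w)"
  for z w :: "complex ^ 'n::finite"
  by (simp add: Re_hprod)

lemma hprod_eq_inner: "symp z w = 0 \<Longrightarrow> hprod z w = of_real (z \<bullet> w)"
  for z w :: "complex ^ 'n::finite"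
  by (simp add: complex_eq_iff symp_def Re_hprod)

text \<open>An orthonormal basis of the range of \<open>L\<close> is pulled back by \<open>L\<close>.\<close>

lemma orthonormal_frame_exists:
  fixes L :: "'e::real_vector \<Rightarrow> 'f::euclidean_space" and B :: "'e list"
  assumes B: "ordered_basis B" and L: "linear L" "inj L"
  obtains es where "length es = length B"
    "\<And>i j. i < length B \<Longrightarrow> j < length B \<Longrightarrow> L (es ! i) \<bullet> L (es ! j) = (if i = j then 1 else 0)"
proof -
  have "subspace (range L)"
    by (rule linear_subspace_image[OF L(1) subspace_UNIV])
  then obtain C where C: "C \<subseteq> range L" "pairwise orthogonal C" "\<And>x. x \<in> C \<Longrightarrow> norm x = 1"
    "independent C" "card C = dim (range L)"
    using orthonormal_basis_subspace by metis
  have "dim (range L) = card (L ` set B)"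
  proof (rule dim_eq_card)
    show "span (L ` set B) = span (range L)"
    proof -
      have "span (L ` set B) = range L"
        using B linear_span_image[OF L(1), of "set B"] by (simp add: ordered_basis_def)
      also have "\<dots> = span (range L)"
        by (rule real_vector.span_eq_iff[THEN iffD2, OF \<open>subspace (range L)\<close>, symmetric])
      finally show ?thesis .
    qed
    show "independent (L ` set B)"
      using B by (intro linear_independent_injective_image[OF L(1) _ inj_on_subset[OF L(2)]])
        (auto simp: ordered_basis_def)
  qed
  also have "\<dots> = length B"
    using B by (simp add: card_image inj_on_subset[OF L(2)] ordered_basis_def distinct_card)
  finally have card: "card C = length B"
    using C(5) by simp
  have "finite C"
    using C(4) by (rule finiteI_independent)
  then obtain cs where cs: "set cs = C" "distinct cs"
    using finite_distinct_list by blast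
  hence len: "length cs = length B"
    using card distinct_card by fastforce
  have Linv: "L (inv_into UNIV L c) = c" if "c \<in> C" for c
    using C(1) that by (auto simp: f_inv_into_f)
  show thesis
  proof (rule that[of "map (inv_into UNIV L) cs"])
    fix i j assume ij: "i < length B" "j < length B"
    hence "cs ! i \<in> C" "cs ! j \<in> C"
      using cs len by auto
    moreover have "cs ! i = cs ! j \<longleftrightarrow> i = j"
      using cs(2) ij len by (simp add: nth_eq_iff_index_eq)
    ultimately show "L (map (inv_into UNIV L) cs ! i) \<bullet> L (map (inv_into UNIV L) cs ! j) = (if i = j then 1 else 0)"
      using C(2,3) ij len by (auto simp: Linv pairwise_def Linear_Algebra.orthogonal_def norm_eq_1)
  qed (simp add: len)
qed

text \<open>A real subspace on which the symplectic form vanishes is totally real: an orthonormal basis is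
  Hermitian orthonormal, so together with Hermitian orthonormal vectors \<open>ws\<close> normal to it it has a
  determinant of modulus one.\<close>

locale isotropic_map =
  fixes L :: "'e::real_vector \<Rightarrow> complex ^ 'n::{finite,linorder}"
    and B :: "'e list" and ws :: "(complex ^ 'n::{finite,linorder}) list"
  assumes basis: "ordered_basis B" and linear: "linear L" and inj: "inj L"
    and isotropic: "\<And>v w. symp (L v) (L w) = 0"
    and normal: "\<And>w v. w \<in> set ws \<Longrightarrow> hprod w (L v) = 0"
    and normal_orthonormal: "\<And>i j. i < length ws \<Longrightarrow> j < length ws \<Longrightarrow>
      hprod (ws ! i) (ws ! j) = (if i = j then 1 else 0)"
    and dimension: "length ws + length B = CARD('n)"
begin

lemma cmod_cdet_orthonormal:
  assumes es: "length es = length B"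
    and on: "\<And>i j. i < length B \<Longrightarrow> j < length B \<Longrightarrow> L (es ! i) \<bullet> L (es ! j) = (if i = j then 1 else 0)"
  shows "cmod (cdet (ws @ map L es)) = 1"
proof (rule cmod_cdet_unitary)
  fix i j assume ij: "i < CARD('n)" "j < CARD('n)"
  have normal': "hprod (L v) w = 0" if "w \<in> set ws" for w v
    using normal[OF that, of v] cnj_hprod[of w "L v"] by simp
  consider "i < length ws" "j < length ws" | "i < length ws" "\<not> j < length ws"
    | "\<not> i < length ws" "j < length ws" | "\<not> i < length ws" "\<not> j < length ws"
    by blast
  thus "hprod ((ws @ map L es) ! i) ((ws @ map L es) ! j) = (if i = j then 1 else 0)"
  proof cases
    case 4
    have "i - length ws < length B" "j - length ws < length B" "i - length ws = j - length ws \<longleftrightarrow> i = j"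
      using 4 ij dimension by auto
    thus ?thesis
      using 4 on[of "i - length ws" "j - length ws"] es
      by (simp add: nth_append hprod_eq_inner[OF isotropic])
  qed (use ij dimension es normal_orthonormal normal normal' in \<open>auto simp: nth_append\<close>)
qed

lemma cdet_frame: "length es = length B \<Longrightarrow>
    cdet (ws @ map L es) = of_real (frame_det B es) * cdet (ws @ map L B)"
  by (rule cdet_append_map_frame[OF basis dimension linear])

lemma cdet_basis_nonzero: "cdet (ws @ map L B) \<noteq> 0"
proof
  assume 0: "cdet (ws @ map L B) = 0"
  obtain es where es: "length es = length B"
    "\<And>i j. i < length B \<Longrightarrow> j < length B \<Longrightarrow> L (es ! i) \<bullet> L (es ! j) = (if i = j then 1 else 0)"
    using orthonormal_frame_exists[OF basis linear inj] by blast
  show False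
    using cmod_cdet_orthonormal[OF es] cdet_frame[OF es(1)] 0 by simp
qed

text \<open>Reversing the first vector of an orthonormal frame of the wrong orientation corrects it.\<close>

lemma oriented_orthonormal_frame_exists:
  obtains es where "length es = length B" "frame_det B es > 0"
    "\<And>i j. i < length B \<Longrightarrow> j < length B \<Longrightarrow> L (es ! i) \<bullet> L (es ! j) = (if i = j then 1 else 0)"
proof -
  obtain es where es: "length es = length B"
    "\<And>i j. i < length B \<Longrightarrow> j < length B \<Longrightarrow> L (es ! i) \<bullet> L (es ! j) = (if i = j then 1 else 0)"
    using orthonormal_frame_exists[OF basis linear inj] by blast
  show thesis
  proof (cases "frame_det B es > 0")
    case True
    with es show thesis
      by (intro that)
  next
    case False
    define fs where "fs = es[0 := - es ! 0]"
    have fs: "length fs = length B"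
      by (simp add: fs_def es)
    have nonempty: "0 < length B"
    proof (rule ccontr)
      assume "\<not> 0 < length B"
      hence "es = B" using es(1) by simp
      with False frame_det_basis[OF basis] show False by simp
    qed
    let ?d = "\<lambda>k. if k = length ws then - 1 else 1 :: complex"
    have "(ws @ map L fs) ! j = (\<Sum>k<CARD('n). (if k = j then ?d k else 0) *s (ws @ map L es) ! k)"
      if j: "j < CARD('n)" for j
    proof -
      have "(\<Sum>k<CARD('n). (if k = j then ?d k else 0) *s (ws @ map L es) ! k) =
          (\<Sum>k<CARD('n). if k = j then ?d j *s (ws @ map L es) ! j else 0)"
        by (intro sum.cong) auto
      also have "\<dots> = ?d j *s (ws @ map L es) ! j"
        using j by simp
      also have "\<dots> = (ws @ map L fs) ! j"
        using nonempty es(1) j dimension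
        by (auto simp: nth_append fs_def nth_list_update linear_neg[OF linear] nth_map)
      finally show ?thesis ..
    qed
    hence "cdet (ws @ map L fs) = ndet CARD('n) (\<lambda>k j. if k = j then ?d k else 0) * cdet (ws @ map L es)"
      by (rule cdet_lincomb)
    also have "ndet CARD('n) (\<lambda>k j. if k = j then ?d k else 0) = - 1"
    proof -
      have "length ws < CARD('n)"
        using nonempty dimension by linarith
      thus ?thesis
        by (simp add: ndet_diagonal)
    qed
    finally have "of_real (frame_det B fs) * cdet (ws @ map L B) =
        of_real (- frame_det B es) * cdet (ws @ map L B)"
      by (simp add: cdet_frame[OF fs] cdet_frame[OF es(1)])
    hence neg: "frame_det B fs = - frame_det B es"
      using cdet_basis_nonzero by (simp del: of_real_minus)
    have "frame_det B es \<noteq> 0"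
      using cmod_cdet_orthonormal[OF es] cdet_frame[OF es(1)] by auto
    show thesis
    proof (rule that[OF fs])
      show "frame_det B fs > 0"
        using neg False \<open>frame_det B es \<noteq> 0\<close> by simp
      have nth: "L (fs ! k) = (if k = 0 then - L (es ! 0) else L (es ! k))" if "k < length B" for k
      proof -
        have "0 < length es"
          using nonempty es(1) by simp
        thus ?thesis
          using that es(1) by (simp add: fs_def nth_list_update linear_neg[OF linear])
      qed
      fix i j assume ij: "i < length B" "j < length B"
      show "L (fs ! i) \<bullet> L (fs ! j) = (if i = j then 1 else 0)"
        unfolding nth[OF ij(1)] nth[OF ij(2)]
        using es(2)[OF ij] es(2)[OF nonempty ij(2)] es(2)[OF ij(1) nonempty] es(2)[OF nonempty nonempty]
        by (auto split: if_splits)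
    qed
  qed
qed

lemma carg_cdet_oriented_frame:
  assumes "length es = length B" "frame_det B es > 0"
  shows "carg (cdet (ws @ map L es)) = carg (cdet (ws @ map L B))"
  by (simp add: cdet_frame[OF assms(1)] carg_positive_mult[OF assms(2) cdet_basis_nonzero])

end

section \<open>Determinants of moving frames\<close>

text \<open>The Lagrangian angle is the argument of this determinant for \<open>hs\<close> empty, the Legendrian angle the
  one for \<open>hs = [f]\<close>.\<close>

definition frame_cdet :: "('a, 'e::real_normed_vector) manifold \<Rightarrow> ('a \<Rightarrow> complex ^ 'n::{finite,linorder}) list \<Rightarrow>
    ('a \<Rightarrow> complex ^ 'n::{finite,linorder}) \<Rightarrow> 'a \<Rightarrow> complex"
  where "frame_cdet M hs f x = cdet (map (\<lambda>h. h x) hs @ map (mderiv M f x) (model_frame M))"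

text \<open>The determinant for the coordinate frame of one fixed chart, which depends smoothly on the point.\<close>

definition chart_cdet :: "('a, 'e::real_normed_vector) manifold \<Rightarrow> ('a, 'e) chart \<Rightarrow>
    ('a \<Rightarrow> complex ^ 'n::{finite,linorder}) list \<Rightarrow> ('a \<Rightarrow> complex ^ 'n::{finite,linorder}) \<Rightarrow> 'a \<Rightarrow> complex"
  where "chart_cdet M c hs f x = cdet (map (\<lambda>h. h x) hs @
    map (frechet_derivative (f \<circ> chart_inv c) (at (snd c x))) (model_frame M))"

lemma (in smooth_manifold) msmooth_chart_cdet:
  fixes f :: "'a \<Rightarrow> complex ^ 'n::{finite,linorder}"
  assumes c: "c \<in> atlas M" and f: "msmooth_on M UNIV f" and hs: "\<And>h. h \<in> set hs \<Longrightarrow> msmooth_on M UNIV h"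
    and n: "length hs + mdim M = CARD('n)"
  shows "msmooth_on M (fst c) (chart_cdet M c hs f)"
proof -
  let ?B = "model_frame M" and ?T = "snd c ` fst c"
  let ?D = "\<lambda>u. frechet_derivative (f \<circ> chart_inv c) (at u)"
  have T: "open ?T"
    by (rule chart_image_open[OF c])
  have fT: "smooth_on ?T (f \<circ> chart_inv c)" and hT: "h \<in> set hs \<Longrightarrow> smooth_on ?T (\<lambda>u. h (chart_inv c u))" for h
    using msmooth_onD[OF f c] msmooth_onD[OF hs c] by (simp_all add: comp_def)
  let ?V = "\<lambda>u. map (\<lambda>h. h (chart_inv c u)) hs @ map (?D u) ?B"
  have "smooth_on ?T (\<lambda>u. (?V u ! j) $ i)" if "j < CARD('n)" for i j
  proof (rule smooth_on_bounded_linear[OF T bounded_linear_vec_nth])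
    show "smooth_on ?T (\<lambda>u. ?V u ! j)"
    proof (cases "j < length hs")
      case True
      thus ?thesis
        using hT[of "hs ! j"] by (simp add: nth_append)
    next
      case False
      hence "j - length hs < length ?B"
        using that n by (simp add: mdim_def)
      thus ?thesis
        using False smooth_on_frechet_derivative[OF fT, of "?B ! (j - length hs)"] by (simp add: nth_append)
    qed
  qed
  hence "smooth_on ?T (\<lambda>u. cdet (?V u))"
    unfolding cdet_eq_ndet by (intro smooth_on_ndet T) auto
  hence "smooth_on (snd c ` (fst c \<inter> fst c)) (chart_cdet M c hs f \<circ> chart_inv c)"
    unfolding Int_absorb
    by (subst smooth_on_cong[OF T, of _ "\<lambda>u. cdet (?V u)"])
       (auto simp: chart_cdet_def chart_inv_chart[OF c])
  thus ?thesis
    using c chart_open[OF c] by (blast intro: msmooth_onI)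
qed

lemma frame_det_chart_positive:
  assumes M: "oriented_manifold M" and c: "c \<in> atlas M" "x \<in> fst c"
  shows "frame_det (model_frame M) (map (mderiv M (snd c) x) (model_frame M)) > 0"
proof -
  interpret smooth_manifold M
    by (rule oriented_imp_smooth_manifold[OF M])
  have "\<forall>(U, \<kappa>)\<in>atlas M. \<forall>(V, \<mu>)\<in>atlas M. \<forall>x\<in>U \<inter> V. frame_det (model_frame M)
      (map (frechet_derivative (\<mu> \<circ> inv_into U \<kappa>) (at (\<kappa> x))) (model_frame M)) > 0"
    using M unfolding oriented_manifold_def by fastforce
  from bspec[OF this chart_at_atlas[of x], unfolded case_prod_beta, rule_format, OF c(1)]
  show ?thesis
    using chart_at_mem c(2) by (simp add: mderiv_def chart_inv_def)
qed

text \<open>Changing from the distinguished chart at each point to one fixed chart multiplies the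
  determinant by a positive number, so its argument can be computed in the fixed chart.\<close>

lemma frame_cdet_chart:
  fixes f :: "'a::{t2_space,second_countable_topology} \<Rightarrow> complex ^ 'n::{finite,linorder}"
  assumes M: "oriented_manifold M" and c: "c \<in> atlas M" "x \<in> fst c" and f: "msmooth_on M UNIV f"
    and n: "length hs + mdim M = CARD('n)"
  obtains r where "r > 0" "frame_cdet M hs f x = of_real r * chart_cdet M c hs f x"
proof
  interpret smooth_manifold M
    by (rule oriented_imp_smooth_manifold[OF M])
  let ?B = "model_frame M"
  let ?r = "frame_det ?B (map (mderiv M (snd c) x) ?B)"
  show "?r > 0"
    by (rule frame_det_chart_positive[OF M c])
  let ?D = "frechet_derivative (f \<circ> chart_inv c) (at (snd c x))"
  have map: "map (mderiv M f x) ?B = map ?D (map (mderiv M (snd c) x) ?B)"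
    using mderiv_smooth_in_chart[OF f UNIV_I c] by simp
  have "linear ?D"
    using msmooth_on_differentiable[OF f UNIV_I c] has_derivative_bounded_linear bounded_linear.linear by blast
  thus "frame_cdet M hs f x = of_real ?r * chart_cdet M c hs f x"
    unfolding frame_cdet_def chart_cdet_def map
    by (intro cdet_append_map_frame[OF frame]) (use n in \<open>simp_all add: mdim_def\<close>)
qed

text \<open>The factor \<open>k\<close> is there for the powers of \<open>\<phi>\<^sub>1\<close> and \<open>\<phi>\<^sub>2\<close> in the angle \<open>G\<close> of the surface.\<close>

lemma smooth_angle_frame_cdet:
  fixes f :: "'a::{t2_space,second_countable_topology} \<Rightarrow> complex ^ 'n::{finite,linorder}"
  assumes M: "oriented_manifold M" and f: "msmooth_on M UNIV f"
    and hs: "\<And>h. h \<in> set hs \<Longrightarrow> msmooth_on M UNIV h"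
    and n: "length hs + mdim M = CARD('n)" and nz: "\<And>x. frame_cdet M hs f x \<noteq> 0"
    and k: "msmooth_on M UNIV k" "\<And>x. k x \<noteq> 0"
  shows "smooth_angle M (\<lambda>x. carg (frame_cdet M hs f x * k x))"
proof -
  interpret smooth_manifold M
    by (rule oriented_imp_smooth_manifold[OF M])
  show ?thesis
  proof (rule smooth_angle_carg, intro exI conjI ballI)
    fix x
    let ?c = "chart_at M x"
    show "open (fst ?c)" "x \<in> fst ?c"
      by (rule chart_open[OF chart_at_atlas] chart_at_mem)+
    have kc: "msmooth_on M (fst ?c) k"
      by (rule msmooth_on_subset[OF k(1)]) simp
    show "msmooth_on M (fst ?c) (\<lambda>y. chart_cdet M ?c hs f y * k y)"
      unfolding msmooth_on_def comp_def
    proof (intro ballI smooth_on_bilinear[OF _ bounded_bilinear_mult])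
      fix d assume d: "d \<in> atlas M"
      show "open (snd d ` (fst d \<inter> fst ?c))"
        by (rule open_chart_image[OF d chart_open[OF chart_at_atlas]])
      show "smooth_on (snd d ` (fst d \<inter> fst ?c)) (\<lambda>u. chart_cdet M ?c hs f (chart_inv d u))"
        using msmooth_onD[OF msmooth_chart_cdet[OF chart_at_atlas f hs n] d] by (simp add: comp_def)
      show "smooth_on (snd d ` (fst d \<inter> fst ?c)) (\<lambda>u. k (chart_inv d u))"
        using msmooth_onD[OF kc d] by (simp add: comp_def)
    qed
    fix y assume y: "y \<in> fst ?c"
    obtain r where r: "r > 0" "frame_cdet M hs f y = of_real r * chart_cdet M ?c hs f y"
      using frame_cdet_chart[OF M chart_at_atlas y f n] .
    show nz': "chart_cdet M ?c hs f y * k y \<noteq> 0"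
      using nz[of y] k(2) by (simp add: r(2))
    show "carg (frame_cdet M hs f y * k y) = carg (chart_cdet M ?c hs f y * k y)"
      using carg_positive_mult[OF r(1) nz'] by (simp add: r(2) mult.assoc)
  qed
qed

section \<open>Lagrangian and Legendrian angles\<close>

lemma lagrangian_isotropic:
  fixes f :: "'a::t2_space \<Rightarrow> complex ^ 'n::{finite,linorder}"
  assumes M: "smooth_manifold M" and f: "lagrangian_immersion M f"
  shows "isotropic_map (mderiv M f x) (model_frame M) []"
proof -
  interpret smooth_manifold M by (rule M)
  show ?thesis
    using f frame linear_mderiv[of UNIV f x]
    by (auto simp: isotropic_map_def lagrangian_immersion_def immersion_def mdim_def)
qed

lemma lagrangian_angle_eq:
  fixes f :: "'a::t2_space \<Rightarrow> complex ^ 'n::{finite,linorder}"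
  assumes M: "smooth_manifold M" and f: "lagrangian_immersion M f"
  shows "frame_cdet M [] f x \<noteq> 0" and "lagrangian_angle M f x = carg (frame_cdet M [] f x)"
proof -
  interpret smooth_manifold M by (rule M)
  interpret isotropic_map "mderiv M f x" "model_frame M" "[]"
    by (rule lagrangian_isotropic[OF M f])
  show "frame_cdet M [] f x \<noteq> 0"
    using cdet_basis_nonzero by (simp add: frame_cdet_def)
  have oriented: "oriented_frame M (model_frame M)"
    by (simp add: oriented_frame_def mdim_def frame_det_basis frame)
  show "lagrangian_angle M f x = carg (frame_cdet M [] f x)"
    unfolding lagrangian_angle_def
  proof (rule the_equality)
    show "\<forall>es. oriented_frame M es \<longrightarrow> carg (frame_cdet M [] f x) = carg (cdet (map (mderiv M f x) es))"
      using carg_cdet_oriented_frame by (auto simp: frame_cdet_def oriented_frame_def mdim_def)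
    fix \<theta> assume "\<forall>es. oriented_frame M es \<longrightarrow> \<theta> = carg (cdet (map (mderiv M f x) es))"
    thus "\<theta> = carg (frame_cdet M [] f x)"
      using oriented by (simp add: frame_cdet_def)
  qed
qed

lemma inner_i_smult: "v \<bullet> (\<i> *s w) = Im (hprod v w)"
  for v w :: "complex ^ 'n::finite"
  by (simp add: inner_eq_Re_hprod hprod_mult_right)

text \<open>Differentiating \<open>\<langle>d\<psi>(v), i\<psi>\<rangle> = 0\<close> along \<open>w\<close> gives
  \<open>\<langle>d\<^sup>2\<psi>(w, v), i\<psi>\<rangle> + \<langle>d\<psi>(v), i d\<psi>(w)\<rangle> = 0\<close>. The first term is symmetric in \<open>v\<close> and \<open>w\<close>, the
  second one antisymmetric, so both vanish: the differential of the Liouville form is the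
  symplectic form.\<close>

lemma legendrian_symp:
  fixes f :: "'a::t2_space \<Rightarrow> complex ^ 'n::{finite,linorder}"
  assumes M: "smooth_manifold M" and f: "legendrian_immersion M f"
  shows "symp (mderiv M f x v) (mderiv M f x w) = 0"
proof -
  interpret smooth_manifold M by (rule M)
  let ?c = "chart_at M x"
  let ?T = "snd ?c ` fst ?c" and ?u = "snd ?c x" and ?f = "f \<circ> chart_inv ?c"
  have sm: "msmooth_on M UNIV f"
    using f by (auto simp: legendrian_immersion_def immersion_def)
  have T: "open ?T" "?u \<in> ?T"
    using chart_image_open[OF chart_at_atlas] chart_at_mem by auto
  have fT: "smooth_on ?T ?f"
    using msmooth_onD[OF sm chart_at_atlas] by simp
  let ?D = "\<lambda>u. frechet_derivative ?f (at u)"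
  have zero: "?D u a \<bullet> (\<i> *s ?f u) = 0" if "u \<in> ?T" for u a
  proof -
    from that obtain y where y: "y \<in> fst ?c" "u = snd ?c y" by auto
    have "liouville (f y) (mderiv M f y (coord_field M ?c a y)) = 0"
      using f by (auto simp: legendrian_immersion_def)
    thus ?thesis
      using mderiv_coord_direction[OF sm UNIV_I chart_at_atlas y(1)] y
      by (simp add: liouville_def chart_inv_chart[OF chart_at_atlas])
  qed
  have bl: "bounded_linear (\<lambda>z :: complex ^ 'n::{finite,linorder}. \<i> *s z)"
    unfolding linear_conv_bounded_linear[symmetric]
    by (intro linearI) (simp_all add: Finite_Cartesian_Product.vec_eq_iff vector_smult_component distrib_left)
  have "frechet_derivative (\<lambda>u. ?D u a) (at ?u) b \<bullet> (\<i> *s ?f ?u) + ?D ?u a \<bullet> (\<i> *s ?D ?u b) = 0" for a b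
  proof -
    have "((\<lambda>u. ?D u a \<bullet> (\<i> *s ?f u)) has_derivative
        (\<lambda>b. ?D ?u a \<bullet> (\<i> *s ?D ?u b) + frechet_derivative (\<lambda>u. ?D u a) (at ?u) b \<bullet> (\<i> *s ?f ?u))) (at ?u)"
      by (intro has_derivative_inner bounded_linear.has_derivative[OF bl]
          smooth_on_has_derivative[OF fT T(2)]
          smooth_on_has_derivative[OF smooth_on_frechet_derivative[OF fT] T(2)])
    moreover have "((\<lambda>u. ?D u a \<bullet> (\<i> *s ?f u)) has_derivative (\<lambda>_. 0)) (at ?u)"
      by (rule has_derivative_transform_within_open[OF has_derivative_const T, of 0])
         (simp only: zero)
    ultimately have "(\<lambda>b. ?D ?u a \<bullet> (\<i> *s ?D ?u b) +
        frechet_derivative (\<lambda>u. ?D u a) (at ?u) b \<bullet> (\<i> *s ?f ?u)) = (\<lambda>_. 0)"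
      by (rule has_derivative_unique)
    from fun_cong[OF this, of b] show ?thesis
      by (subst add.commute)
  qed
  from this[of v w] this[of w v] second_derivative_symmetric[OF fT T, of v w]
  have "?D ?u v \<bullet> (\<i> *s ?D ?u w) = ?D ?u w \<bullet> (\<i> *s ?D ?u v)"
    by simp
  moreover have "Im (hprod (?D ?u w) (?D ?u v)) = - Im (hprod (?D ?u v) (?D ?u w))"
    using cnj_hprod[of "?D ?u v" "?D ?u w"] by (metis cnj.sel(2))
  ultimately show ?thesis
    by (simp add: inner_i_smult symp_def mderiv_def)
qed

text \<open>The real part vanishes because the immersion stays in the sphere, the imaginary part because the
  Liouville form pulls back to zero.\<close>

lemma legendrian_position_normal:
  fixes f :: "'a::t2_space \<Rightarrow> complex ^ 'n::{finite,linorder}"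
  assumes M: "smooth_manifold M" and f: "legendrian_immersion M f"
  shows "hprod (f x) (mderiv M f x v) = 0" and "hprod (f x) (f x) = 1"
proof -
  interpret smooth_manifold M by (rule M)
  let ?c = "chart_at M x"
  let ?T = "snd ?c ` fst ?c" and ?u = "snd ?c x" and ?f = "f \<circ> chart_inv ?c"
  have sm: "msmooth_on M UNIV f"
    using f by (auto simp: legendrian_immersion_def immersion_def)
  have unit: "f y \<bullet> f y = 1" for y
    using f by (auto simp: legendrian_immersion_def norm_eq_1[symmetric])
  have "Im (hprod (f x) (f x)) = 0"
    using cnj_hprod[of "f x" "f x"] by (simp add: complex_eq_iff)
  thus "hprod (f x) (f x) = 1"
    using unit[of x] by (simp add: complex_eq_iff Re_hprod)
  have "((\<lambda>u. ?f u \<bullet> ?f u) has_derivative (\<lambda>v. ?f ?u \<bullet> mderiv M f x v + mderiv M f x v \<bullet> ?f ?u)) (at ?u)"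
    by (intro has_derivative_inner mderiv_has_derivative[OF sm UNIV_I])
  moreover have "((\<lambda>u. ?f u \<bullet> ?f u) has_derivative (\<lambda>_. 0)) (at ?u)"
    by (simp add: unit)
  ultimately have "(\<lambda>v. ?f ?u \<bullet> mderiv M f x v + mderiv M f x v \<bullet> ?f ?u) = (\<lambda>_. 0)"
    by (rule has_derivative_unique)
  hence "f x \<bullet> mderiv M f x v + mderiv M f x v \<bullet> f x = 0"
    by (simp add: chart_inv_chart[OF chart_at_atlas chart_at_mem] fun_eq_iff)
  hence re: "f x \<bullet> mderiv M f x v = 0"
    by (simp add: inner_commute)
  have "liouville (f x) (mderiv M f x v) = 0"
    using f by (auto simp: legendrian_immersion_def)
  hence "Im (hprod (mderiv M f x v) (f x)) = 0"
    by (simp add: liouville_def inner_i_smult)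
  hence "Im (hprod (f x) (mderiv M f x v)) = 0"
    using cnj_hprod[of "f x" "mderiv M f x v"] by (metis cnj.sel(2) neg_equal_0_iff_equal)
  thus "hprod (f x) (mderiv M f x v) = 0"
    using re by (simp add: complex_eq_iff Re_hprod)
qed

lemma legendrian_isotropic:
  fixes f :: "'a::t2_space \<Rightarrow> complex ^ 'n::{finite,linorder}"
  assumes M: "smooth_manifold M" and f: "legendrian_immersion M f"
  shows "isotropic_map (mderiv M f x) (model_frame M) [f x]"
proof -
  interpret smooth_manifold M by (rule M)
  show ?thesis
    using f frame linear_mderiv[of UNIV f x] legendrian_symp[OF M f] legendrian_position_normal[OF M f]
    by (auto simp: isotropic_map_def legendrian_immersion_def immersion_def mdim_def)
qed

text \<open>For orthonormal frames the determinant has modulus one, and for oriented frames its argument does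
  not depend on the frame, so all oriented orthonormal frames have the same determinant.\<close>

lemma legendrian_angle_eq:
  fixes f :: "'a::t2_space \<Rightarrow> complex ^ 'n::{finite,linorder}"
  assumes M: "smooth_manifold M" and f: "legendrian_immersion M f"
  shows "frame_cdet M [f] f x \<noteq> 0" and "legendrian_angle M f x = carg (frame_cdet M [f] f x)"
proof -
  interpret smooth_manifold M by (rule M)
  interpret isotropic_map "mderiv M f x" "model_frame M" "[f x]"
    by (rule legendrian_isotropic[OF M f])
  show "frame_cdet M [f] f x \<noteq> 0"
    using cdet_basis_nonzero by (simp add: frame_cdet_def)
  show "legendrian_angle M f x = carg (frame_cdet M [f] f x)"
    unfolding legendrian_angle_def
  proof (rule the_equality)
    show "\<forall>es. oriented_frame M es \<and> orthonormal (induced_metric M f) x es \<longrightarrow>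
        angle_cis (carg (frame_cdet M [f] f x)) = cdet (f x # map (mderiv M f x) es)"
    proof (intro allI impI)
      fix es assume "oriented_frame M es \<and> orthonormal (induced_metric M f) x es"
      hence es: "length es = length (model_frame M)" "frame_det (model_frame M) es > 0"
        and on: "\<And>i j. i < length (model_frame M) \<Longrightarrow> j < length (model_frame M) \<Longrightarrow>
          mderiv M f x (es ! i) \<bullet> mderiv M f x (es ! j) = (if i = j then 1 else 0)"
        by (auto simp: oriented_frame_def mdim_def orthonormal_def induced_metric_def)
      have "carg (frame_cdet M [f] f x) = carg (cdet (f x # map (mderiv M f x) es))"
        using carg_cdet_oriented_frame[OF es] by (simp add: frame_cdet_def)
      thus "angle_cis (carg (frame_cdet M [f] f x)) = cdet (f x # map (mderiv M f x) es)"
        using carg_norm_one[OF cmod_cdet_orthonormal[OF es(1) on]] by simp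
    qed
    fix \<theta> assume \<theta>: "\<forall>es. oriented_frame M es \<and> orthonormal (induced_metric M f) x es \<longrightarrow>
        angle_cis \<theta> = cdet (f x # map (mderiv M f x) es)"
    obtain es where es: "length es = length (model_frame M)" "frame_det (model_frame M) es > 0"
      "\<And>i j. i < length (model_frame M) \<Longrightarrow> j < length (model_frame M) \<Longrightarrow>
        mderiv M f x (es ! i) \<bullet> mderiv M f x (es ! j) = (if i = j then 1 else 0)"
      using oriented_orthonormal_frame_exists by blast
    hence "angle_cis \<theta> = cdet ([f x] @ map (mderiv M f x) es)"
      using \<theta> by (simp add: oriented_frame_def mdim_def orthonormal_def induced_metric_def)
    hence "carg (angle_cis \<theta>) = carg (frame_cdet M [f] f x)"
      using carg_cdet_oriented_frame[OF es(1,2)] by (simp add: frame_cdet_def)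
    thus "\<theta> = carg (frame_cdet M [f] f x)"
      using carg_polar[of 1 \<theta>] by simp
  qed
qed

section \<open>Gradients\<close>

text \<open>Extend \<open>\<alpha>\<close> along a left inverse of \<open>L\<close> to the Euclidean space, represent it there by a vector and
  project that vector to the range of \<open>L\<close>.\<close>

lemma riesz_pullback:
  fixes L :: "'e::real_vector \<Rightarrow> 'f::euclidean_space"
  assumes L: "linear L" "inj L" and \<alpha>: "linear \<alpha>"
  shows "\<exists>w. \<forall>v. L w \<bullet> L v = \<alpha> v"
proof -
  obtain R where R: "linear R" "\<And>v. R (L v) = v"
    using linear_injective_left_inverse[OF L] by (metis comp_apply id_apply)
  have "linear (\<alpha> \<circ> R)"
    using linear_compose[OF R(1) \<alpha>] .
  define a where "a = adjoint (\<alpha> \<circ> R) 1"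
  have a: "\<alpha> v = L v \<bullet> a" for v
    using adjoint_works[OF \<open>linear (\<alpha> \<circ> R)\<close>, of "L v" 1] by (simp add: a_def R(2))
  obtain y z where y: "y \<in> span (range L)" and z: "\<And>w. w \<in> span (range L) \<Longrightarrow> orthogonal z w" and "a = y + z"
    using orthogonal_subspace_decomp_exists[of "range L" a] by metis
  have "span (range L) = range L"
    by (rule real_vector.span_eq_iff[THEN iffD2]) (rule linear_subspace_image[OF L(1) subspace_UNIV])
  with y have "y \<in> range L"
    by (simp only:)
  then obtain w where w: "y = L w"
    by blast
  have "L w \<bullet> L v = \<alpha> v" for v
    using z[of "L v"] \<open>a = y + z\<close> a[of v] w
    by (simp add: inner_add_right Linear_Algebra.orthogonal_def inner_commute real_vector.span_base)
  thus ?thesis by blast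
qed

locale immersed_manifold = smooth_manifold M for M :: "('a::t2_space, 'e::real_normed_vector) manifold" +
  fixes f :: "'a \<Rightarrow> 'f::euclidean_space"
  assumes immersion: "immersion M f"
begin

abbreviation "g \<equiv> induced_metric M f"

lemma smooth: "msmooth_on M UNIV f"
  using immersion by (simp add: immersion_def)

lemma linear_differential: "linear (mderiv M f x)"
  by (rule linear_mderiv[OF smooth UNIV_I])

lemma inj_differential: "inj (mderiv M f x)"
  using immersion by (simp add: immersion_def)

lemma metric_nondegenerate:
  assumes "\<And>v. g x w v = g x w' v"
  shows "w = w'"
proof -
  have "mderiv M f x (w - w') \<bullet> mderiv M f x (w - w') = 0"
    using assms[of w] assms[of w'] linear_diff[OF linear_differential, of x w w']
    by (simp add: induced_metric_def inner_diff_left inner_diff_right inner_commute)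
  hence "mderiv M f x w = mderiv M f x w'"
    by (simp add: linear_diff[OF linear_differential])
  thus ?thesis
    using inj_differential by (simp add: inj_eq)
qed

lemma metric_linear:
  shows "linear (g x v)" and "linear (\<lambda>w. g x w v)"
  using linear_differential[of x]
  by (auto intro!: linearI simp: induced_metric_def linear_add linear_cmul inner_add_right inner_add_left)

lemma metric_commute: "g x v w = g x w v"
  by (simp add: induced_metric_def inner_commute)

lemma sharp_eqI: "(\<And>v. g x w v = \<alpha> x v) \<Longrightarrow> sharp g \<alpha> x = w"
  unfolding sharp_def by (rule the_equality) (simp, rule metric_nondegenerate[of x], simp)

lemma metric_sharp: "linear (\<alpha> x) \<Longrightarrow> g x (sharp g \<alpha> x) v = \<alpha> x v"
  using riesz_pullback[OF linear_differential inj_differential, of "\<alpha> x" x]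
  by (metis induced_metric_def sharp_eqI)

text \<open>The first fundamental form of the immersion in the chart \<open>c\<close>, at the point with coordinates \<open>u\<close>.\<close>

definition chart_metric :: "('a, 'e) chart \<Rightarrow> 'e \<Rightarrow> 'e \<Rightarrow> 'e \<Rightarrow> real"
  where "chart_metric c u a b =
    frechet_derivative (f \<circ> chart_inv c) (at u) a \<bullet> frechet_derivative (f \<circ> chart_inv c) (at u) b"

lemma metric_in_chart:
  assumes c: "c \<in> atlas M" "x \<in> fst c"
  shows "g x v w = chart_metric c (snd c x) (mderiv M (snd c) x v) (mderiv M (snd c) x w)"
  by (simp add: induced_metric_def chart_metric_def mderiv_smooth_in_chart[OF smooth UNIV_I c])

lemma metric_at: "g x v w = chart_metric (chart_at M x) (snd (chart_at M x) x) v w"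
  by (simp add: metric_in_chart[OF chart_at_atlas chart_at_mem] mderiv_chart_at)

lemma smooth_chart_metric:
  assumes "c \<in> atlas M" "smooth_on (snd c ` (fst c \<inter> W)) X" "smooth_on (snd c ` (fst c \<inter> W)) Y" "open W"
  shows "smooth_on (snd c ` (fst c \<inter> W)) (\<lambda>u. chart_metric c u (X u) (Y u))"
proof -
  have "smooth_on (snd c ` (fst c \<inter> W)) (f \<circ> chart_inv c)"
    by (rule smooth_on_subset[OF msmooth_onD[OF smooth assms(1)]]) auto
  thus ?thesis
    unfolding chart_metric_def
    by (intro smooth_on_bilinear[OF _ bounded_bilinear_inner]
        smooth_on_frechet_derivative_field[OF frame] open_chart_image assms)
qed

text \<open>The coordinates of a gradient solve a linear system whose matrix is the Gram matrix of the
  coordinate fields. Cramer's rule exhibits them as smooth functions.\<close>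

lemma smooth_grad_angle:
  assumes \<beta>: "smooth_angle M \<beta>"
  shows "smooth_field_on M UNIV (grad_angle M g \<beta>)"
  unfolding smooth_field_on_def
proof
  fix c assume c: "c \<in> atlas M"
  let ?B = "model_frame M" and ?T = "snd c ` fst c"
  let ?X = "field_in_chart M c (grad_angle M g \<beta>)"
  let ?n = "length ?B"
  have T: "open ?T"
    by (rule chart_image_open[OF c])
  define A where "A = (\<lambda>i j u. chart_metric c u (?B ! j) (?B ! i))"
  define r where "r = (\<lambda>i u. mderiv_angle M \<beta> (chart_inv c u) (coord_field M c (?B ! i) (chart_inv c u)))"
  have D: "linear (frechet_derivative (f \<circ> chart_inv c) (at u))" if "u \<in> ?T" for u
    using smooth_on_linear_frechet[OF msmooth_onD[OF smooth c]] that by simp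
  have grad: "chart_metric c u (?X u) (?B ! i) = r i u" if u: "u \<in> ?T" for u i
  proof -
    from u obtain x where x: "x \<in> fst c" "u = snd c x" by auto
    have "chart_metric c u (?X u) (?B ! i) = g x (grad_angle M g \<beta> x) (coord_field M c (?B ! i) x)"
      by (simp add: metric_in_chart[OF c x(1)] x field_in_chart_eq[OF c] mderiv_coord_field[OF c])
    thus ?thesis
      using metric_sharp[of "mderiv_angle M \<beta>" x] linear_mderiv_angle[OF \<beta>]
      by (simp add: grad_angle_def r_def x chart_inv_chart[OF c])
  qed
  have system: "(\<Sum>j<?n. A i j u * representation (set ?B) (?X u) (?B ! j)) = r i u"
    if u: "u \<in> ?T" "i < ?n" for u i
    using grad[OF u(1), of i] linear_basis_expansion[OF frame D[OF u(1)], of "?X u"]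
    by (simp add: A_def chart_metric_def inner_sum_left mult.commute)
  have nz: "ndet ?n (\<lambda>i j. A i j u) \<noteq> 0" if u: "u \<in> ?T" for u
  proof
    from u obtain x where x: "x \<in> fst c" "u = snd c x" by auto
    assume "ndet ?n (\<lambda>i j. A i j u) = 0"
    then obtain w k where k: "k < ?n" "w k \<noteq> 0" and ker: "\<And>i. i < ?n \<Longrightarrow> (\<Sum>j<?n. A i j u * w j) = 0"
      by (rule ndet_eq_0_imp_kernel) (rule that)
    let ?D = "frechet_derivative (f \<circ> chart_inv c) (at u)"
    define v where "v = (\<Sum>j<?n. w j *\<^sub>R ?B ! j)"
    have Dv: "?D v = (\<Sum>j<?n. w j *\<^sub>R ?D (?B ! j))"
      unfolding v_def using D[OF u] by (simp add: linear_sum linear_cmul)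
    have "?D v \<bullet> ?D v = (\<Sum>i<?n. w i * (\<Sum>j<?n. A i j u * w j))"
      unfolding Dv by (simp add: A_def chart_metric_def inner_sum_left inner_sum_right sum_distrib_left mult_ac)
    also have "\<dots> = 0"
      by (simp add: ker)
    finally have "?D v = 0"
      by simp
    hence "mderiv M f x (coord_field M c v x) = 0"
      using mderiv_coord_direction[OF smooth UNIV_I c x(1)] by (simp add: x)
    hence "coord_field M c v x = 0"
      using inj_differential[of x] linear_0[OF linear_differential[of x]] by (metis injD)
    hence "v = 0"
      using mderiv_coord_field[OF c x(1), of v] linear_0[OF linear_mderiv[OF msmooth_on_chart[OF c] x(1)]]
      by simp
    have lin: "linear (\<lambda>v. representation (set ?B) v (?B ! k))"
      by (rule bounded_linear.linear[OF bounded_linear_representation[OF frame]])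
    have "representation (set ?B) v (?B ! k) = (\<Sum>j<?n. w j * representation (set ?B) (?B ! j) (?B ! k))"
      using linear_sum[OF lin, of "\<lambda>j. w j *\<^sub>R ?B ! j" "{..<?n}"] linear_cmul[OF lin]
      by (simp add: v_def)
    also have "\<dots> = (\<Sum>j<?n. if j = k then w k else 0)"
      by (intro sum.cong) (auto simp: representation_basis_nth[OF frame] k)
    also have "\<dots> = w k"
      using k by simp
    finally show False
      using k(2) \<open>v = 0\<close> by (simp add: real_vector.representation_zero)
  qed
  have Asm: "smooth_on ?T (A i j)" for i j
    using smooth_chart_metric[OF c smooth_on_const smooth_on_const open_UNIV] unfolding A_def by simp
  have rsm: "smooth_on ?T (r i)" for i
  proof (rule smooth_on_local)
    fix u assume "u \<in> ?T"
    then obtain x where x: "x \<in> fst c" "u = snd c x" by auto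
    obtain W b where W: "open W" "x \<in> W" "msmooth_on M W b" "\<And>y. y \<in> W \<Longrightarrow> angle_of (b y) = \<beta> y"
      using smooth_angle_lift[OF \<beta>] by metis
    let ?U = "snd c ` (fst c \<inter> W)"
    have U: "open ?U" by (rule open_chart_image[OF c W(1)])
    have "r i (snd c y) = frechet_derivative (b \<circ> chart_inv c) (at (snd c y)) (?B ! i)"
      if "y \<in> fst c" "y \<in> W" for y
      using mderiv_angle_eq[OF W(1) that(2) W(3,4)] mderiv_coord_direction[OF W(3) that(2) c that(1)]
      by (simp add: r_def chart_inv_chart[OF c that(1)])
    hence "smooth_on ?U (r i)"
      by (subst smooth_on_cong[OF U, of _ "\<lambda>u. frechet_derivative (b \<circ> chart_inv c) (at u) (?B ! i)"])
         (auto intro!: smooth_on_frechet_derivative msmooth_onD[OF W(3) c])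
    thus "\<exists>T. open T \<and> u \<in> T \<and> smooth_on T (r i)"
      using U x W(2) by blast
  qed
  have coords: "representation (set ?B) (?X u) (?B ! k) =
      ndet ?n (\<lambda>i j. (if j = k then r i else A i j) u) * inverse (ndet ?n (\<lambda>i j. A i j u))"
    if "u \<in> ?T" "k < ?n" for u k
    using ndet_cramer[where n = ?n and A = "\<lambda>i j. A i j u" and b = "\<lambda>i. r i u"
        and w = "\<lambda>j. representation (set ?B) (?X u) (?B ! j)", OF system[OF that(1)] that(2)]
      nz[OF that(1)] by (simp add: field_simps if_distrib[of "\<lambda>h. h u"])
  have "smooth_on ?T (\<lambda>u. \<Sum>k<?n. (ndet ?n (\<lambda>i j. (if j = k then r i else A i j) u) *
      inverse (ndet ?n (\<lambda>i j. A i j u))) *\<^sub>R (?B ! k))"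
    by (intro smooth_on_sum smooth_on_bilinear[OF _ bounded_bilinear_scaleR]
        smooth_on_bilinear[OF _ bounded_bilinear_mult] smooth_on_ndet smooth_on_inverse smooth_on_const T)
       (auto simp: rsm Asm nz)
  moreover have "?X u = (\<Sum>k<?n. (ndet ?n (\<lambda>i j. (if j = k then r i else A i j) u) *
      inverse (ndet ?n (\<lambda>i j. A i j u))) *\<^sub>R (?B ! k))" if "u \<in> ?T" for u
  proof -
    have "?X u = (\<Sum>k<?n. representation (set ?B) (?X u) (?B ! k) *\<^sub>R (?B ! k))"
      by (rule basis_expansion[OF frame])
    also have "\<dots> = (\<Sum>k<?n. (ndet ?n (\<lambda>i j. (if j = k then r i else A i j) u) *
      inverse (ndet ?n (\<lambda>i j. A i j u))) *\<^sub>R (?B ! k))"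
      by (intro sum.cong refl arg_cong2[where f = scaleR] coords that) auto
    finally show ?thesis .
  qed
  ultimately show "smooth_on (snd c ` (fst c \<inter> UNIV)) ?X"
    using smooth_on_cong[OF T, of ?X] by simp
qed

end

section \<open>The Hessian of a function in coordinates\<close>

context immersed_manifold
begin

lemma chart_metric_eq:
  assumes c: "c \<in> atlas M" "x \<in> fst c"
  shows "chart_metric c (snd c x) a b = g x (coord_field M c a x) (coord_field M c b x)"
  by (simp add: metric_in_chart[OF c] mderiv_coord_field[OF c])

lemma grad_angle_inner: "smooth_angle M \<beta> \<Longrightarrow> g x (grad_angle M g \<beta> x) v = mderiv_angle M \<beta> x v"
  unfolding grad_angle_def by (rule metric_sharp[OF linear_mderiv_angle])

text \<open>The Koszul formula for a gradient field \<open>V\<close> and coordinate fields \<open>a\<close>, \<open>b\<close>. The form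
  \<open>g(D\<^sub>a V, b)\<close> is symmetric because the second derivatives of a lift of the angle are, and the
  symmetrised form is half the Lie derivative of \<open>g\<close> along \<open>V\<close>, in which no Christoffel symbols
  occur.\<close>

lemma covariant_derivative_gradient:
  fixes x :: 'a
  assumes D: "levi_civita M g D" and \<beta>: "smooth_angle M \<beta>"
  defines "V \<equiv> grad_angle M g \<beta>" and "c \<equiv> chart_at M x"
  defines "X \<equiv> field_in_chart M c V" and "u \<equiv> snd c x"
  shows "2 * g x (D x a V) b =
    frechet_derivative (\<lambda>u. chart_metric c u a b) (at u) (V x) +
    g x (frechet_derivative X (at u) a) b + g x a (frechet_derivative X (at u) b)"
proof -
  have c: "c \<in> atlas M" "x \<in> fst c"
    by (simp_all add: c_def chart_at_atlas chart_at_mem)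
  let ?W = "fst c" and ?T = "snd c ` fst c"
  let ?E = "coord_field M c"
  have W: "open ?W" and T: "open ?T" "u \<in> ?T"
    using chart_open[OF c(1)] chart_image_open[OF c(1)] c(2) by (auto simp: u_def)
  have E: "smooth_field_on M ?W (?E v)" for v
    by (rule smooth_coord_field[OF c(1)])
  have V: "smooth_field_on M ?W V"
    unfolding V_def by (rule smooth_field_on_subset[OF smooth_grad_angle[OF \<beta>]]) simp
  have Ex: "?E v x = v" for v
    unfolding c_def by (rule coord_field_at)
  have tor: "D x (Y x) Z - D x (Z x) Y = lie_bracket M Y Z x"
    and met: "mderiv M (\<lambda>y. g y (Y y) (Z y)) x v = g x (D x v Y) (Z x) + g x (Y x) (D x v Z)"
    if "smooth_field_on M ?W Y" "smooth_field_on M ?W Z" for Y Z v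
    using D W that c(2) unfolding levi_civita_def by blast+
  have Econst: "frechet_derivative (field_in_chart M c (?E v)) (at u) = (\<lambda>_. 0)" for v
  proof -
    have "frechet_derivative (field_in_chart M c (?E v)) (at u) = frechet_derivative (\<lambda>_. v) (at u)"
      by (rule frechet_derivative_cong_open[OF T field_in_chart_coord_field[OF c(1)]])
    thus ?thesis by simp
  qed
  have EV: "D x v V - D x (V x) (?E v) = frechet_derivative X (at u) v" for v
    using tor[OF E V, of v] Econst
    by (simp add: Ex lie_bracket_def Let_def c_def[symmetric] u_def[symmetric] X_def)
  have EE: "D x v (?E w) = D x w (?E v)" for v w
    using tor[OF E E, of v w] Econst
    by (simp add: Ex lie_bracket_def Let_def c_def[symmetric] u_def[symmetric])
  obtain U b0 where U: "open U" "x \<in> U" "msmooth_on M U b0" "\<And>y. y \<in> U \<Longrightarrow> angle_of (b0 y) = \<beta> y"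
    using smooth_angle_lift[OF \<beta>] by metis
  let ?b = "b0 \<circ> chart_inv c" and ?S = "snd c ` (fst c \<inter> U)"
  have S: "open ?S" "u \<in> ?S"
    using open_chart_image[OF c(1) U(1)] c(2) U(2) by (auto simp: u_def)
  have bS: "smooth_on ?S ?b"
    by (rule msmooth_onD[OF U(3) c(1)])
  have dV: "mderiv M (\<lambda>y. g y (V y) (?E w y)) x v =
      frechet_derivative (\<lambda>u. frechet_derivative ?b (at u) w) (at u) v" for v w
  proof -
    have "g y (V y) (?E w y) = frechet_derivative ?b (at (snd c y)) w" if y: "y \<in> fst c" "y \<in> U" for y
    proof -
      have "mderiv_angle M \<beta> y = mderiv M b0 y"
        by (rule mderiv_angle_eq[OF U(1) y(2) U(3)]) (rule U(4))
      thus ?thesis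
        using mderiv_coord_direction[OF U(3) y(2) c(1) y(1)] by (simp add: V_def grad_angle_inner[OF \<beta>])
    qed
    hence "((\<lambda>y. g y (V y) (?E w y)) \<circ> chart_inv c) u' = frechet_derivative ?b (at u') w" if "u' \<in> ?S" for u'
      using that by (auto simp: chart_inv_chart[OF c(1)])
    hence "frechet_derivative ((\<lambda>y. g y (V y) (?E w y)) \<circ> chart_inv c) (at u) =
        frechet_derivative (\<lambda>u. frechet_derivative ?b (at u) w) (at u)"
      by (rule frechet_derivative_cong_open[OF S])
    thus ?thesis
      by (simp add: mderiv_def c_def[symmetric] u_def[symmetric])
  qed
  have "g x (D x a V) b + g x (V x) (D x a (?E b)) = g x (D x b V) a + g x (V x) (D x b (?E a))"
    using met[OF V E, of a b] met[OF V E, of b a] second_derivative_symmetric[OF bS S, of b a]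
    by (simp add: Ex dV)
  hence sym: "g x (D x a V) b = g x (D x b V) a"
    by (simp add: EE)
  have dE: "mderiv M (\<lambda>y. g y (?E a y) (?E b y)) x (V x) =
      frechet_derivative (\<lambda>u. chart_metric c u a b) (at u) (V x)"
  proof -
    have "frechet_derivative ((\<lambda>y. g y (?E a y) (?E b y)) \<circ> chart_inv c) (at u) =
        frechet_derivative (\<lambda>u. chart_metric c u a b) (at u)"
      by (rule frechet_derivative_cong_open[OF T])
         (auto simp: chart_inv_chart[OF c(1)] chart_metric_eq[OF c(1)])
    thus ?thesis
      by (simp add: mderiv_def c_def[symmetric] u_def[symmetric])
  qed
  have "frechet_derivative (\<lambda>u. chart_metric c u a b) (at u) (V x) =
      g x (D x (V x) (?E a)) b + g x a (D x (V x) (?E b))"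
    using met[OF E E, of a b "V x"] by (simp add: Ex dE)
  moreover have "g x (D x (V x) (?E a)) b = g x (D x a V) b - g x (frechet_derivative X (at u) a) b"
    unfolding EV[symmetric] by (simp add: linear_diff[OF metric_linear(2)])
  moreover have "g x a (D x (V x) (?E b)) = g x (D x b V) a - g x a (frechet_derivative X (at u) b)"
    unfolding EV[symmetric] by (simp add: linear_diff[OF metric_linear(1)] metric_commute)
  ultimately show ?thesis
    using sym by simp
qed

lemma differentiable_chart_metric:
  assumes c: "c \<in> atlas M" "x \<in> fst c"
  shows "((\<lambda>u. chart_metric c u a b) has_derivative
    frechet_derivative (\<lambda>u. chart_metric c u a b) (at (snd c x))) (at (snd c x))"
  using smooth_on_has_derivative[OF smooth_chart_metric[OF c(1) smooth_on_const smooth_on_const open_UNIV], of "snd c x" a b] c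
  by simp

lemma differentiable_field_in_chart:
  assumes "smooth_field_on M UNIV X" and c: "c \<in> atlas M" "x \<in> fst c"
  shows "(field_in_chart M c X has_derivative
    frechet_derivative (field_in_chart M c X) (at (snd c x))) (at (snd c x))"
  using assms(1) smooth_on_has_derivative[of "snd c ` fst c" "field_in_chart M c X" "snd c x"] c
  unfolding smooth_field_on_def by simp

lemma grad_inner: "msmooth_on M UNIV h \<Longrightarrow> g x (grad M g h x) v = mderiv M h x v"
  unfolding grad_def by (rule metric_sharp[OF linear_mderiv[OF _ UNIV_I]])

end

lemma levi_civita_linear:
  assumes "levi_civita M g D" "smooth_field_on M UNIV X"
  shows "linear (\<lambda>v. D x v X)"
proof -
  have "affine_connection M D"
    using assms(1) by (simp add: levi_civita_def)
  from this[unfolded affine_connection_def, THEN spec, of UNIV, THEN spec, of X] assms(2)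
  show ?thesis by simp
qed

lemma levi_civita_scale:
  assumes "levi_civita M g D" "smooth_field_on M UNIV X" "msmooth_on M UNIV h"
  shows "D x v (\<lambda>y. h y *\<^sub>R X y) = mderiv M h x v *\<^sub>R X x + h x *\<^sub>R D x v X"
proof -
  have "affine_connection M D"
    using assms(1) by (simp add: levi_civita_def)
  from this[unfolded affine_connection_def, THEN spec, of UNIV, THEN spec, of X] assms(2,3)
  show ?thesis by simp
qed

lemma basis_trace_add: "ordered_basis B \<Longrightarrow>
    basis_trace B (\<lambda>v. L v + K v) = basis_trace B L + basis_trace B K"
  by (simp add: basis_trace_def real_vector.representation_add ordered_basis_def sum.distrib)

lemma basis_trace_scale: "ordered_basis B \<Longrightarrow> basis_trace B (\<lambda>v. r *\<^sub>R L v) = r * basis_trace B L"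
  by (simp add: basis_trace_def real_vector.representation_scale ordered_basis_def sum_distrib_left)

lemma basis_trace_ident: "ordered_basis B \<Longrightarrow> basis_trace B (\<lambda>v. v) = real (length B)"
  by (simp add: basis_trace_def representation_basis_nth)

text \<open>With \<open>\<alpha>\<close> the differential of \<open>h\<close> this is the term \<open>dh(V)\<close> of \<open>div (h V) = dh(V) + h div V\<close>.\<close>

lemma basis_trace_rank_one:
  assumes B: "ordered_basis B" and \<alpha>: "linear \<alpha>"
  shows "basis_trace B (\<lambda>v. \<alpha> v *\<^sub>R w) = \<alpha> w"
  using B linear_basis_expansion[OF B \<alpha>, of w]
  by (simp add: basis_trace_def real_vector.representation_scale ordered_basis_def mult.commute)

section \<open>Multiply warped products\<close>

text \<open>A base \<open>S\<close> and two fibres whose metrics are scaled by functions on the base, together with an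
  angle that is a sum of angles of the three factors.\<close>

locale warped_product =
  S: immersed_manifold S \<phi> + N1: immersed_manifold N1 \<psi>1 + N2: immersed_manifold N2 \<psi>2 +
  N: product_manifold N1 N2 + P: product_manifold S "N1 \<times>\<^sub>M N2" +
  P: immersed_manifold "S \<times>\<^sub>M N1 \<times>\<^sub>M N2" \<Phi>
  for S :: "('s::t2_space, 'e::real_normed_vector) manifold" and \<phi> :: "'s \<Rightarrow> 'u::euclidean_space"
    and N1 :: "('x::t2_space, 'f1::real_normed_vector) manifold" and \<psi>1 :: "'x \<Rightarrow> 'v::euclidean_space"
    and N2 :: "('y::t2_space, 'f2::real_normed_vector) manifold" and \<psi>2 :: "'y \<Rightarrow> 'w::euclidean_space"
    and \<Phi> :: "'s \<times> 'x \<times> 'y \<Rightarrow> 'z::euclidean_space" +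
  fixes r1 r2 :: "'s \<Rightarrow> real" and G :: "'s \<Rightarrow> angle" and \<beta>1 :: "'x \<Rightarrow> angle" and \<beta>2 :: "'y \<Rightarrow> angle"
    and \<beta> :: "'s \<times> 'x \<times> 'y \<Rightarrow> angle" and k :: real
  assumes r1_pos: "r1 p > 0" and r2_pos: "r2 p > 0"
    and r1_smooth: "msmooth_on S UNIV r1" and r2_smooth: "msmooth_on S UNIV r2"
    and metric: "P.g (p, x, y) (a, b, c) (a', b', c') =
      S.g p a a' + (r1 p)\<^sup>2 * N1.g x b b' + (r2 p)\<^sup>2 * N2.g y c c'"
    and G: "smooth_angle S G" and \<beta>1: "smooth_angle N1 \<beta>1" and \<beta>2: "smooth_angle N2 \<beta>2"
    and \<beta>: "\<beta> (p, x, y) = angle_of k + G p + \<beta>1 x + \<beta>2 y"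
begin

abbreviation "P \<equiv> S \<times>\<^sub>M N1 \<times>\<^sub>M N2"
abbreviation "V0 \<equiv> grad_angle S S.g G"
abbreviation "V1 \<equiv> grad_angle N1 N1.g \<beta>1"
abbreviation "V2 \<equiv> grad_angle N2 N2.g \<beta>2"
abbreviation "V \<equiv> grad_angle P P.g \<beta>"
abbreviation "s1 \<equiv> \<lambda>p. 1 / (r1 p)\<^sup>2"
abbreviation "s2 \<equiv> \<lambda>p. 1 / (r2 p)\<^sup>2"

lemma angle_lift_sum:
  obtains W b where "open W" "(p, x, y) \<in> W" "msmooth_on P W b" "\<And>q. q \<in> W \<Longrightarrow> angle_of (b q) = \<beta> q"
    "\<And>a b' c. mderiv P b (p, x, y) (a, b', c) =
      mderiv_angle S G p a + mderiv_angle N1 \<beta>1 x b' + mderiv_angle N2 \<beta>2 y c"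
proof -
  obtain W0 b0 where 0: "open W0" "p \<in> W0" "msmooth_on S W0 b0" "\<And>q. q \<in> W0 \<Longrightarrow> angle_of (b0 q) = G q"
    "mderiv_angle S G p = mderiv S b0 p"
    by (rule S.smooth_angle_lift[OF G, of p]) (rule that)
  obtain W1 b1 where 1: "open W1" "x \<in> W1" "msmooth_on N1 W1 b1" "\<And>q. q \<in> W1 \<Longrightarrow> angle_of (b1 q) = \<beta>1 q"
    "mderiv_angle N1 \<beta>1 x = mderiv N1 b1 x"
    by (rule N1.smooth_angle_lift[OF \<beta>1, of x]) (rule that)
  obtain W2 b2 where 2: "open W2" "y \<in> W2" "msmooth_on N2 W2 b2" "\<And>q. q \<in> W2 \<Longrightarrow> angle_of (b2 q) = \<beta>2 q"
    "mderiv_angle N2 \<beta>2 y = mderiv N2 b2 y"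
    by (rule N2.smooth_angle_lift[OF \<beta>2, of y]) (rule that)
  let ?W = "W0 \<times> W1 \<times> W2"
  let ?h = "\<lambda>q. b1 (fst q) + b2 (snd q)"
  let ?kb = "\<lambda>p. k + b0 p"
  have W12: "open (W1 \<times> W2)"
    by (intro open_Times 1 2)
  have kS: "msmooth_on S W0 (\<lambda>_. k)"
    by (simp add: msmooth_on_def comp_def smooth_on_const)
  have b0: "msmooth_on S W0 ?kb"
    by (rule S.msmooth_on_add[OF 0(1) kS 0(3)])
  have h: "msmooth_on (N1 \<times>\<^sub>M N2) (W1 \<times> W2) ?h"
    by (rule N.msmooth_on_add[OF W12 N.msmooth_on_fst[OF 1(1) 2(1) 1(3)] N.msmooth_on_snd[OF 1(1) 2(1) 2(3)]])
  let ?b = "\<lambda>q. ?kb (fst q) + ?h (snd q)"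
  show thesis
  proof (rule that)
    show "open ?W" "(p, x, y) \<in> ?W"
      using 0 1 2 by (auto intro: open_Times)
    show "msmooth_on P ?W ?b"
      by (rule P.msmooth_on_add[OF open_Times[OF 0(1) W12] P.msmooth_on_fst[OF 0(1) W12 b0] P.msmooth_on_snd[OF 0(1) W12 h]])
    show "angle_of (?b q) = \<beta> q" if "q \<in> ?W" for q
      using that 0(4) 1(4) 2(4) by (cases q) (auto simp: angle_of_add \<beta> add.assoc)
    fix a b' c
    have "mderiv P ?b (p, x, y) (a, b', c) = mderiv S ?kb p a + mderiv (N1 \<times>\<^sub>M N2) ?h (x, y) (b', c)"
      using P.mderiv_add[OF P.msmooth_on_fst[OF 0(1) W12 b0] P.msmooth_on_snd[OF 0(1) W12 h], of "(p, x, y)" "(a, b', c)"]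
        P.mderiv_fst[OF b0 0(2), of "(x, y)"] P.mderiv_snd[OF h, of "(x, y)" p] 0(2) 1(2) 2(2) by simp
    also have "mderiv S ?kb p a = mderiv S b0 p a"
      using S.mderiv_add[OF kS 0(3,2), of a] by (simp add: mderiv_def[of S "\<lambda>_. k"] comp_def)
    also have "mderiv (N1 \<times>\<^sub>M N2) ?h (x, y) (b', c) = mderiv N1 b1 x b' + mderiv N2 b2 y c"
      using N.mderiv_add[OF N.msmooth_on_fst[OF 1(1) 2(1) 1(3)] N.msmooth_on_snd[OF 1(1) 2(1) 2(3)], of "(x, y)" "(b', c)"]
        N.mderiv_fst[OF 1(3,2), of y] N.mderiv_snd[OF 2(3,2), of x] 1(2) 2(2) by simp
    finally show "mderiv P ?b (p, x, y) (a, b', c) =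
        mderiv_angle S G p a + mderiv_angle N1 \<beta>1 x b' + mderiv_angle N2 \<beta>2 y c"
      by (simp add: 0(5) 1(5) 2(5))
  qed
qed

lemma smooth_angle_product: "smooth_angle P \<beta>"
  unfolding smooth_angle_def
proof
  fix q :: "'s \<times> 'x \<times> 'y"
  obtain p x y where q: "q = (p, x, y)"
    by (metis prod.collapse)
  show "\<exists>W b. open W \<and> q \<in> W \<and> msmooth_on P W b \<and> (\<forall>y\<in>W. angle_of (b y) = \<beta> y)"
    unfolding q by (rule angle_lift_sum[of p x y]) blast
qed

lemma mderiv_angle_product:
  "mderiv_angle P \<beta> (p, x, y) (a, b, c) =
    mderiv_angle S G p a + mderiv_angle N1 \<beta>1 x b + mderiv_angle N2 \<beta>2 y c"
  by (rule angle_lift_sum[of p x y]) (simp add: P.mderiv_angle_eq)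

lemma gradient: "V (p, x, y) = (V0 p, s1 p *\<^sub>R V1 x, s2 p *\<^sub>R V2 y)"
proof -
  have "P.g (p, x, y) (V0 p, s1 p *\<^sub>R V1 x, s2 p *\<^sub>R V2 y) q = mderiv_angle P \<beta> (p, x, y) q" for q
  proof -
    obtain a b c where q: "q = (a, b, c)" by (metis prod.collapse)
    show ?thesis
      using r1_pos[of p] r2_pos[of p]
      by (simp add: q metric mderiv_angle_product S.grad_angle_inner[OF G] N1.grad_angle_inner[OF \<beta>1]
          N2.grad_angle_inner[OF \<beta>2] linear_cmul[OF N1.metric_linear(2)] linear_cmul[OF N2.metric_linear(2)])
  qed
  thus ?thesis
    unfolding grad_angle_def by (rule P.sharp_eqI)
qed

lemma coord_field_triple:
  assumes "c0 \<in> atlas S" "p \<in> fst c0" "c1 \<in> atlas N1" "x \<in> fst c1" "c2 \<in> atlas N2" "y \<in> fst c2"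
  shows "coord_field P (prod_chart c0 (prod_chart c1 c2)) (a, b, c) (p, x, y) =
    (coord_field S c0 a p, coord_field N1 c1 b x, coord_field N2 c2 c y)"
proof -
  have "prod_chart c1 c2 \<in> atlas (N1 \<times>\<^sub>M N2)" "(x, y) \<in> fst (prod_chart c1 c2)"
    using assms by (auto simp: atlas_mprod simp del: split_paired_Ex)
  from P.coord_field_prod_chart[OF assms(1,2) this] show ?thesis
    using N.coord_field_prod_chart[OF assms(3-6)] by simp
qed

lemma s1_smooth: "msmooth_on S UNIV s1" and s2_smooth: "msmooth_on S UNIV s2"
proof -
  have "msmooth_on S UNIV (\<lambda>p. 1 / (r p)\<^sup>2)" if r: "msmooth_on S UNIV r" "\<And>p. r p > 0" for r :: "'s \<Rightarrow> real"
    unfolding msmooth_on_def comp_def divide_inverse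
    by (intro ballI smooth_on_bilinear[OF _ bounded_bilinear_mult] smooth_on_const smooth_on_inverse
        smooth_on_power S.open_chart_image open_UNIV S.msmooth_onD[OF r(1), unfolded comp_def])
       (use r(2) in \<open>auto simp: less_imp_neq[THEN not_sym]\<close>)
  thus "msmooth_on S UNIV s1" "msmooth_on S UNIV s2"
    using r1_smooth r2_smooth r1_pos r2_pos by auto
qed

lemma mderiv_inverse_square:
  fixes r :: "'s \<Rightarrow> real"
  assumes r: "msmooth_on S UNIV r" "\<And>p. r p > 0"
  shows "mderiv S (\<lambda>p. (r p)\<^sup>2) p v = 2 * r p * mderiv S r p v"
    and "mderiv S (\<lambda>p. 1 / (r p)\<^sup>2) p v = - 2 / (r p) ^ 3 * mderiv S r p v"
proof -
  let ?c = "chart_at S p"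
  let ?u = "snd ?c p"
  note d = S.mderiv_has_derivative[OF r(1) UNIV_I, of p, unfolded comp_def]
  have p: "chart_inv ?c ?u = p"
    by (rule S.chart_inv_chart[OF S.chart_at_atlas S.chart_at_mem])
  have "((\<lambda>u. (r (chart_inv ?c u))\<^sup>2) has_derivative (\<lambda>v. 2 * r p * mderiv S r p v)) (at ?u)"
    by (rule derivative_eq_intros d refl)+ (simp add: p mult_ac)
  from frechet_derivative_at[OF this] show "mderiv S (\<lambda>p. (r p)\<^sup>2) p v = 2 * r p * mderiv S r p v"
    unfolding mderiv_def[of S "\<lambda>p. (r p)\<^sup>2"] comp_def by metis
  have "((\<lambda>u. 1 / (r (chart_inv ?c u))\<^sup>2) has_derivative (\<lambda>v. - 2 / (r p) ^ 3 * mderiv S r p v)) (at ?u)"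
    by (rule derivative_eq_intros d refl)+
       (use r(2)[of p] in \<open>auto simp: p field_simps power2_eq_square power3_eq_cube\<close>)
  from frechet_derivative_at[OF this] show "mderiv S (\<lambda>p. 1 / (r p)\<^sup>2) p v = - 2 / (r p) ^ 3 * mderiv S r p v"
    unfolding mderiv_def[of S "\<lambda>p. 1 / (r p)\<^sup>2"] comp_def by metis
qed

text \<open>The next two lemmas prepare the Hessian of the product: in a product chart the metric and the
  gradient are combinations of functions of one block of coordinates each, so that their derivatives
  follow from the product rule.\<close>

lemma frechet_warped_metric:
  assumes "c0 = chart_at S p" "c1 = chart_at N1 x" "c2 = chart_at N2 y"
  defines "u0 \<equiv> snd c0 p" and "u1 \<equiv> snd c1 x" and "u2 \<equiv> snd c2 y"
  shows "frechet_derivative (\<lambda>u. P.chart_metric (chart_at P (p, x, y)) u (a, b, c) (a', b', c'))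
      (at (u0, u1, u2)) (v0, v1, v2) =
    frechet_derivative (\<lambda>u. S.chart_metric c0 u a a') (at u0) v0 +
    (2 * r1 p * mderiv S r1 p v0 * N1.g x b b' +
      (r1 p)\<^sup>2 * frechet_derivative (\<lambda>u. N1.chart_metric c1 u b b') (at u1) v1) +
    (2 * r2 p * mderiv S r2 p v0 * N2.g y c c' +
      (r2 p)\<^sup>2 * frechet_derivative (\<lambda>u. N2.chart_metric c2 u c c') (at u2) v2)"
proof -
  have c: "c0 \<in> atlas S" "p \<in> fst c0" "c1 \<in> atlas N1" "x \<in> fst c1" "c2 \<in> atlas N2" "y \<in> fst c2"
    using assms(1-3) by (auto simp: S.chart_at_atlas S.chart_at_mem N1.chart_at_atlas N1.chart_at_mem
      N2.chart_at_atlas N2.chart_at_mem)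
  have cP: "chart_at P (p, x, y) = prod_chart c0 (prod_chart c1 c2)"
    by (simp add: chart_at_mprod assms(1-3))
  let ?T = "(snd c0 ` fst c0) \<times> (snd c1 ` fst c1) \<times> (snd c2 ` fst c2)"
  have T: "open ?T" "(u0, u1, u2) \<in> ?T"
    using c by (auto intro!: open_Times S.chart_image_open N1.chart_image_open N2.chart_image_open
        simp: u0_def u1_def u2_def)
  let ?h = "\<lambda>u. S.chart_metric c0 (fst u) a a' +
    (r1 (chart_inv c0 (fst u)))\<^sup>2 * N1.chart_metric c1 (fst (snd u)) b b' +
    (r2 (chart_inv c0 (fst u)))\<^sup>2 * N2.chart_metric c2 (snd (snd u)) c c'"
  have "P.chart_metric (prod_chart c0 (prod_chart c1 c2)) u (a, b, c) (a', b', c') = ?h u"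
    if "u \<in> ?T" for u
  proof -
    from that obtain p' x' y' where u: "u = (snd c0 p', snd c1 x', snd c2 y')"
      and q: "p' \<in> fst c0" "x' \<in> fst c1" "y' \<in> fst c2"
      by auto
    have cQ: "prod_chart c0 (prod_chart c1 c2) \<in> atlas P" "(p', x', y') \<in> fst (prod_chart c0 (prod_chart c1 c2))"
      using c q by (auto simp: atlas_mprod simp del: split_paired_Ex)
    have u': "u = snd (prod_chart c0 (prod_chart c1 c2)) (p', x', y')"
      by (simp add: u)
    show ?thesis
      unfolding u' P.chart_metric_eq[OF cQ]
        coord_field_triple[OF c(1) q(1) c(3) q(2) c(5) q(3)] metric
      by (simp add: S.chart_metric_eq[OF c(1) q(1)] N1.chart_metric_eq[OF c(3) q(2)]
          N2.chart_metric_eq[OF c(5) q(3)] S.chart_inv_chart[OF c(1) q(1)])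
  qed
  hence eq: "frechet_derivative (\<lambda>u. P.chart_metric (chart_at P (p, x, y)) u (a, b, c) (a', b', c')) (at (u0, u1, u2)) =
      frechet_derivative ?h (at (u0, u1, u2))"
    unfolding cP by (rule frechet_derivative_cong_open[OF T])
  have bf: "bounded_linear (\<lambda>u :: 'e \<times> 'f1 \<times> 'f2. fst (snd u))" "bounded_linear (\<lambda>u :: 'e \<times> 'f1 \<times> 'f2. snd (snd u))"
    by (intro bounded_linear_compose[OF bounded_linear_fst bounded_linear_snd]
        bounded_linear_compose[OF bounded_linear_snd bounded_linear_snd])+
  have S': "((\<lambda>u. S.chart_metric c0 (fst u) a a') has_derivative
      (\<lambda>v. frechet_derivative (\<lambda>u. S.chart_metric c0 u a a') (at u0) (fst v))) (at (u0, u1, u2))"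
    by (rule has_derivative_compose[OF bounded_linear_imp_has_derivative[OF bounded_linear_fst]])
       (use S.differentiable_chart_metric[OF c(1,2)] in \<open>simp add: u0_def\<close>)
  have N1': "((\<lambda>u. N1.chart_metric c1 (fst (snd u)) b b') has_derivative
      (\<lambda>v. frechet_derivative (\<lambda>u. N1.chart_metric c1 u b b') (at u1) (fst (snd v)))) (at (u0, u1, u2))"
    by (rule has_derivative_compose[OF bounded_linear_imp_has_derivative[OF bf(1)]])
       (use N1.differentiable_chart_metric[OF c(3,4)] in \<open>simp add: u1_def\<close>)
  have N2': "((\<lambda>u. N2.chart_metric c2 (snd (snd u)) c c') has_derivative
      (\<lambda>v. frechet_derivative (\<lambda>u. N2.chart_metric c2 u c c') (at u2) (snd (snd v)))) (at (u0, u1, u2))"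
    by (rule has_derivative_compose[OF bounded_linear_imp_has_derivative[OF bf(2)]])
       (use N2.differentiable_chart_metric[OF c(5,6)] in \<open>simp add: u2_def\<close>)
  have r': "((\<lambda>u. r (chart_inv c0 (fst u))) has_derivative (\<lambda>v. mderiv S r p (fst v))) (at (u0, u1, u2))"
    if "msmooth_on S UNIV r" for r :: "'s \<Rightarrow> real"
    by (rule has_derivative_compose[OF bounded_linear_imp_has_derivative[OF bounded_linear_fst]])
       (use S.mderiv_has_derivative[OF that UNIV_I, of p] in \<open>simp add: u0_def assms(1) comp_def\<close>)
  have at: "chart_inv c0 u0 = p" "N1.chart_metric c1 u1 b b' = N1.g x b b'" "N2.chart_metric c2 u2 c c' = N2.g y c c'"
    by (simp_all add: u0_def u1_def u2_def S.chart_inv_chart[OF c(1,2)] assms(2,3) N1.metric_at N2.metric_at)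
  have "(?h has_derivative (\<lambda>v. frechet_derivative (\<lambda>u. S.chart_metric c0 u a a') (at u0) (fst v) +
    (2 * r1 p * mderiv S r1 p (fst v) * N1.g x b b' +
      (r1 p)\<^sup>2 * frechet_derivative (\<lambda>u. N1.chart_metric c1 u b b') (at u1) (fst (snd v))) +
    (2 * r2 p * mderiv S r2 p (fst v) * N2.g y c c' +
      (r2 p)\<^sup>2 * frechet_derivative (\<lambda>u. N2.chart_metric c2 u c c') (at u2) (snd (snd v))))) (at (u0, u1, u2))"
    by (rule derivative_eq_intros S' N1' N2' r'[OF r1_smooth] r'[OF r2_smooth] refl)+
       (simp add: at fun_eq_iff)
  from frechet_derivative_at[OF this, symmetric] show ?thesis
    unfolding eq by simp
qed

lemma frechet_warped_gradient:
  assumes "c0 = chart_at S p" "c1 = chart_at N1 x" "c2 = chart_at N2 y"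
  defines "u0 \<equiv> snd c0 p" and "u1 \<equiv> snd c1 x" and "u2 \<equiv> snd c2 y"
  shows "frechet_derivative (field_in_chart P (chart_at P (p, x, y)) V) (at (u0, u1, u2)) (a, b, c) =
    (frechet_derivative (field_in_chart S c0 V0) (at u0) a,
     mderiv S s1 p a *\<^sub>R V1 x + s1 p *\<^sub>R frechet_derivative (field_in_chart N1 c1 V1) (at u1) b,
     mderiv S s2 p a *\<^sub>R V2 y + s2 p *\<^sub>R frechet_derivative (field_in_chart N2 c2 V2) (at u2) c)"
proof -
  have c: "c0 \<in> atlas S" "p \<in> fst c0" "c1 \<in> atlas N1" "x \<in> fst c1" "c2 \<in> atlas N2" "y \<in> fst c2"
    using assms(1-3) by (auto simp: S.chart_at_atlas S.chart_at_mem N1.chart_at_atlas N1.chart_at_mem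
      N2.chart_at_atlas N2.chart_at_mem)
  have cP: "chart_at P (p, x, y) = prod_chart c0 (prod_chart c1 c2)"
    by (simp add: chart_at_mprod assms(1-3))
  let ?T = "(snd c0 ` fst c0) \<times> (snd c1 ` fst c1) \<times> (snd c2 ` fst c2)"
  have T: "open ?T" "(u0, u1, u2) \<in> ?T"
    using c by (auto intro!: open_Times S.chart_image_open N1.chart_image_open N2.chart_image_open
        simp: u0_def u1_def u2_def)
  let ?h = "\<lambda>u. (field_in_chart S c0 V0 (fst u),
    s1 (chart_inv c0 (fst u)) *\<^sub>R field_in_chart N1 c1 V1 (fst (snd u)),
    s2 (chart_inv c0 (fst u)) *\<^sub>R field_in_chart N2 c2 V2 (snd (snd u)))"
  have "field_in_chart P (prod_chart c0 (prod_chart c1 c2)) V u = ?h u" if "u \<in> ?T" for u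
  proof -
    from that obtain p' x' y' where u: "u = (snd c0 p', snd c1 x', snd c2 y')"
      and q: "p' \<in> fst c0" "x' \<in> fst c1" "y' \<in> fst c2"
      by auto
    have c12: "prod_chart c1 c2 \<in> atlas (N1 \<times>\<^sub>M N2)" "(x', y') \<in> fst (prod_chart c1 c2)"
      using c q by (auto simp: atlas_mprod simp del: split_paired_Ex)
    have cQ: "prod_chart c0 (prod_chart c1 c2) \<in> atlas P" "(p', x', y') \<in> fst (prod_chart c0 (prod_chart c1 c2))"
      using c q c12 by (auto simp: atlas_mprod[of S] simp del: split_paired_Ex)
    have u': "u = snd (prod_chart c0 (prod_chart c1 c2)) (p', x', y')"
      by (simp add: u)
    show ?thesis
      unfolding u' P.field_in_chart_eq[OF cQ] P.mderiv_prod_chart[OF c(1) q(1) c12] gradient fst_conv snd_conv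
        N.mderiv_prod_chart[OF c(3) q(2) c(5) q(3)]
      by (simp add: S.field_in_chart_eq[OF c(1) q(1)] N1.field_in_chart_eq[OF c(3) q(2)]
          N2.field_in_chart_eq[OF c(5) q(3)] S.chart_inv_chart[OF c(1) q(1)]
          linear_cmul[OF N1.linear_mderiv[OF N1.msmooth_on_chart[OF c(3)] q(2)]]
          linear_cmul[OF N2.linear_mderiv[OF N2.msmooth_on_chart[OF c(5)] q(3)]])
  qed
  hence eq: "frechet_derivative (field_in_chart P (chart_at P (p, x, y)) V) (at (u0, u1, u2)) =
      frechet_derivative ?h (at (u0, u1, u2))"
    unfolding cP by (rule frechet_derivative_cong_open[OF T])
  have bf: "bounded_linear (\<lambda>u :: 'e \<times> 'f1 \<times> 'f2. fst (snd u))" "bounded_linear (\<lambda>u :: 'e \<times> 'f1 \<times> 'f2. snd (snd u))"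
    by (intro bounded_linear_compose[OF bounded_linear_fst bounded_linear_snd]
        bounded_linear_compose[OF bounded_linear_snd bounded_linear_snd])+
  have S': "((\<lambda>u. field_in_chart S c0 V0 (fst u)) has_derivative
      (\<lambda>v. frechet_derivative (field_in_chart S c0 V0) (at u0) (fst v))) (at (u0, u1, u2))"
    by (rule has_derivative_compose[OF bounded_linear_imp_has_derivative[OF bounded_linear_fst]])
       (use S.differentiable_field_in_chart[OF S.smooth_grad_angle[OF G] c(1,2)] in \<open>simp add: u0_def\<close>)
  have N1': "((\<lambda>u. field_in_chart N1 c1 V1 (fst (snd u))) has_derivative
      (\<lambda>v. frechet_derivative (field_in_chart N1 c1 V1) (at u1) (fst (snd v)))) (at (u0, u1, u2))"
    by (rule has_derivative_compose[OF bounded_linear_imp_has_derivative[OF bf(1)]])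
       (use N1.differentiable_field_in_chart[OF N1.smooth_grad_angle[OF \<beta>1] c(3,4)] in \<open>simp add: u1_def\<close>)
  have N2': "((\<lambda>u. field_in_chart N2 c2 V2 (snd (snd u))) has_derivative
      (\<lambda>v. frechet_derivative (field_in_chart N2 c2 V2) (at u2) (snd (snd v)))) (at (u0, u1, u2))"
    by (rule has_derivative_compose[OF bounded_linear_imp_has_derivative[OF bf(2)]])
       (use N2.differentiable_field_in_chart[OF N2.smooth_grad_angle[OF \<beta>2] c(5,6)] in \<open>simp add: u2_def\<close>)
  have s': "((\<lambda>u. h (chart_inv c0 (fst u))) has_derivative (\<lambda>v. mderiv S h p (fst v))) (at (u0, u1, u2))"
    if "msmooth_on S UNIV h" for h :: "'s \<Rightarrow> real"
    by (rule has_derivative_compose[OF bounded_linear_imp_has_derivative[OF bounded_linear_fst]])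
       (use S.mderiv_has_derivative[OF that UNIV_I, of p] in \<open>simp add: u0_def assms(1) comp_def\<close>)
  have at: "chart_inv c0 u0 = p" "field_in_chart N1 c1 V1 u1 = V1 x" "field_in_chart N2 c2 V2 u2 = V2 y"
    by (simp_all add: u0_def u1_def u2_def S.chart_inv_chart[OF c(1,2)] assms(2,3) N1.field_in_chart_at N2.field_in_chart_at)
  have "(?h has_derivative (\<lambda>v. (frechet_derivative (field_in_chart S c0 V0) (at u0) (fst v),
     s1 p *\<^sub>R frechet_derivative (field_in_chart N1 c1 V1) (at u1) (fst (snd v)) + mderiv S s1 p (fst v) *\<^sub>R V1 x,
     s2 p *\<^sub>R frechet_derivative (field_in_chart N2 c2 V2) (at u2) (snd (snd v)) + mderiv S s2 p (fst v) *\<^sub>R V2 y)))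
     (at (u0, u1, u2))"
    using has_derivative_Pair[OF S' has_derivative_Pair[OF
        has_derivative_scaleR[OF s'[OF s1_smooth] N1'] has_derivative_scaleR[OF s'[OF s2_smooth] N2']]]
    by (simp add: at)
  from frechet_derivative_at[OF this, symmetric] show ?thesis
    unfolding eq by (simp add: add.commute)
qed

text \<open>All cross terms of the Koszul formula come from the derivatives of the two warping functions;
  by \<open>d(r\<^sup>2) = - r\<^sup>4 d(r\<^sup>-\<^sup>2)\<close> they can be written with the gradient of \<open>r\<^sup>-\<^sup>2\<close>.\<close>

lemma covariant_derivative_warped:
  assumes D: "levi_civita S S.g D" and D1: "levi_civita N1 N1.g D1" and D2: "levi_civita N2 N2.g D2"
    and DP: "levi_civita P P.g DP"
  shows "DP (p, x, y) (a, b, c) V =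
    (D p a V0 + ((r1 p)\<^sup>2 / 2 * mderiv_angle N1 \<beta>1 x b) *\<^sub>R grad S S.g s1 p
        + ((r2 p)\<^sup>2 / 2 * mderiv_angle N2 \<beta>2 y c) *\<^sub>R grad S S.g s2 p,
     (1 / 2 * mderiv S s1 p a) *\<^sub>R V1 x + (s1 p *\<^sub>R D1 x b V1
        - ((r1 p)\<^sup>2 / 2 * S.g p (V0 p) (grad S S.g s1 p)) *\<^sub>R b),
     (1 / 2 * mderiv S s2 p a) *\<^sub>R V2 y + (s2 p *\<^sub>R D2 y c V2
        - ((r2 p)\<^sup>2 / 2 * S.g p (V0 p) (grad S S.g s2 p)) *\<^sub>R c))" (is "_ = ?R")
proof (rule P.metric_nondegenerate)
  fix q :: "'e \<times> 'f1 \<times> 'f2"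
  obtain a' b' c' where q: "q = (a', b', c')" by (metis prod.collapse)
  let ?c0 = "chart_at S p" and ?c1 = "chart_at N1 x" and ?c2 = "chart_at N2 y"
  let ?u0 = "snd ?c0 p" and ?u1 = "snd ?c1 x" and ?u2 = "snd ?c2 y"
  note mP = P.covariant_derivative_gradient[OF DP smooth_angle_product, of "(p, x, y)" "(a, b, c)" "(a', b', c')"]
  have uP: "snd (chart_at P (p, x, y)) (p, x, y) = (?u0, ?u1, ?u2)"
    by (simp add: chart_at_mprod)
  note m0 = S.covariant_derivative_gradient[OF D G, of p a a']
  note m1 = N1.covariant_derivative_gradient[OF D1 \<beta>1, of x b b']
  note m2 = N2.covariant_derivative_gradient[OF D2 \<beta>2, of y c c']
  note lin = linear_add[OF S.metric_linear(2)] linear_cmul[OF S.metric_linear(2)]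
    linear_add[OF N1.metric_linear(2)] linear_cmul[OF N1.metric_linear(2)] linear_diff[OF N1.metric_linear(2)]
    linear_add[OF N2.metric_linear(2)] linear_cmul[OF N2.metric_linear(2)] linear_diff[OF N2.metric_linear(2)]
  note lin' = linear_add[OF N1.metric_linear(1)] linear_cmul[OF N1.metric_linear(1)]
    linear_add[OF N2.metric_linear(1)] linear_cmul[OF N2.metric_linear(1)]
  have L1: "linear (frechet_derivative (\<lambda>u. N1.chart_metric ?c1 u b b') (at ?u1))"
    by (rule bounded_linear.linear[OF has_derivative_bounded_linear[OF
        N1.differentiable_chart_metric[OF N1.chart_at_atlas N1.chart_at_mem]]])
  have L2: "linear (frechet_derivative (\<lambda>u. N2.chart_metric ?c2 u c c') (at ?u2))"
    by (rule bounded_linear.linear[OF has_derivative_bounded_linear[OF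
        N2.differentiable_chart_metric[OF N2.chart_at_atlas N2.chart_at_mem]]])
  have pos: "r1 p \<noteq> 0" "r2 p \<noteq> 0"
    using r1_pos[of p] r2_pos[of p] by auto
  define E0 E1 E2 where "E0 = S.g p (D p a V0) a'" and "E1 = N1.g x (D1 x b V1) b'" and "E2 = N2.g y (D2 y c V2) c'"
  define m where "m = (\<lambda>v. mderiv S r1 p v)"
  define n where "n = (\<lambda>v. mderiv S r2 p v)"
  define A1 B1 C1 A2 B2 C2 where "A1 = N1.g x (V1 x) b'" and "B1 = N1.g x b (V1 x)" and "C1 = N1.g x b b'"
    and "A2 = N2.g y (V2 y) c'" and "B2 = N2.g y c (V2 y)" and "C2 = N2.g y c c'"
  have ds: "mderiv S s1 p v = - 2 / (r1 p) ^ 3 * m v" "mderiv S s2 p v = - 2 / (r2 p) ^ 3 * n v" for v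
    unfolding m_def n_def by (rule mderiv_inverse_square[OF r1_smooth r1_pos] mderiv_inverse_square[OF r2_smooth r2_pos])+
  have "2 * P.g (p, x, y) (DP (p, x, y) (a, b, c) V) (a', b', c') =
     2 * E0 + (2 * r1 p * m (V0 p) * C1 + 2 * E1 + (r1 p)\<^sup>2 * mderiv S s1 p a * A1 + (r1 p)\<^sup>2 * mderiv S s1 p a' * B1)
       + (2 * r2 p * n (V0 p) * C2 + 2 * E2 + (r2 p)\<^sup>2 * mderiv S s2 p a * A2 + (r2 p)\<^sup>2 * mderiv S s2 p a' * B2)"
    unfolding mP uP gradient frechet_warped_metric[OF refl refl refl] frechet_warped_gradient[OF refl refl refl]
      metric lin lin' linear_cmul[OF L1] linear_cmul[OF L2] E0_def E1_def E2_def m0 m1 m2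
    using pos by (simp add: A1_def B1_def C1_def A2_def B2_def C2_def m_def n_def field_simps)
  also have "\<dots> = 2 * P.g (p, x, y) ?R (a', b', c')"
  proof -
    have gs: "S.g p (grad S S.g s1 p) v = mderiv S s1 p v" "S.g p (grad S S.g s2 p) v = mderiv S s2 p v" for v
      by (rule S.grad_inner[OF s1_smooth] S.grad_inner[OF s2_smooth])+
    have gs': "S.g p (V0 p) (grad S S.g s1 p) = mderiv S s1 p (V0 p)" "S.g p (V0 p) (grad S S.g s2 p) = mderiv S s2 p (V0 p)"
      using gs[of "V0 p"] by (simp_all add: S.metric_commute)
    have db: "mderiv_angle N1 \<beta>1 x b = B1" "mderiv_angle N2 \<beta>2 y c = B2"
      using N1.grad_angle_inner[OF \<beta>1, of x b] N2.grad_angle_inner[OF \<beta>2, of y c]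
      by (simp_all add: B1_def B2_def N1.metric_commute N2.metric_commute)
    show ?thesis
      unfolding metric lin gs gs' db E0_def[symmetric] E1_def[symmetric] E2_def[symmetric]
        A1_def[symmetric] A2_def[symmetric] C1_def[symmetric] C2_def[symmetric] ds
      using pos by (simp add: field_simps power2_eq_square power3_eq_cube)
  qed
  finally show "P.g (p, x, y) (DP (p, x, y) (a, b, c) V) q = P.g (p, x, y) ?R q"
    by (simp add: q)
qed

text \<open>On a fibre of dimension \<open>m\<close> the multiple of the identity in the covariant derivative has the trace
  \<open>- m r\<^sup>2/2 d(r\<^sup>-\<^sup>2)(V\<^sub>0) = m d(log r)(V\<^sub>0)\<close>, and the sum over both fibres is \<open>dh(V\<^sub>0)/h\<close> for the weight
  \<open>h = r\<^sub>1\<^sup>m r\<^sub>2\<^sup>n\<close>, with \<open>m\<close> and \<open>n\<close> the dimensions of the fibres.\<close>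

lemma laplacian_warped:
  assumes D: "levi_civita S S.g D" and D1: "levi_civita N1 N1.g D1" and D2: "levi_civita N2 N2.g D2"
    and DP: "levi_civita P P.g DP"
  shows "laplacian_angle P P.g DP \<beta> (p, x, y) =
    1 / (r1 p ^ mdim N1 * r2 p ^ mdim N2) *
      mdiv S D (\<lambda>q. (r1 q ^ mdim N1 * r2 q ^ mdim N2) *\<^sub>R V0 q) p
    + laplacian_angle N1 N1.g D1 \<beta>1 x / (r1 p)\<^sup>2 + laplacian_angle N2 N2.g D2 \<beta>2 y / (r2 p)\<^sup>2"
proof -
  note cov = covariant_derivative_warped[OF D D1 D2 DP]
  have pos: "r1 p > 0" "r2 p > 0"
    by (rule r1_pos r2_pos)+
  have gV: "S.g p (V0 p) (grad S S.g s1 p) = mderiv S s1 p (V0 p)" "S.g p (V0 p) (grad S S.g s2 p) = mderiv S s2 p (V0 p)"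
    using S.grad_inner[OF s1_smooth, of p "V0 p"] S.grad_inner[OF s2_smooth, of p "V0 p"]
    by (simp_all add: S.metric_commute)
  define m n where "m = mderiv S r1 p (V0 p)" and "n = mderiv S r2 p (V0 p)"
  have ds: "mderiv S s1 p (V0 p) = - 2 / (r1 p) ^ 3 * m" "mderiv S s2 p (V0 p) = - 2 / (r2 p) ^ 3 * n"
    unfolding m_def n_def by (rule mderiv_inverse_square[OF r1_smooth r1_pos] mderiv_inverse_square[OF r2_smooth r2_pos])+
  have zero: "mderiv_angle N1 \<beta>1 x 0 = 0" "mderiv_angle N2 \<beta>2 y 0 = 0" "mderiv S s1 p 0 = 0" "mderiv S s2 p 0 = 0"
    using linear_0[OF N1.linear_mderiv_angle[OF \<beta>1]] linear_0[OF N2.linear_mderiv_angle[OF \<beta>2]]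
      linear_0[OF S.linear_mderiv[OF s1_smooth UNIV_I]] linear_0[OF S.linear_mderiv[OF s2_smooth UNIV_I]] by auto
  have trace_fiber: "basis_trace B (\<lambda>v. s *\<^sub>R L v - t *\<^sub>R v) = s * basis_trace B L - t * real (length B)"
    if "ordered_basis B" for B :: "'b::real_vector list" and L s t
    using basis_trace_add[OF that, of "\<lambda>v. s *\<^sub>R L v" "\<lambda>v. (- t) *\<^sub>R v"]
    by (simp only: basis_trace_scale[OF that] basis_trace_ident[OF that]) simp
  have lap: "laplacian_angle P P.g DP \<beta> (p, x, y) = mdiv S D V0 p +
      (s1 p * laplacian_angle N1 N1.g D1 \<beta>1 x - ((r1 p)\<^sup>2 / 2 * mderiv S s1 p (V0 p)) * real (mdim N1)) +
      (s2 p * laplacian_angle N2 N2.g D2 \<beta>2 y - ((r2 p)\<^sup>2 / 2 * mderiv S s2 p (V0 p)) * real (mdim N2))"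
    unfolding laplacian_angle_def mdiv_def model_frame_mprod
      basis_trace_prod_basis[OF S.frame ordered_basis_prod_basis[OF N1.frame N2.frame]]
      basis_trace_prod_basis[OF N1.frame N2.frame]
    by (simp add: zero_prod_def cov zero gV trace_fiber[OF N1.frame] trace_fiber[OF N2.frame] mdim_def)
  let ?h = "\<lambda>q. r1 q ^ mdim N1 * r2 q ^ mdim N2"
  have hs: "msmooth_on S UNIV ?h"
    unfolding msmooth_on_def comp_def
    by (intro ballI smooth_on_bilinear[OF _ bounded_bilinear_mult] smooth_on_power S.open_chart_image open_UNIV
        S.msmooth_onD[OF r1_smooth, unfolded comp_def] S.msmooth_onD[OF r2_smooth, unfolded comp_def])
  have dh: "mderiv S ?h p (V0 p) = ?h p * (real (mdim N1) * m / r1 p + real (mdim N2) * n / r2 p)"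
  proof -
    let ?c = "chart_at S p"
    have p: "chart_inv ?c (snd ?c p) = p"
      by (rule S.chart_inv_chart[OF S.chart_at_atlas S.chart_at_mem])
    (* For j = 0 the truncated exponent j - 1 does no harm, as the factor j vanishes. *)
    have pw: "real j * z ^ (j - 1) = z ^ j * real j / z" if "z > 0" for j and z :: real
      using that by (cases j) auto
    have "((\<lambda>u. r1 (chart_inv ?c u) ^ mdim N1 * r2 (chart_inv ?c u) ^ mdim N2) has_derivative
       (\<lambda>v. r1 p ^ mdim N1 * (real (mdim N2) * r2 p ^ (mdim N2 - 1) * mderiv S r2 p v) +
         (real (mdim N1) * r1 p ^ (mdim N1 - 1) * mderiv S r1 p v) * r2 p ^ mdim N2)) (at (snd ?c p))"
      by (rule derivative_eq_intros S.mderiv_has_derivative[OF r1_smooth UNIV_I, of p, unfolded comp_def]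
            S.mderiv_has_derivative[OF r2_smooth UNIV_I, of p, unfolded comp_def] refl)+
         (simp add: p fun_eq_iff mult_ac)
    from frechet_derivative_at[OF this, symmetric] show ?thesis
      unfolding mderiv_def[of S ?h] comp_def pw[OF pos(1)] pw[OF pos(2)]
      using pos by (simp add: m_def n_def field_simps)
  qed
  have "mdiv S D (\<lambda>q. ?h q *\<^sub>R V0 q) p = mderiv S ?h p (V0 p) + ?h p * mdiv S D V0 p"
    unfolding mdiv_def levi_civita_scale[OF D S.smooth_grad_angle[OF G] hs]
    by (simp add: basis_trace_add[OF S.frame] basis_trace_scale[OF S.frame]
        basis_trace_rank_one[OF S.frame S.linear_mderiv[OF hs UNIV_I]])
  hence div: "1 / ?h p * mdiv S D (\<lambda>q. ?h q *\<^sub>R V0 q) p =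
      mdiv S D V0 p + (real (mdim N1) * m / r1 p + real (mdim N2) * n / r2 p)"
    unfolding dh using pos by (simp add: field_simps)
  show ?thesis
    unfolding lap div ds using pos by (simp add: field_simps power2_eq_square power3_eq_cube)
qed

end

section \<open>The product of a Lagrangian surface with two Legendrian immersions\<close>

lemma bounded_bilinear_smult: "bounded_bilinear ((*s) :: complex \<Rightarrow> complex ^ 'n \<Rightarrow> complex ^ 'n::finite)"
  unfolding bilinear_conv_bounded_bilinear[symmetric] bilinear_def
  by (auto intro!: linearI simp: Finite_Cartesian_Product.vec_eq_iff algebra_simps)

lemma bounded_linear_cjoin:
  assumes "CARD('k) + CARD('l) = CARD('n)"
  shows "bounded_linear (\<lambda>u. cjoin (fst u :: complex ^ 'k::{finite,linorder})
    (snd u :: complex ^ 'l::{finite,linorder}) :: complex ^ 'n::{finite,linorder})"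
  unfolding linear_conv_bounded_linear[symmetric]
  by (intro linearI) (simp_all add: cjoin_add[OF assms] scaleR_eq_smult cjoin_smult[OF assms])

locale lagrangian_legendrian =
  fixes S :: "('s::{t2_space,second_countable_topology}, 'e::real_normed_vector) manifold"
    and N1 :: "('x::{t2_space,second_countable_topology}, 'f1::real_normed_vector) manifold"
    and N2 :: "('y::{t2_space,second_countable_topology}, 'f2::real_normed_vector) manifold"
    and \<phi>1 \<phi>2 :: "'s \<Rightarrow> complex" and \<phi> :: "'s \<Rightarrow> complex ^ 2"
    and \<psi>1 :: "'x \<Rightarrow> complex ^ 'n1::{finite,linorder}" and \<psi>2 :: "'y \<Rightarrow> complex ^ 'n2::{finite,linorder}"
    and \<Phi> :: "'s \<times> 'x \<times> 'y \<Rightarrow> complex ^ 'n::{finite,linorder}"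
  assumes S: "oriented_manifold S" and N1: "oriented_manifold N1" and N2: "oriented_manifold N2"
    and \<phi>_def: "\<phi> = (\<lambda>p. cvec [\<phi>1 p, \<phi>2 p])"
    and lagrangian: "lagrangian_immersion S \<phi>"
    and nonzero1: "\<phi>1 p \<noteq> 0" and nonzero2: "\<phi>2 p \<noteq> 0"
    and legendrian1: "legendrian_immersion N1 \<psi>1" and legendrian2: "legendrian_immersion N2 \<psi>2"
    and card: "CARD('n1) + CARD('n2) = CARD('n)"
    and \<Phi>_def: "\<Phi> = (\<lambda>(p, x, y). cjoin (\<phi>1 p *s \<psi>1 x) (\<phi>2 p *s \<psi>2 y))"
begin

sublocale S: smooth_manifold S
  by (rule oriented_imp_smooth_manifold[OF S])

sublocale N: product_manifold N1 N2
  by (rule product_manifold.intro) (rule oriented_imp_smooth_manifold N1 N2)+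

sublocale P: product_manifold S "N1 \<times>\<^sub>M N2"
  by (rule product_manifold.intro) unfold_locales

abbreviation "P \<equiv> S \<times>\<^sub>M N1 \<times>\<^sub>M N2"

lemma smooth_\<phi>: "msmooth_on S UNIV \<phi>"
  and smooth_\<psi>1: "msmooth_on N1 UNIV \<psi>1" and smooth_\<psi>2: "msmooth_on N2 UNIV \<psi>2"
  using lagrangian legendrian1 legendrian2
  by (auto simp: lagrangian_immersion_def legendrian_immersion_def immersion_def)

lemma \<phi>_components: "\<phi>1 = (\<lambda>p. \<phi> p $ coord 0)" "\<phi>2 = (\<lambda>p. \<phi> p $ coord 1)"
  by (simp_all add: \<phi>_def cvec_coord)

lemma smooth_\<phi>1: "msmooth_on S UNIV \<phi>1" and smooth_\<phi>2: "msmooth_on S UNIV \<phi>2"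
  unfolding \<phi>_components
  by (rule S.msmooth_on_bounded_linear[OF bounded_linear_vec_nth open_UNIV smooth_\<phi>])+

lemma mderiv_\<phi>: "mderiv S \<phi> p a $ coord 0 = mderiv S \<phi>1 p a" "mderiv S \<phi> p a $ coord 1 = mderiv S \<phi>2 p a"
  unfolding \<phi>_components
  by (rule S.mderiv_bounded_linear[OF bounded_linear_vec_nth smooth_\<phi> UNIV_I, symmetric])+

lemma smooth_factors:
  "msmooth_on P UNIV (\<lambda>q. \<phi>1 (fst q) *s \<psi>1 (fst (snd q)))" (is "msmooth_on P UNIV ?f1")
  "msmooth_on P UNIV (\<lambda>q. \<phi>2 (fst q) *s \<psi>2 (snd (snd q)))" (is "msmooth_on P UNIV ?f2")
  and mderiv_factors:
  "mderiv P (\<lambda>q. \<phi>1 (fst q) *s \<psi>1 (fst (snd q))) (p, x, y) (a, b, c) =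
    \<phi>1 p *s mderiv N1 \<psi>1 x b + mderiv S \<phi>1 p a *s \<psi>1 x"
  "mderiv P (\<lambda>q. \<phi>2 (fst q) *s \<psi>2 (snd (snd q))) (p, x, y) (a, b, c) =
    \<phi>2 p *s mderiv N2 \<psi>2 y c + mderiv S \<phi>2 p a *s \<psi>2 y"
proof -
  have s: "msmooth_on P UNIV (\<lambda>q. \<phi>1 (fst q))" "msmooth_on P UNIV (\<lambda>q. \<phi>2 (fst q))"
    using P.msmooth_on_fst[OF open_UNIV open_UNIV smooth_\<phi>1] P.msmooth_on_fst[OF open_UNIV open_UNIV smooth_\<phi>2]
    by simp_all
  have n: "msmooth_on (N1 \<times>\<^sub>M N2) UNIV (\<lambda>q. \<psi>1 (fst q))" "msmooth_on (N1 \<times>\<^sub>M N2) UNIV (\<lambda>q. \<psi>2 (snd q))"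
    using N.msmooth_on_fst[OF open_UNIV open_UNIV smooth_\<psi>1] N.msmooth_on_snd[OF open_UNIV open_UNIV smooth_\<psi>2]
    by simp_all
  have t: "msmooth_on P UNIV (\<lambda>q. \<psi>1 (fst (snd q)))" "msmooth_on P UNIV (\<lambda>q. \<psi>2 (snd (snd q)))"
    using P.msmooth_on_snd[OF open_UNIV open_UNIV n(1)] P.msmooth_on_snd[OF open_UNIV open_UNIV n(2)] by simp_all
  show "msmooth_on P UNIV ?f1" "msmooth_on P UNIV ?f2"
    by (rule P.msmooth_on_bilinear[OF bounded_bilinear_smult open_UNIV s(1) t(1)]
        P.msmooth_on_bilinear[OF bounded_bilinear_smult open_UNIV s(2) t(2)])+
  show "mderiv P ?f1 (p, x, y) (a, b, c) = \<phi>1 p *s mderiv N1 \<psi>1 x b + mderiv S \<phi>1 p a *s \<psi>1 x"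
    by (simp add: P.mderiv_bilinear[OF bounded_bilinear_smult s(1) t(1) UNIV_I] P.mderiv_fst[OF smooth_\<phi>1 UNIV_I]
        P.mderiv_snd[OF n(1) UNIV_I] N.mderiv_fst[OF smooth_\<psi>1 UNIV_I])
  show "mderiv P ?f2 (p, x, y) (a, b, c) = \<phi>2 p *s mderiv N2 \<psi>2 y c + mderiv S \<phi>2 p a *s \<psi>2 y"
    by (simp add: P.mderiv_bilinear[OF bounded_bilinear_smult s(2) t(2) UNIV_I] P.mderiv_fst[OF smooth_\<phi>2 UNIV_I]
        P.mderiv_snd[OF n(2) UNIV_I] N.mderiv_snd[OF smooth_\<psi>2 UNIV_I])
qed

lemma smooth_\<Phi>: "msmooth_on P UNIV \<Phi>"
  and mderiv_\<Phi>: "mderiv P \<Phi> (p, x, y) (a, b, c) =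
    cjoin (\<phi>1 p *s mderiv N1 \<psi>1 x b + mderiv S \<phi>1 p a *s \<psi>1 x)
      (\<phi>2 p *s mderiv N2 \<psi>2 y c + mderiv S \<phi>2 p a *s \<psi>2 y)"
proof -
  let ?f1 = "\<lambda>q. \<phi>1 (fst q) *s \<psi>1 (fst (snd q))" and ?f2 = "\<lambda>q. \<phi>2 (fst q) *s \<psi>2 (snd (snd q))"
  let ?j = "\<lambda>u :: (complex ^ 'n1::{finite,linorder}) \<times> (complex ^ 'n2::{finite,linorder}). cjoin (fst u) (snd u) :: complex ^ 'n::{finite,linorder}"
  have \<Phi>: "\<Phi> = (\<lambda>q. ?j (?f1 q, 0) + ?j (0, ?f2 q))"
    by (simp add: \<Phi>_def fun_eq_iff cjoin_add[OF card] split: prod.splits)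
  have l1: "bounded_linear (\<lambda>z. ?j (z, 0))" and l2: "bounded_linear (\<lambda>w. ?j (0, w))"
    by (rule bounded_linear_compose[OF bounded_linear_cjoin[OF card]];
        intro bounded_linear_Pair bounded_linear_ident bounded_linear_zero)+
  have s: "msmooth_on P UNIV (\<lambda>q. ?j (?f1 q, 0))" "msmooth_on P UNIV (\<lambda>q. ?j (0, ?f2 q))"
    by (rule P.msmooth_on_bounded_linear[OF l1 open_UNIV smooth_factors(1)]
        P.msmooth_on_bounded_linear[OF l2 open_UNIV smooth_factors(2)])+
  show "msmooth_on P UNIV \<Phi>"
    unfolding \<Phi> by (rule P.msmooth_on_add[OF open_UNIV s])
  show "mderiv P \<Phi> (p, x, y) (a, b, c) =
    cjoin (\<phi>1 p *s mderiv N1 \<psi>1 x b + mderiv S \<phi>1 p a *s \<psi>1 x)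
      (\<phi>2 p *s mderiv N2 \<psi>2 y c + mderiv S \<phi>2 p a *s \<psi>2 y)"
    unfolding \<Phi> P.mderiv_add[OF s UNIV_I] P.mderiv_bounded_linear[OF l1 smooth_factors(1) UNIV_I]
      P.mderiv_bounded_linear[OF l2 smooth_factors(2) UNIV_I] mderiv_factors
    by (simp add: cjoin_add[OF card])
qed

lemma hprod_mderiv_\<phi>: "hprod (mderiv S \<phi> p a) (mderiv S \<phi> p a') =
    mderiv S \<phi>1 p a * cnj (mderiv S \<phi>1 p a') + mderiv S \<phi>2 p a * cnj (mderiv S \<phi>2 p a')"
  by (simp add: hprod_coord mderiv_\<phi>[unfolded One_nat_def] numeral_2_eq_2)

text \<open>Since \<open>\<psi>\<^sub>j\<close> is a Hermitian unit normal of the totally real space \<open>d\<psi>\<^sub>j\<close>, the Hermitian products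
  of the three groups of tangent vectors do not interact. The real part of this formula is the induced
  metric, and its imaginary part shows that the immersion is Lagrangian.\<close>

lemma hprod_mderiv_\<Phi>:
  "hprod (mderiv P \<Phi> (p, x, y) (a, b, c)) (mderiv P \<Phi> (p, x, y) (a', b', c')) =
    hprod (mderiv S \<phi> p a) (mderiv S \<phi> p a') +
    of_real ((cmod (\<phi>1 p))\<^sup>2 * induced_metric N1 \<psi>1 x b b') +
    of_real ((cmod (\<phi>2 p))\<^sup>2 * induced_metric N2 \<psi>2 y c c')"
proof -
  have cross: "hprod (s *s d + z *s u) (s *s d' + z' *s u) = z * cnj z' + of_real ((cmod s)\<^sup>2 * (d \<bullet> d'))"
    if "hprod u d = 0" "hprod u d' = 0" "hprod u u = 1" "symp d d' = 0"
    for s z z' and u d d' :: "complex ^ 'm::finite"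
  proof -
    have "hprod d u = 0" "hprod d' u = 0"
      using that(1,2) cnj_hprod[of u d] cnj_hprod[of u d'] by simp_all
    hence "hprod (s *s d + z *s u) (s *s d' + z' *s u) = z * cnj z' + (s * cnj s) * hprod d d'"
      using that by (simp add: hprod_add_left hprod_add_right hprod_mult_left hprod_mult_right)
    thus ?thesis
      using hprod_eq_inner[OF that(4)] by (simp add: complex_norm_square[symmetric])
  qed
  note l1 = legendrian_position_normal[OF N.L.smooth_manifold_axioms legendrian1]
    legendrian_symp[OF N.L.smooth_manifold_axioms legendrian1]
  note l2 = legendrian_position_normal[OF N.R.smooth_manifold_axioms legendrian2]
    legendrian_symp[OF N.R.smooth_manifold_axioms legendrian2]
  show ?thesis
    unfolding mderiv_\<Phi> hprod_cjoin[OF card] cross[OF l1(1) l1(1) l1(2) l1(3)] cross[OF l2(1) l2(1) l2(2) l2(3)]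
    by (simp add: hprod_mderiv_\<phi> induced_metric_def)
qed

lemma metric_\<Phi>: "induced_metric P \<Phi> (p, x, y) (a, b, c) (a', b', c') =
    induced_metric S \<phi> p a a' + (cmod (\<phi>1 p))\<^sup>2 * induced_metric N1 \<psi>1 x b b' +
    (cmod (\<phi>2 p))\<^sup>2 * induced_metric N2 \<psi>2 y c c'"
  unfolding induced_metric_def[of P] induced_metric_def[of S] inner_eq_Re_hprod[of "mderiv P \<Phi> _ _"]
    hprod_mderiv_\<Phi> by (simp add: Re_hprod)

lemma mdim_factors: "mdim S = 2" "mdim N1 = CARD('n1) - 1" "mdim N2 = CARD('n2) - 1"
  "mdim N1 + 1 = CARD('n1)" "mdim N2 + 1 = CARD('n2)"
  using lagrangian legendrian1 legendrian2 by (auto simp: lagrangian_immersion_def legendrian_immersion_def)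

lemma lagrangian_\<Phi>: "lagrangian_immersion P \<Phi>"
  unfolding lagrangian_immersion_def immersion_def
proof (intro conjI allI)
  show "mdim P = CARD('n)"
    using mdim_factors(1,4,5) card by (simp add: mdim_mprod)
  show "msmooth_on P UNIV \<Phi>"
    by (rule smooth_\<Phi>)
  fix q :: "'s \<times> 'x \<times> 'y" and v w :: "'e \<times> 'f1 \<times> 'f2"
  obtain p x y where q: "q = (p, x, y)" by (metis prod.collapse)
  obtain a b c a' b' c' where vw: "v = (a, b, c)" "w = (a', b', c')" by (metis prod.collapse)
  have "symp (mderiv S \<phi> p a) (mderiv S \<phi> p a') = 0"
    using lagrangian by (simp add: lagrangian_immersion_def)
  thus "symp (mderiv P \<Phi> q v) (mderiv P \<Phi> q w) = 0"
    unfolding symp_def q vw hprod_mderiv_\<Phi> by simp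
  show "inj (mderiv P \<Phi> q)"
    unfolding linear_injective_0[OF P.linear_mderiv[OF smooth_\<Phi> UNIV_I]]
  proof (intro allI impI)
    fix v assume 0: "mderiv P \<Phi> q v = 0"
    obtain a b c where v: "v = (a, b, c)" by (metis prod.collapse)
    have "induced_metric P \<Phi> q v v = 0"
      using 0 by (simp add: induced_metric_def)
    hence "(norm (mderiv S \<phi> p a))\<^sup>2 + (cmod (\<phi>1 p))\<^sup>2 * (norm (mderiv N1 \<psi>1 x b))\<^sup>2 +
        (cmod (\<phi>2 p))\<^sup>2 * (norm (mderiv N2 \<psi>2 y c))\<^sup>2 = 0"
      unfolding q v metric_\<Phi> by (simp add: induced_metric_def power2_norm_eq_inner)
    hence "mderiv S \<phi> p a = 0" "mderiv N1 \<psi>1 x b = 0" "mderiv N2 \<psi>2 y c = 0"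
      using nonzero1[of p] nonzero2[of p] by (auto simp: add_nonneg_eq_0_iff)
    moreover have "inj (mderiv S \<phi> p)" "inj (mderiv N1 \<psi>1 x)" "inj (mderiv N2 \<psi>2 y)"
      using lagrangian legendrian1 legendrian2
      by (auto simp: lagrangian_immersion_def legendrian_immersion_def immersion_def)
    ultimately show "v = 0"
      using linear_injective_0[OF S.linear_mderiv[OF smooth_\<phi> UNIV_I]]
        linear_injective_0[OF N.L.linear_mderiv[OF smooth_\<psi>1 UNIV_I]]
        linear_injective_0[OF N.R.linear_mderiv[OF smooth_\<psi>2 UNIV_I]]
      by (auto simp: v zero_prod_def)
  qed
qed

text \<open>The model frame of the product consists of the model frames of the factors, which are mapped to
  vectors of exactly the form treated in \<open>cdet_cjoin\<close>.\<close>

lemma frame_cdet_\<Phi>: "frame_cdet P [] \<Phi> (p, x, y) =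
    (- 1) ^ (CARD('n1) - 1) * (frame_cdet S [] \<phi> p * (\<phi>1 p ^ (CARD('n1) - 1) * \<phi>2 p ^ (CARD('n2) - 1))) *
    frame_cdet N1 [\<psi>1] \<psi>1 x * frame_cdet N2 [\<psi>2] \<psi>2 y"
proof -
  obtain e1 e2 where e: "model_frame S = [e1, e2]"
    using mdim_factors(1) unfolding mdim_def by (metis length_0_conv length_Suc_conv numeral_2_eq_2)
  let ?us = "map (mderiv N1 \<psi>1 x) (model_frame N1)" and ?vs = "map (mderiv N2 \<psi>2 y) (model_frame N2)"
  have zero: "mderiv S \<phi>1 p 0 = 0" "mderiv S \<phi>2 p 0 = 0" "mderiv N1 \<psi>1 x 0 = 0" "mderiv N2 \<psi>2 y 0 = 0"
    by (rule linear_0[OF S.linear_mderiv[OF smooth_\<phi>1 UNIV_I]] linear_0[OF S.linear_mderiv[OF smooth_\<phi>2 UNIV_I]]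
        linear_0[OF N.L.linear_mderiv[OF smooth_\<psi>1 UNIV_I]] linear_0[OF N.R.linear_mderiv[OF smooth_\<psi>2 UNIV_I]])+
  have "map (mderiv P \<Phi> (p, x, y)) (model_frame P) =
      [cjoin (mderiv S \<phi>1 p e1 *s \<psi>1 x) (mderiv S \<phi>2 p e1 *s \<psi>2 y),
       cjoin (mderiv S \<phi>1 p e2 *s \<psi>1 x) (mderiv S \<phi>2 p e2 *s \<psi>2 y)] @
      map (\<lambda>u. cjoin (\<phi>1 p *s u) (0 :: complex ^ 'n2::{finite,linorder})) ?us @
      map (\<lambda>v. cjoin (0 :: complex ^ 'n1::{finite,linorder}) (\<phi>2 p *s v)) ?vs"
    by (simp add: model_frame_mprod prod_basis_def e zero_prod_def mderiv_\<Phi> zero comp_def)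
  hence "frame_cdet P [] \<Phi> (p, x, y) = (- 1) ^ length ?us * \<phi>1 p ^ length ?us * \<phi>2 p ^ length ?vs *
      (mderiv S \<phi>1 p e1 * mderiv S \<phi>2 p e2 - mderiv S \<phi>1 p e2 * mderiv S \<phi>2 p e1) *
      cdet (\<psi>1 x # ?us) * cdet (\<psi>2 y # ?vs)"
    using cdet_cjoin[OF card, of ?us ?vs] mdim_factors(4,5)
    by (simp add: frame_cdet_def mdim_def)
  moreover have "frame_cdet S [] \<phi> p = mderiv S \<phi>1 p e1 * mderiv S \<phi>2 p e2 - mderiv S \<phi>1 p e2 * mderiv S \<phi>2 p e1"
    by (simp add: frame_cdet_def e cdet_eq_ndet numeral_2_eq_2 ndet_two mderiv_\<phi>[unfolded One_nat_def])
  ultimately show ?thesis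
    using mdim_factors(2,3) by (simp add: frame_cdet_def mdim_def mult_ac)
qed

definition base_angle :: "'s \<Rightarrow> angle"
  where "base_angle p = lagrangian_angle S \<phi> p
    + angle_mult (CARD('n1) - 1) (carg (\<phi>1 p)) + angle_mult (CARD('n2) - 1) (carg (\<phi>2 p))"

lemmas angle_\<phi> = lagrangian_angle_eq[OF S.smooth_manifold_axioms lagrangian]
lemmas angle_\<psi>1 = legendrian_angle_eq[OF N.L.smooth_manifold_axioms legendrian1]
lemmas angle_\<psi>2 = legendrian_angle_eq[OF N.R.smooth_manifold_axioms legendrian2]
lemmas angle_\<Phi> = lagrangian_angle_eq[OF P.smooth_manifold_axioms lagrangian_\<Phi>]

lemma base_angle_eq: "base_angle p =
    carg (frame_cdet S [] \<phi> p * (\<phi>1 p ^ (CARD('n1) - 1) * \<phi>2 p ^ (CARD('n2) - 1)))"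
  using nonzero1[of p] nonzero2[of p] angle_\<phi>[of p]
  by (simp add: base_angle_def carg_mult carg_power add.assoc)

text \<open>All factors of the determinant are nonzero, so its argument is the sum of their arguments.\<close>

lemma angle_product: "lagrangian_angle P \<Phi> (p, x, y) =
    angle_of (real (CARD('n1) - 1) * pi) + base_angle p + legendrian_angle N1 \<psi>1 x + legendrian_angle N2 \<psi>2 y"
proof -
  let ?k = "\<phi>1 p ^ (CARD('n1) - 1) * \<phi>2 p ^ (CARD('n2) - 1)"
  have nz: "frame_cdet S [] \<phi> p * ?k \<noteq> 0"
    using nonzero1[of p] nonzero2[of p] angle_\<phi>(1)[of p] by simp
  have "lagrangian_angle P \<Phi> (p, x, y) = carg ((- 1) ^ (CARD('n1) - 1) * (frame_cdet S [] \<phi> p * ?k) *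
      frame_cdet N1 [\<psi>1] \<psi>1 x * frame_cdet N2 [\<psi>2] \<psi>2 y)"
    unfolding angle_\<Phi>(2) frame_cdet_\<Phi> ..
  also have "\<dots> = carg ((- 1) ^ (CARD('n1) - 1)) + carg (frame_cdet S [] \<phi> p * ?k) +
      carg (frame_cdet N1 [\<psi>1] \<psi>1 x) + carg (frame_cdet N2 [\<psi>2] \<psi>2 y)"
    using nz angle_\<psi>1(1)[of x] angle_\<psi>2(1)[of y] by (subst carg_mult carg_mult carg_mult; simp)+
  finally show ?thesis
    by (simp only: carg_minus_one_power base_angle_eq angle_\<psi>1(2) angle_\<psi>2(2))
qed

lemma smooth_base_angle: "smooth_angle S base_angle"
proof -
  have "msmooth_on S UNIV (\<lambda>p. \<phi>1 p ^ (CARD('n1) - 1) * \<phi>2 p ^ (CARD('n2) - 1))"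
    by (intro S.msmooth_on_bilinear[OF bounded_bilinear_mult] S.msmooth_on_power smooth_\<phi>1 smooth_\<phi>2 open_UNIV)
  hence "smooth_angle S (\<lambda>p. carg (frame_cdet S [] \<phi> p * (\<phi>1 p ^ (CARD('n1) - 1) * \<phi>2 p ^ (CARD('n2) - 1))))"
    by (intro smooth_angle_frame_cdet[OF S smooth_\<phi>])
       (use mdim_factors(1) angle_\<phi>(1) nonzero1 nonzero2 in auto)
  thus ?thesis
    unfolding base_angle_eq[abs_def] .
qed

lemma smooth_legendrian_angle:
  fixes \<psi> :: "'t::{t2_space,second_countable_topology} \<Rightarrow> complex ^ 'm::{finite,linorder}"
  assumes M: "oriented_manifold M" and \<psi>: "legendrian_immersion M \<psi>"
  shows "smooth_angle M (legendrian_angle M \<psi>)"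
proof -
  note eq = legendrian_angle_eq[OF oriented_imp_smooth_manifold[OF M] \<psi>]
  have "smooth_angle M (\<lambda>x. carg (frame_cdet M [\<psi>] \<psi> x * 1))"
    using \<psi> eq(1)
    by (intro smooth_angle_frame_cdet[OF M])
       (auto simp: legendrian_immersion_def immersion_def msmooth_on_def comp_def smooth_on_const)
  thus ?thesis
    by (simp add: eq(2)[abs_def])
qed

sublocale warped: warped_product S \<phi> N1 \<psi>1 N2 \<psi>2 \<Phi> "\<lambda>p. cmod (\<phi>1 p)" "\<lambda>p. cmod (\<phi>2 p)"
  base_angle "legendrian_angle N1 \<psi>1" "legendrian_angle N2 \<psi>2" "lagrangian_angle P \<Phi>"
  "real (CARD('n1) - 1) * pi"
proof unfold_locales
  show "immersion S \<phi>" "immersion N1 \<psi>1" "immersion N2 \<psi>2" "immersion P \<Phi>"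
    using lagrangian legendrian1 legendrian2 lagrangian_\<Phi>
    by (auto simp: lagrangian_immersion_def legendrian_immersion_def)
  show "smooth_angle N1 (legendrian_angle N1 \<psi>1)" "smooth_angle N2 (legendrian_angle N2 \<psi>2)"
    by (rule smooth_legendrian_angle N1 N2 legendrian1 legendrian2)+
  show "0 < cmod (\<phi>1 p)" "0 < cmod (\<phi>2 p)" for p
    using nonzero1 nonzero2 by simp_all
  show "msmooth_on S UNIV (\<lambda>p. cmod (\<phi>1 p))" "msmooth_on S UNIV (\<lambda>p. cmod (\<phi>2 p))"
    by (rule S.msmooth_on_cmod smooth_\<phi>1 smooth_\<phi>2 nonzero1 nonzero2)+
qed (rule metric_\<Phi> smooth_base_angle angle_product)+

end

theorem theorem2:
  fixes S :: "('s::{t2_space,second_countable_topology}, 'e::real_normed_vector) manifold"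
    and N1 :: "('x::{t2_space,second_countable_topology}, 'f1::real_normed_vector) manifold"
    and N2 :: "('y::{t2_space,second_countable_topology}, 'f2::real_normed_vector) manifold"
    and \<phi>1 \<phi>2 :: "'s \<Rightarrow> complex"
    and \<phi> :: "'s \<Rightarrow> complex ^ 2"
    and \<psi>1 :: "'x \<Rightarrow> complex ^ 'n1::{finite,linorder}"
    and \<psi>2 :: "'y \<Rightarrow> complex ^ 'n2::{finite,linorder}"
    and \<Phi> :: "'s \<times> 'x \<times> 'y \<Rightarrow> complex ^ 'n::{finite,linorder}"
    and P :: "('s \<times> 'x \<times> 'y, 'e \<times> 'f1 \<times> 'f2) manifold"
    and g :: "('s, 'e) metric" and g1 :: "('x, 'f1) metric" and g2 :: "('y, 'f2) metric"
    and gbar :: "('s \<times> 'x \<times> 'y, 'e \<times> 'f1 \<times> 'f2) metric"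
    and \<beta> :: "'s \<times> 'x \<times> 'y \<Rightarrow> angle" and G :: "'s \<Rightarrow> angle"
    and \<beta>1 :: "'x \<Rightarrow> angle" and \<beta>2 :: "'y \<Rightarrow> angle"
  assumes "oriented_manifold S" and "oriented_manifold N1" and "oriented_manifold N2"
    and \<phi>_def: "\<phi> = (\<lambda>p. cvec [\<phi>1 p, \<phi>2 p])"
    and "lagrangian_immersion S \<phi>"
    and "\<forall>p. \<phi>1 p \<noteq> 0" and "\<forall>p. \<phi>2 p \<noteq> 0"
    and "legendrian_immersion N1 \<psi>1" and "legendrian_immersion N2 \<psi>2"
    and "CARD('n1) + CARD('n2) = CARD('n)"
    and \<Phi>_def: "\<Phi> = (\<lambda>(p, x, y). cjoin (\<phi>1 p *s \<psi>1 x) (\<phi>2 p *s \<psi>2 y))"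
    and P_def: "P = S \<times>\<^sub>M N1 \<times>\<^sub>M N2"
    and g_def: "g = induced_metric S \<phi>"
    and g1_def: "g1 = induced_metric N1 \<psi>1"
    and g2_def: "g2 = induced_metric N2 \<psi>2"
    and gbar_def: "gbar = induced_metric P \<Phi>"
    and \<beta>_def: "\<beta> = lagrangian_angle P \<Phi>"
    and \<beta>1_def: "\<beta>1 = legendrian_angle N1 \<psi>1"
    and \<beta>2_def: "\<beta>2 = legendrian_angle N2 \<psi>2"
    and G_def: "G = (\<lambda>p. lagrangian_angle S \<phi> p
        + angle_mult (CARD('n1) - 1) (carg (\<phi>1 p)) + angle_mult (CARD('n2) - 1) (carg (\<phi>2 p)))"
  shows "lagrangian_immersion P \<Phi>
    \<and> (\<forall>p x y a b c a' b' c'. gbar (p, x, y) (a, b, c) (a', b', c') =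
        g p a a' + (cmod (\<phi>1 p))\<^sup>2 * g1 x b b' + (cmod (\<phi>2 p))\<^sup>2 * g2 y c c')
    \<and> (\<forall>p x y. \<beta> (p, x, y) = angle_of (real (CARD('n1) - 1) * pi) + G p + \<beta>1 x + \<beta>2 y)
    \<and> (\<forall>p x y. grad_angle P gbar \<beta> (p, x, y) =
        (grad_angle S g G p,
         (1 / (cmod (\<phi>1 p))\<^sup>2) *\<^sub>R grad_angle N1 g1 \<beta>1 x,
         (1 / (cmod (\<phi>2 p))\<^sup>2) *\<^sub>R grad_angle N2 g2 \<beta>2 y))
    \<and> (\<forall>D D1 D2 Dbar. levi_civita S g D \<and> levi_civita N1 g1 D1 \<and> levi_civita N2 g2 D2
        \<and> levi_civita P gbar Dbar \<longrightarrow>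
        (\<forall>X Y Z p x y. smooth_field_on S UNIV X \<and> smooth_field_on N1 UNIV Y
            \<and> smooth_field_on N2 UNIV Z \<longrightarrow>
          Dbar (p, x, y) (X p, 0, 0) (grad_angle P gbar \<beta>) =
            (D p (X p) (grad_angle S g G),
             (1/2 * mderiv S (\<lambda>q. 1 / (cmod (\<phi>1 q))\<^sup>2) p (X p)) *\<^sub>R grad_angle N1 g1 \<beta>1 x,
             (1/2 * mderiv S (\<lambda>q. 1 / (cmod (\<phi>2 q))\<^sup>2) p (X p)) *\<^sub>R grad_angle N2 g2 \<beta>2 y)
        \<and> Dbar (p, x, y) (0, Y x, 0) (grad_angle P gbar \<beta>) =
            (((cmod (\<phi>1 p))\<^sup>2 / 2 * mderiv_angle N1 \<beta>1 x (Y x)) *\<^sub>R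
               grad S g (\<lambda>q. 1 / (cmod (\<phi>1 q))\<^sup>2) p,
             (1 / (cmod (\<phi>1 p))\<^sup>2) *\<^sub>R D1 x (Y x) (grad_angle N1 g1 \<beta>1)
               - ((cmod (\<phi>1 p))\<^sup>2 / 2 *
                  g p (grad_angle S g G p) (grad S g (\<lambda>q. 1 / (cmod (\<phi>1 q))\<^sup>2) p)) *\<^sub>R Y x,
             0)
        \<and> Dbar (p, x, y) (0, 0, Z y) (grad_angle P gbar \<beta>) =
            (((cmod (\<phi>2 p))\<^sup>2 / 2 * mderiv_angle N2 \<beta>2 y (Z y)) *\<^sub>R
               grad S g (\<lambda>q. 1 / (cmod (\<phi>2 q))\<^sup>2) p,
             0,
             (1 / (cmod (\<phi>2 p))\<^sup>2) *\<^sub>R D2 y (Z y) (grad_angle N2 g2 \<beta>2)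
               - ((cmod (\<phi>2 p))\<^sup>2 / 2 *
                  g p (grad_angle S g G p) (grad S g (\<lambda>q. 1 / (cmod (\<phi>2 q))\<^sup>2) p)) *\<^sub>R Z y))
        \<and> (\<forall>p x y. laplacian_angle P gbar Dbar \<beta> (p, x, y) =
            1 / (cmod (\<phi>1 p) ^ (CARD('n1) - 1) * cmod (\<phi>2 p) ^ (CARD('n2) - 1)) *
              mdiv S D (\<lambda>q. (cmod (\<phi>1 q) ^ (CARD('n1) - 1) * cmod (\<phi>2 q) ^ (CARD('n2) - 1)) *\<^sub>R
                grad_angle S g G q) p
            + laplacian_angle N1 g1 D1 \<beta>1 x / (cmod (\<phi>1 p))\<^sup>2
            + laplacian_angle N2 g2 D2 \<beta>2 y / (cmod (\<phi>2 p))\<^sup>2))"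
proof -
  interpret lagrangian_legendrian S N1 N2 \<phi>1 \<phi>2 \<phi> \<psi>1 \<psi>2 \<Phi>
    using assms by (intro lagrangian_legendrian.intro) auto
  have G: "G = base_angle"
    by (simp add: G_def base_angle_def fun_eq_iff)
  note defs = P_def g_def g1_def g2_def gbar_def \<beta>_def \<beta>1_def \<beta>2_def G
  have zero: "mderiv_angle N1 \<beta>1 x 0 = 0" "mderiv_angle N2 \<beta>2 y 0 = 0"
    "mderiv S (\<lambda>p. 1 / (cmod (\<phi>1 p))\<^sup>2) p 0 = 0" "mderiv S (\<lambda>p. 1 / (cmod (\<phi>2 p))\<^sup>2) p 0 = 0" for p x y
    unfolding defs
    by (rule linear_0 N.L.linear_mderiv_angle N.R.linear_mderiv_angle warped.\<beta>1 warped.\<beta>2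
        S.linear_mderiv[OF _ UNIV_I] warped.s1_smooth warped.s2_smooth)+
  have lin0: "D p 0 (grad_angle S g G) = 0" if "levi_civita S g D" for D p
    using that unfolding defs by (rule linear_0[OF levi_civita_linear[OF _ warped.S.smooth_grad_angle[OF warped.G]]])
  have lin1: "D x 0 (grad_angle N1 g1 \<beta>1) = 0" if "levi_civita N1 g1 D" for D x
    using that unfolding defs by (rule linear_0[OF levi_civita_linear[OF _ warped.N1.smooth_grad_angle[OF warped.\<beta>1]]])
  have lin2: "D y 0 (grad_angle N2 g2 \<beta>2) = 0" if "levi_civita N2 g2 D" for D y
    using that unfolding defs by (rule linear_0[OF levi_civita_linear[OF _ warped.N2.smooth_grad_angle[OF warped.\<beta>2]]])
  have card1: "CARD('n1) - 1 = mdim N1" "CARD('n2) - 1 = mdim N2"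
    using mdim_factors by auto
  show ?thesis
  proof (intro conjI allI impI)
    show "lagrangian_immersion P \<Phi>"
      unfolding P_def by (rule lagrangian_\<Phi>)
    show "gbar (p, x, y) (a, b, c) (a', b', c') =
        g p a a' + (cmod (\<phi>1 p))\<^sup>2 * g1 x b b' + (cmod (\<phi>2 p))\<^sup>2 * g2 y c c'" for p x y a b c a' b' c'
      unfolding defs by (rule metric_\<Phi>)
    show "\<beta> (p, x, y) = angle_of (real (CARD('n1) - 1) * pi) + G p + \<beta>1 x + \<beta>2 y" for p x y
      unfolding defs by (rule angle_product)
    show "grad_angle P gbar \<beta> (p, x, y) =
        (grad_angle S g G p,
         (1 / (cmod (\<phi>1 p))\<^sup>2) *\<^sub>R grad_angle N1 g1 \<beta>1 x,
         (1 / (cmod (\<phi>2 p))\<^sup>2) *\<^sub>R grad_angle N2 g2 \<beta>2 y)" for p x y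
      unfolding defs by (rule warped.gradient)
    fix D D1 D2 Dbar
    assume LC: "levi_civita S g D \<and> levi_civita N1 g1 D1 \<and> levi_civita N2 g2 D2 \<and> levi_civita P gbar Dbar"
    hence lc: "levi_civita S g D" "levi_civita N1 g1 D1" "levi_civita N2 g2 D2" "levi_civita P gbar Dbar"
      by auto
    note cov = warped.covariant_derivative_warped[OF lc[unfolded defs], folded P_def, folded defs]
    fix X Y Z p x y
    show "Dbar (p, x, y) (X p, 0, 0) (grad_angle P gbar \<beta>) =
            (D p (X p) (grad_angle S g G),
             (1/2 * mderiv S (\<lambda>q. 1 / (cmod (\<phi>1 q))\<^sup>2) p (X p)) *\<^sub>R grad_angle N1 g1 \<beta>1 x,
             (1/2 * mderiv S (\<lambda>q. 1 / (cmod (\<phi>2 q))\<^sup>2) p (X p)) *\<^sub>R grad_angle N2 g2 \<beta>2 y)"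
      unfolding cov by (simp add: zero lin0[OF lc(1)] lin1[OF lc(2)] lin2[OF lc(3)])
    show "Dbar (p, x, y) (0, Y x, 0) (grad_angle P gbar \<beta>) =
            (((cmod (\<phi>1 p))\<^sup>2 / 2 * mderiv_angle N1 \<beta>1 x (Y x)) *\<^sub>R
               grad S g (\<lambda>q. 1 / (cmod (\<phi>1 q))\<^sup>2) p,
             (1 / (cmod (\<phi>1 p))\<^sup>2) *\<^sub>R D1 x (Y x) (grad_angle N1 g1 \<beta>1)
               - ((cmod (\<phi>1 p))\<^sup>2 / 2 *
                  g p (grad_angle S g G p) (grad S g (\<lambda>q. 1 / (cmod (\<phi>1 q))\<^sup>2) p)) *\<^sub>R Y x,
             0)"
      unfolding cov by (simp add: zero lin0[OF lc(1)] lin1[OF lc(2)] lin2[OF lc(3)])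
    show "Dbar (p, x, y) (0, 0, Z y) (grad_angle P gbar \<beta>) =
            (((cmod (\<phi>2 p))\<^sup>2 / 2 * mderiv_angle N2 \<beta>2 y (Z y)) *\<^sub>R
               grad S g (\<lambda>q. 1 / (cmod (\<phi>2 q))\<^sup>2) p,
             0,
             (1 / (cmod (\<phi>2 p))\<^sup>2) *\<^sub>R D2 y (Z y) (grad_angle N2 g2 \<beta>2)
               - ((cmod (\<phi>2 p))\<^sup>2 / 2 *
                  g p (grad_angle S g G p) (grad S g (\<lambda>q. 1 / (cmod (\<phi>2 q))\<^sup>2) p)) *\<^sub>R Z y)"
      unfolding cov by (simp add: zero lin0[OF lc(1)] lin1[OF lc(2)] lin2[OF lc(3)])
  next
    fix D D1 D2 Dbar p x y
    assume LC: "levi_civita S g D \<and> levi_civita N1 g1 D1 \<and> levi_civita N2 g2 D2 \<and> levi_civita P gbar Dbar"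
    hence lc: "levi_civita S g D" "levi_civita N1 g1 D1" "levi_civita N2 g2 D2" "levi_civita P gbar Dbar"
      by auto
    show "laplacian_angle P gbar Dbar \<beta> (p, x, y) =
            1 / (cmod (\<phi>1 p) ^ (CARD('n1) - 1) * cmod (\<phi>2 p) ^ (CARD('n2) - 1)) *
              mdiv S D (\<lambda>q. (cmod (\<phi>1 q) ^ (CARD('n1) - 1) * cmod (\<phi>2 q) ^ (CARD('n2) - 1)) *\<^sub>R
                grad_angle S g G q) p
            + laplacian_angle N1 g1 D1 \<beta>1 x / (cmod (\<phi>1 p))\<^sup>2
            + laplacian_angle N2 g2 D2 \<beta>2 y / (cmod (\<phi>2 p))\<^sup>2"
      using warped.laplacian_warped[OF lc[unfolded defs]] unfolding defs card1 .
  qed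
qed

end
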